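(* Let $u$ be a nonnegative weak subsolution of $\partial_t u-\operatorname{div}\mathcal A(Du)=0$ in $\Omega_T$. Then $u\in L^\infty_{\rm loc}(\Omega_T)$.
   Context: Standing setting. $n\ge 2$, $\Omega\subset\mathbb R^n$ is a bounded domain, $T>0$, $\Omega_T=\Omega\times(0,T)$. The function $g:[0,\infty)\to[0,\infty)$ is $C^1$, positive on $(0,\infty)$, and satisfies $g_0-1\le \frac{s g'(s)}{g(s)}\le g_1-1$ for all $s>0$, where $\frac{2n}{n+2}<g_0\le g_1<\infty$; it is normalized by $\int_0^1 g(\rho)\,d\rho=1$. Put $G(s)=\int_0^s g(r)\,dr$. The vector field $\mathcal A:\mathbb R^n\to\mathbb R^n$ is $C^1$ with $\mathcal A(0)=0$, and for some $0<\nu\le 1\le L$ it satisfies $\langle D\mathcal A(\xi)\zeta,\zeta\rangle\ge \nu\frac{g(|\xi|)}{|\xi|}|\zeta|^2$ and $|D\mathcal A(\xi)|\le L\frac{g(|\xi|)}{|\xi|}$ for all $\xi\in\mathbb R^n\setminus\{0\}$, $\zeta\in\mathbb R^n$. Function spaces. $L^G(E)$ is the space of measurable $u$ on $E$ with $\int_E G(|u|)<\infty$. For a cylinder $\mathcal K=D\times(t_1,t_2)$, $V^G(\mathcal K)$ is the space of $u\in L^G(\mathcal K)\cap L^1(t_1,t_2;W^{1,1}(D))$ whose weak spatial gradient $Du$ lies in $L^G(\mathcal K)$, and $V^{2,G}(\mathcal K)=L^\infty(t_1,t_2;L^2(D))\cap V^G(\mathcal K)$. $u\in V^{2,G}_{\rm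 loc}(\Omega_T)$ (resp. $L^\infty_{\rm loc}(\Omega_T)$) means $u\in V^{2,G}(\mathcal K)$ (resp. $L^\infty(\mathcal K)$) for every cylinder $\mathcal K$ whose closure is a compact subset of $\Omega_T$. Weak subsolution in $\Omega_T$: $u\in V^{2,G}_{\rm loc}(\Omega_T)$ and $-\int_{\Omega_T} u\,\partial_t\eta\,dx\,dt+\int_{\Omega_T} \mathcal A(Du)\cdot D\eta\,dx\,dt\le 0$ for every nonnegative $\eta\in C_c^\infty(\Omega_T)$. *)

theory Defs
  imports "HOL-Analysis.Analysis"
begin

primrec C_k_on :: "nat \<Rightarrow> ('a::euclidean_space \<Rightarrow> real) \<Rightarrow> 'a set \<Rightarrow> bool" where
  "C_k_on 0 f S \<longleftrightarrow> continuous_on S f"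
| "C_k_on (Suc k) f S \<longleftrightarrow> (\<forall>x\<in>S. f differentiable (at x)) \<and>
     (\<forall>v. C_k_on k (\<lambda>x. frechet_derivative f (at x) v) S)"

text \<open>\<open>C\<^sub>c\<^sup>\<infinity>(E)\<close> for open \<open>E\<close>; its members are extended by zero to the whole space.\<close>

definition test_functions :: "'a::euclidean_space set \<Rightarrow> ('a \<Rightarrow> real) set" where
  "test_functions E = {\<phi>. (\<forall>k. C_k_on k \<phi> UNIV) \<and>
     compact (closure {x. \<phi> x \<noteq> 0}) \<and> closure {x. \<phi> x \<noteq> 0} \<subseteq> E}"

definition locally_integrable :: "'a::euclidean_space set \<Rightarrow> ('a \<Rightarrow> 'b::euclidean_space) \<Rightarrow> bool" where
  "locally_integrable E f \<longleftrightarrow> (\<forall>C. compact C \<and> C \<subseteq> E \<longrightarrow> integrable (lebesgue_on C) f)"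

definition weak_gradient :: "'a::euclidean_space set \<Rightarrow> ('a \<Rightarrow> real) \<Rightarrow> ('a \<Rightarrow> 'a) \<Rightarrow> bool" where
  "weak_gradient D f v \<longleftrightarrow> locally_integrable D f \<and> locally_integrable D v \<and>
     (\<forall>\<phi>\<in>test_functions D. \<forall>b\<in>Basis.
        integral\<^sup>L (lebesgue_on D) (\<lambda>x. f x * frechet_derivative \<phi> (at x) b)
        = - integral\<^sup>L (lebesgue_on D) (\<lambda>x. (v x \<bullet> b) * \<phi> x))"

text \<open>Functions on space-time are functions of pairs \<open>(x, t)\<close>. The joint measurability of the
  gradient has to be demanded, since it does not follow from the condition on time slices.\<close>

definition weak_spatial_gradient ::
    "'a::euclidean_space set \<Rightarrow> real \<Rightarrow> real \<Rightarrow> ('a \<times> real \<Rightarrow> real) \<Rightarrow> ('a \<times> real \<Rightarrow> 'a) \<Rightarrow> bool" where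
  "weak_spatial_gradient D t\<^sub>1 t\<^sub>2 u v \<longleftrightarrow>
     u \<in> borel_measurable (lebesgue_on (D \<times> {t\<^sub>1<..<t\<^sub>2})) \<and>
     v \<in> borel_measurable (lebesgue_on (D \<times> {t\<^sub>1<..<t\<^sub>2})) \<and>
     (AE t in lebesgue_on {t\<^sub>1<..<t\<^sub>2}. weak_gradient D (\<lambda>x. u (x, t)) (\<lambda>x. v (x, t)))"

text \<open>\<open>L\<^sup>1(t\<^sub>1,t\<^sub>2;W\<^sup>1\<^sup>,\<^sup>1(D))\<close>. As \<open>W\<^sup>1\<^sup>,\<^sup>1(D)\<close> is separable, joint measurability of
  the function and its gradient makes \<open>t \<mapsto> u(\<cdot>,t)\<close> strongly measurable.\<close>

definition L1_W11 :: "'a::euclidean_space set \<Rightarrow> real \<Rightarrow> real \<Rightarrow> ('a \<times> real \<Rightarrow> real) set" where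
  "L1_W11 D t\<^sub>1 t\<^sub>2 = {u. \<exists>v. weak_spatial_gradient D t\<^sub>1 t\<^sub>2 u v \<and>
     (AE t in lebesgue_on {t\<^sub>1<..<t\<^sub>2}.
        integrable (lebesgue_on D) (\<lambda>x. u (x, t)) \<and> integrable (lebesgue_on D) (\<lambda>x. v (x, t))) \<and>
     integrable (lebesgue_on {t\<^sub>1<..<t\<^sub>2})
       (\<lambda>t. integral\<^sup>L (lebesgue_on D) (\<lambda>x. \<bar>u (x, t)\<bar>) +
            integral\<^sup>L (lebesgue_on D) (\<lambda>x. norm (v (x, t))))}"

definition Linf_L2 :: "'a::euclidean_space set \<Rightarrow> real \<Rightarrow> real \<Rightarrow> ('a \<times> real \<Rightarrow> real) set" where
  "Linf_L2 D t\<^sub>1 t\<^sub>2 = {u. u \<in> borel_measurable (lebesgue_on (D \<times> {t\<^sub>1<..<t\<^sub>2})) \<and>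
     (\<exists>C. AE t in lebesgue_on {t\<^sub>1<..<t\<^sub>2}.
        integrable (lebesgue_on D) (\<lambda>x. (u (x, t))\<^sup>2) \<and>
        integral\<^sup>L (lebesgue_on D) (\<lambda>x. (u (x, t))\<^sup>2) \<le> C)}"

definition primitive :: "(real \<Rightarrow> real) \<Rightarrow> real \<Rightarrow> real" where
  "primitive g s = integral {0..s} g"

definition L_G :: "(real \<Rightarrow> real) \<Rightarrow> 'a::euclidean_space set \<Rightarrow> ('a \<Rightarrow> 'b::euclidean_space) set" where
  "L_G g E = {u. u \<in> borel_measurable (lebesgue_on E) \<and>
     (\<integral>\<^sup>+ x. ennreal (primitive g (norm (u x))) \<partial>lebesgue_on E) < \<infinity>}"

definition V_G :: "(real \<Rightarrow> real) \<Rightarrow> 'a::euclidean_space set \<Rightarrow> real \<Rightarrow> real \<Rightarrow> ('a \<times> real \<Rightarrow> real) set" where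
  "V_G g D t\<^sub>1 t\<^sub>2 = {u \<in> L_G g (D \<times> {t\<^sub>1<..<t\<^sub>2}) \<inter> L1_W11 D t\<^sub>1 t\<^sub>2.
     \<exists>v. weak_spatial_gradient D t\<^sub>1 t\<^sub>2 u v \<and> v \<in> L_G g (D \<times> {t\<^sub>1<..<t\<^sub>2})}"

definition V2_G :: "(real \<Rightarrow> real) \<Rightarrow> 'a::euclidean_space set \<Rightarrow> real \<Rightarrow> real \<Rightarrow> ('a \<times> real \<Rightarrow> real) set" where
  "V2_G g D t\<^sub>1 t\<^sub>2 = Linf_L2 D t\<^sub>1 t\<^sub>2 \<inter> V_G g D t\<^sub>1 t\<^sub>2"

definition L_inf :: "'a::euclidean_space set \<Rightarrow> ('a \<Rightarrow> real) set" where
  "L_inf E = {u. u \<in> borel_measurable (lebesgue_on E) \<and> (\<exists>M. AE z in lebesgue_on E. \<bar>u z\<bar> \<le> M)}"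

definition compact_cylinder ::
    "'a::euclidean_space set \<Rightarrow> real \<Rightarrow> 'a set \<Rightarrow> real \<Rightarrow> real \<Rightarrow> bool" where
  "compact_cylinder \<Omega> T D t\<^sub>1 t\<^sub>2 \<longleftrightarrow> open D \<and> t\<^sub>1 < t\<^sub>2 \<and>
     compact (closure (D \<times> {t\<^sub>1<..<t\<^sub>2})) \<and> closure (D \<times> {t\<^sub>1<..<t\<^sub>2}) \<subseteq> \<Omega> \<times> {0<..<T}"

definition V2_G_loc :: "(real \<Rightarrow> real) \<Rightarrow> 'a::euclidean_space set \<Rightarrow> real \<Rightarrow> ('a \<times> real \<Rightarrow> real) set" where
  "V2_G_loc g \<Omega> T = {u. \<forall>D t\<^sub>1 t\<^sub>2. compact_cylinder \<Omega> T D t\<^sub>1 t\<^sub>2 \<longrightarrow> u \<in> V2_G g D t\<^sub>1 t\<^sub>2}"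

definition L_inf_loc :: "'a::euclidean_space set \<Rightarrow> real \<Rightarrow> ('a \<times> real \<Rightarrow> real) set" where
  "L_inf_loc \<Omega> T = {u. \<forall>D t\<^sub>1 t\<^sub>2. compact_cylinder \<Omega> T D t\<^sub>1 t\<^sub>2 \<longrightarrow> u \<in> L_inf (D \<times> {t\<^sub>1<..<t\<^sub>2})}"

definition time_deriv :: "('a::euclidean_space \<times> real \<Rightarrow> real) \<Rightarrow> 'a \<times> real \<Rightarrow> real" where
  "time_deriv \<eta> z = frechet_derivative \<eta> (at z) (0, 1)"

definition space_grad :: "('a::euclidean_space \<times> real \<Rightarrow> real) \<Rightarrow> 'a \<times> real \<Rightarrow> 'a" where
  "space_grad \<eta> z = (\<Sum>b\<in>Basis. frechet_derivative \<eta> (at z) (b, 0) *\<^sub>R b)"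

text \<open>For \<open>u\<close> in \<open>V2_G_loc g \<Omega> T\<close> the weak spatial gradient \<open>v\<close> on all of \<open>\<Omega> \<times> (0,T)\<close> exists and
  is unique almost everywhere, so the existential quantifier only gives it a name.\<close>

definition weak_subsolution ::
    "(real \<Rightarrow> real) \<Rightarrow> ('a \<Rightarrow> 'a) \<Rightarrow> 'a::euclidean_space set \<Rightarrow> real \<Rightarrow> ('a \<times> real \<Rightarrow> real) \<Rightarrow> bool" where
  "weak_subsolution g A \<Omega> T u \<longleftrightarrow> u \<in> V2_G_loc g \<Omega> T \<and>
     (\<exists>v. weak_spatial_gradient \<Omega> 0 T u v \<and>
        (\<forall>\<eta>\<in>test_functions (\<Omega> \<times> {0<..<T}). (\<forall>z. 0 \<le> \<eta> z) \<longrightarrow>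
           - integral\<^sup>L (lebesgue_on (\<Omega> \<times> {0<..<T})) (\<lambda>z. u z * time_deriv \<eta> z)
           + integral\<^sup>L (lebesgue_on (\<Omega> \<times> {0<..<T})) (\<lambda>z. A (v z) \<bullet> space_grad \<eta> z) \<le> 0))"

end

theory Submission
  imports Defs
begin

text \<open>
  Mollifying \<open>u\<close> in space-time turns the weak inequality into the pointwise inequality
  \<open>\<partial>\<^sub>t u\<^sub>\<epsilon> \<le> div (A(Du))\<^sub>\<epsilon>\<close>. Multiplying it by a C1 truncation of \<open>u\<^sub>\<epsilon> - k\<close> times a
  cutoff and letting \<open>\<epsilon> \<rightarrow> 0\<close>, with the mollification of \<open>u\<^sup>2 + G(|u|) + G(|Du|)\<close> as convergent
  majorant, gives a Caccioppoli estimate. No Sobolev embedding is needed: the energy controls the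
  modular of difference quotients of a truncation \<open>f\<close> of \<open>u\<close>, and comparing \<open>f\<close> with its values on a
  ball of radius \<open>h\<close>, chosen from the \<open>L\<^sup>2\<close> bound on time slices, yields a weak-type estimate of
  \<open>|{f > l}|\<close>. Its exponent \<open>p (n + 2) / n\<close> exceeds 2 exactly when \<open>p > 2 n / (n + 2)\<close>, so De Giorgi's
  iteration over levels and shrinking space-time balls converges.
\<close>

subsection \<open>Smooth bump functions\<close>

text \<open>The function \<open>u\<close> has no time derivative and cannot serve as a test
  function. The weak inequality is therefore tested only with the mollification kernels themselves.
  Smoothness of every order is needed for this single family; truncations and cutoffs act on
  mollified functions and need only be of class C1. The square of the positive part is not regular
  enough for the chain rule used after mollification, since its second derivative jumps. A smoother
  substitute \<open>trunc0\<close> replaces it. Its derivative \<open>trunc1\<close> is only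
  quadratic near 0, so it controls the positive part from a distance \<open>d\<close> on, at the
  cost of a factor \<open>d\<close>. Hence the negative powers of \<open>d\<close> in each step,
  which the iteration tolerates because they grow only geometrically. The other obstacle is that
  \<open>G\<close> is not homogeneous: squares and \<open>G\<close> of the truncation both occur in
  the energy and no scaling makes them comparable. Both are carried along in one quantity,
  \<open>excess\<close>, and smallness at the start is obtained by dominated convergence from a high
  initial level.\<close>

lemma DERIV_zero_of_quadratic_bound:
  fixes f :: "real \<Rightarrow> real"
  assumes "\<And>s. \<bar>f s\<bar> \<le> C * s\<^sup>2"
  shows "(f has_real_derivative 0) (at 0)"
proof -
  have f0: "f 0 = 0" using assms[of 0] by simp
  have "((\<lambda>h. f h / h) \<longlongrightarrow> 0) (at 0)"
  proof (rule Lim_null_comparison)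
    show "\<forall>\<^sub>F h in at 0. norm (f h / h) \<le> C * \<bar>h\<bar>"
    proof (rule eventually_at_filter[THEN iffD2], intro always_eventually allI impI)
      fix h :: real assume "h \<noteq> 0"
      then show "norm (f h / h) \<le> C * \<bar>h\<bar>"
        using assms[of h] by (simp add: field_simps power2_eq_square abs_mult_self_eq)
    qed
    show "((\<lambda>h. C * \<bar>h\<bar>) \<longlongrightarrow> 0) (at 0)"
      by (auto intro!: tendsto_eq_intros)
  qed
  then show ?thesis by (simp add: DERIV_def f0)
qed

text \<open>The quadratic bound kills the difference quotient at 0, so a function on the positive
  half-line glues to zero. All one-sided functions below (\<open>psi\<close>, \<open>trunc0\<close>,
  \<open>trunc1\<close>, \<open>sqpos\<close>) are differentiated this way.\<close>

lemma DERIV_zero_ext_pos: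
  fixes f F F' :: "real \<Rightarrow> real"
  assumes pos: "\<And>s. s > 0 \<Longrightarrow> f s = F s" and neg: "\<And>s. s \<le> 0 \<Longrightarrow> f s = 0"
    and der: "\<And>s. s > 0 \<Longrightarrow> (F has_real_derivative F' s) (at s)"
    and bd: "\<And>s. s > 0 \<Longrightarrow> \<bar>F s\<bar> \<le> C * s\<^sup>2"
  shows "(f has_real_derivative (if s > 0 then F' s else 0)) (at s)"
proof -
  consider "s > 0" | "s = 0" | "s < 0" by linarith
  then show ?thesis
  proof cases
    case 1
    have "(f has_real_derivative F' s) (at s)"
      by (rule has_field_derivative_transform_within_open[OF der[OF 1], of "{0<..}"])
         (use 1 pos in auto)
    then show ?thesis using 1 by simp
  next
    case 2
    have C: "C \<ge> 0" using bd[of 1] by simp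
    have "(f has_real_derivative 0) (at 0)"
    proof (rule DERIV_zero_of_quadratic_bound)
      fix s :: real show "\<bar>f s\<bar> \<le> C * s\<^sup>2"
        using bd[of s] pos[of s] neg[of s] C by (cases "s > 0") auto
    qed
    then show ?thesis using 2 by simp
  next
    case 3
    have "(f has_real_derivative 0) (at s)"
      by (rule has_field_derivative_transform_within_open[of "\<lambda>_. 0" _ _ "{..<0}"])
         (use 3 neg in auto)
    then show ?thesis using 3 by simp
  qed
qed

text \<open>\<open>psi 0\<close> is the classical flat function exp(-1/s). The extra powers of 1/s
  make the family closed under differentiation up to linear combinations.\<close>

definition psi :: "nat \<Rightarrow> real \<Rightarrow> real" where
  "psi j s = (if s > 0 then exp (- (1 / s)) / s ^ j else 0)"

lemma power_div_fact_le_exp: "x \<ge> 0 \<Longrightarrow> x ^ m / fact m \<le> exp (x::real)"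
proof -
  assume x: "x \<ge> 0"
  have "(\<Sum>n\<in>{m}. x ^ n /\<^sub>R fact n) \<le> (\<Sum>n. x ^ n /\<^sub>R fact n)"
    by (rule sum_le_suminf[OF summable_exp_generic]) (use x in auto)
  then show ?thesis by (simp add: exp_def field_simps)
qed

lemma psi_nonneg: "psi j s \<ge> 0"
  by (simp add: psi_def)

text \<open>One term of the exponential series at 1/s, the one of order \<open>j + 2\<close>, beats
  the pole of order \<open>j\<close> and leaves the two powers of \<open>s\<close> that
  \<open>DERIV_zero_ext_pos\<close> asks for.\<close>

lemma psi_bound: "psi j s \<le> fact (j + 2) * s\<^sup>2"
proof (cases "s > 0")
  case True
  define F :: real where "F = fact (j + 2)"
  have F: "F > 0" by (simp add: F_def)
  have "(1/s) ^ (j+2) / F \<le> exp (1/s)"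
    unfolding F_def by (rule power_div_fact_le_exp) (use True in simp)
  then have "exp (-(1/s)) \<le> F * s ^ (j+2)"
    using True F by (simp add: exp_minus field_simps)
  then have "exp (-(1/s)) / s ^ j \<le> F * s\<^sup>2"
    using True by (simp add: field_simps power_add power2_eq_square)
  then show ?thesis using True by (simp add: psi_def F_def)
qed (simp add: psi_def)

lemma DERIV_psi: "(psi j has_real_derivative (psi (j+2) s - real j * psi (j+1) s)) (at s)"
proof -
  let ?F = "\<lambda>s::real. exp (- (1 / s)) / s ^ j"
  let ?F' = "\<lambda>s::real. exp (- (1 / s)) / s ^ (j+2) - real j * (exp (- (1 / s)) / s ^ (j+1))"
  have "(psi j has_real_derivative (if s > 0 then ?F' s else 0)) (at s)"
  proof (rule DERIV_zero_ext_pos[where F = ?F and C = "fact (j+2)"])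
    fix s :: real assume s: "s > 0"
    show "psi j s = ?F s" using s by (simp add: psi_def)
    show "\<bar>?F s\<bar> \<le> fact (j+2) * s\<^sup>2" using psi_bound[of j s] s by (simp add: psi_def)
    have *: "(?F has_real_derivative (exp (- (1 / s)) * (1 / s\<^sup>2) * s ^ j - exp (- (1 / s)) * (real j * s ^ (j - 1))) / (s^j * s^j)) (at s)"
      using s by (auto intro!: derivative_eq_intros simp: power2_eq_square)
    have "(exp (- (1 / s)) * (1 / s\<^sup>2) * s ^ j - exp (- (1 / s)) * (real j * s ^ (j - 1))) / (s^j * s^j) = ?F' s"
    \<comment> \<open>The truncated subtraction \<open>j - 1\<close> is harmless for
      \<open>j = 0\<close> because its coefficient \<open>real j\<close> vanishes.\<close>
    proof (cases j)
      case 0 then show ?thesis by (simp add: power2_eq_square)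
    next
      case (Suc i)
      then show ?thesis using s by (simp add: field_simps power2_eq_square)
    qed
    with * show "(?F has_real_derivative ?F' s) (at s)" by simp
  qed (simp add: psi_def)
  then show ?thesis by (auto simp: psi_def split: if_splits)
qed

lemma psi_measurable [measurable]: "psi j \<in> borel_measurable borel"
  by (rule borel_measurable_continuous_onI, rule DERIV_continuous_on, rule DERIV_psi)

text \<open>The parameter \<open>a\<close> is the square of the radius. A time slice of a space-time
  bump is then a spatial bump with a smaller \<open>a\<close>; a nonpositive \<open>a\<close> gives
  the zero function.\<close>

definition bump :: "real \<Rightarrow> 'a::euclidean_space \<Rightarrow> 'a \<Rightarrow> real" where
  "bump a c z = psi 0 (a - (norm (z - c))\<^sup>2)"

definition dbump :: "real \<Rightarrow> 'a::euclidean_space \<Rightarrow> 'a \<Rightarrow> 'a \<Rightarrow> real" where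
  "dbump a c z v = - 2 * psi 2 (a - (norm (z - c))\<^sup>2) * ((z - c) \<bullet> v)"

text \<open>A class containing the bump and stable under directional derivatives. Differentiability
  of its members and this stability give all orders of smoothness by one induction.\<close>

inductive_set bump_span :: "real \<Rightarrow> 'a::euclidean_space \<Rightarrow> ('a \<Rightarrow> real) set" for a :: real and c :: 'a where
  base: "(\<lambda>z. psi j (a - (norm (z - c))\<^sup>2)) \<in> bump_span a c"
| mult: "f \<in> bump_span a c \<Longrightarrow> (\<lambda>z. ((z - c) \<bullet> w) * f z) \<in> bump_span a c"
| add: "f \<in> bump_span a c \<Longrightarrow> g \<in> bump_span a c \<Longrightarrow> (\<lambda>z. f z + g z) \<in> bump_span a c"
| scale: "f \<in> bump_span a c \<Longrightarrow> (\<lambda>z. r * f z) \<in> bump_span a c"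

lemma has_derivative_psi_norm:
  "((\<lambda>z::'a::euclidean_space. psi j (a - (norm (z - c))\<^sup>2)) has_derivative
     (\<lambda>v. (psi (j+2) (a - (norm (z - c))\<^sup>2) - real j * psi (j+1) (a - (norm (z - c))\<^sup>2)) * (- 2 * ((z - c) \<bullet> v)))) (at z)"
proof -
  have 1: "((\<lambda>z::'a. a - (norm (z - c))\<^sup>2) has_derivative (\<lambda>v. - 2 * ((z - c) \<bullet> v))) (at z)"
    unfolding power2_norm_eq_inner
    by (auto intro!: derivative_eq_intros simp: inner_commute)
  have 2: "(psi j has_derivative (\<lambda>x. (psi (j+2) (a - (norm (z - c))\<^sup>2) - real j * psi (j+1) (a - (norm (z - c))\<^sup>2)) * x)) (at (a - (norm (z - c))\<^sup>2))"
    using DERIV_psi[of j "a - (norm (z - c))\<^sup>2"] by (simp add: has_field_derivative_def)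
  show ?thesis
    using diff_chain_at[OF 1 2] by (simp add: o_def)
qed

lemma has_derivative_bump: "(bump a c has_derivative dbump a c z) (at z)"
  using has_derivative_psi_norm[of 0 a c z]
  by (simp add: bump_def[abs_def] dbump_def[abs_def] algebra_simps numeral_2_eq_2)

lemma bump_span_deriv:
  assumes "f \<in> bump_span a c"
  shows "\<exists>f'. (\<forall>z. (f has_derivative f' z) (at z)) \<and> (\<forall>v. (\<lambda>z. f' z v) \<in> bump_span a c)"
  using assms
proof induction
  case (base j)
  let ?D = "\<lambda>z v. (psi (j+2) (a - (norm (z - c))\<^sup>2) - real j * psi (j+1) (a - (norm (z - c))\<^sup>2)) * (- 2 * ((z - c) \<bullet> v))"
  have "(\<lambda>z. ?D z v) \<in> bump_span a c" for v
  proof -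
    have "(\<lambda>z. ((z - c) \<bullet> v) * (-2 * (psi (j+2) (a - (norm (z - c))\<^sup>2) + (- real j) * psi (j+1) (a - (norm (z - c))\<^sup>2)))) \<in> bump_span a c"
      by (intro bump_span.intros)
    then show ?thesis by (simp add: algebra_simps)
  qed
  then show ?case using has_derivative_psi_norm by (intro exI[of _ ?D]) blast
next
  case (mult f w)
  then obtain f' where f': "\<And>z. (f has_derivative f' z) (at z)" "\<And>v. (\<lambda>z. f' z v) \<in> bump_span a c" by blast
  have w0: "(\<lambda>z. (v \<bullet> w) * f z) \<in> bump_span a c" for v
    using mult(1) by (rule bump_span.scale)
  show ?case
    by (rule exI[of _ "\<lambda>z v. ((z - c) \<bullet> w) * f' z v + (v \<bullet> w) * f z"])
       (auto intro!: derivative_eq_intros f' bump_span.add bump_span.mult w0)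
next
  case (add f g)
  then obtain f' g' where f': "\<And>z. (f has_derivative f' z) (at z)" "\<And>v. (\<lambda>z. f' z v) \<in> bump_span a c"
    and g': "\<And>z. (g has_derivative g' z) (at z)" "\<And>v. (\<lambda>z. g' z v) \<in> bump_span a c" by metis
  show ?case
    by (rule exI[of _ "\<lambda>z v. f' z v + g' z v"])
       (auto intro!: derivative_eq_intros f' g' bump_span.add)
next
  case (scale f r)
  then obtain f' where f': "\<And>z. (f has_derivative f' z) (at z)" "\<And>v. (\<lambda>z. f' z v) \<in> bump_span a c" by blast
  show ?case
    by (rule exI[of _ "\<lambda>z v. r * f' z v"])
       (auto intro!: derivative_eq_intros f' bump_span.scale)
qed

lemma C_k_on_bump_span: "f \<in> bump_span a c \<Longrightarrow> C_k_on k f UNIV"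
proof (induction k arbitrary: f)
  case 0
  then obtain f' where "\<And>z. (f has_derivative f' z) (at z)" using bump_span_deriv by blast
  then show ?case
    by (auto intro!: has_derivative_continuous_on[of _ _ f'] intro: has_derivative_at_withinI)
next
  case (Suc k)
  then obtain f' where f': "\<And>z. (f has_derivative f' z) (at z)" "\<And>v. (\<lambda>z. f' z v) \<in> bump_span a c"
    using bump_span_deriv by blast
  have "frechet_derivative f (at z) = f' z" for z
    using frechet_derivative_at[OF f'(1)] by simp
  then show ?case using f' Suc.IH by (auto simp: differentiable_def)
qed

lemma bump_eq_0: "a \<le> (norm (z - c))\<^sup>2 \<Longrightarrow> bump a c z = 0"
  by (simp add: bump_def psi_def)

lemma bump_nonneg: "bump a c z \<ge> 0"
  by (simp add: bump_def psi_nonneg)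

lemma frechet_derivative_bump: "frechet_derivative (bump a c) (at z) = dbump a c z"
  using frechet_derivative_at[OF has_derivative_bump] by metis

lemma bump_test_function:
  fixes c :: "'a::euclidean_space"
  assumes r: "0 \<le> r" "a \<le> r\<^sup>2" and sub: "cball c r \<subseteq> E"
  shows "bump a c \<in> test_functions E"
proof -
  have s: "{z. bump a c z \<noteq> 0} \<subseteq> cball c r"
  proof
    fix z assume "z \<in> {z. bump a c z \<noteq> 0}"
    then have "(norm (z - c))\<^sup>2 < r\<^sup>2" using bump_eq_0[of a z c] r by force
    then have "norm (z - c) \<le> r" using power2_less_imp_less[OF _ r(1)] by fastforce
    then show "z \<in> cball c r" by (simp add: dist_norm norm_minus_commute)
  qed
  then have cl: "closure {z. bump a c z \<noteq> 0} \<subseteq> cball c r"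
    by (rule closure_minimal) simp
  then have "compact (closure {z. bump a c z \<noteq> 0})"
    by (meson bounded_cball bounded_subset closed_closure compact_eq_bounded_closed)
  moreover have "bump a c \<in> bump_span a c"
    unfolding bump_def by (rule bump_span.base)
  ultimately show ?thesis
    using C_k_on_bump_span cl sub by (auto simp: test_functions_def)
qed

text \<open>The weak gradient is defined on time slices, while mollification takes place in
  space-time. This identity lets the space-time kernel be used as a test function on almost every
  slice.\<close>

lemma bump_slice: "bump a (c, \<tau>) (x, t) = bump (a - (t - \<tau>)\<^sup>2) c x"
  by (simp add: bump_def norm_Pair algebra_simps)

lemma dbump_slice: "dbump a (c, \<tau>) (x, t) (b, 0) = dbump (a - (t - \<tau>)\<^sup>2) c x b"
  by (simp add: dbump_def norm_Pair algebra_simps)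

lemma bump_continuous: "continuous_on S (bump a c)"
  by (rule has_derivative_continuous_on, rule has_derivative_at_withinI, rule has_derivative_bump)

lemma psi_continuous: "continuous_on S (psi j)"
  by (rule DERIV_continuous_on, rule has_field_derivative_at_within, rule DERIV_psi)

lemma dbump_continuous: "continuous_on S (\<lambda>z. dbump a c z v)"
  unfolding dbump_def by (intro continuous_intros continuous_on_compose2[OF psi_continuous[of UNIV 2]]) auto

lemma bump_measurable [measurable]: "bump a c \<in> borel_measurable borel"
  by (rule borel_measurable_continuous_onI, rule bump_continuous)

lemma dbump_measurable [measurable]: "(\<lambda>z. dbump a c z v) \<in> borel_measurable borel"
  by (rule borel_measurable_continuous_onI, rule dbump_continuous)

lemma dbump_eq_0: "a \<le> (norm (z - c))\<^sup>2 \<Longrightarrow> dbump a c z v = 0"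
  by (simp add: dbump_def psi_def)

lemma bump_commute: "bump a c z = bump a z c"
  by (simp add: bump_def norm_minus_commute)

text \<open>The kernel depends on \<open>z - c\<close> only, so a derivative in the centre is minus
  a derivative in the integration variable.\<close>

lemma dbump_commute: "dbump a c z v = - dbump a z c v"
  by (simp add: dbump_def norm_minus_commute algebra_simps)

subsection \<open>Mollification\<close>

lemma nn_integral_lborel_translation:
  fixes f :: "'a::euclidean_space \<Rightarrow> ennreal"
  assumes [measurable]: "f \<in> borel_measurable borel"
  shows "(\<integral>\<^sup>+x. f (x + y) \<partial>lborel) = (\<integral>\<^sup>+x. f x \<partial>lborel)"
proof -
  have "(\<integral>\<^sup>+x. f x \<partial>lborel) = (\<integral>\<^sup>+x. f x \<partial>distr lborel borel ((+) y))"
    by (simp add: lborel_distr_plus)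
  also have "\<dots> = (\<integral>\<^sup>+x. f (y + x) \<partial>lborel)"
    by (subst nn_integral_distr) auto
  finally show ?thesis by (simp add: add.commute)
qed

lemma integrable_lborel_translation:
  fixes f :: "'a::euclidean_space \<Rightarrow> 'b::{banach, second_countable_topology}"
  assumes f: "integrable lborel f"
  shows "integrable lborel (\<lambda>x. f (x + y))"
proof -
  have [measurable]: "f \<in> borel_measurable borel" using f by auto
  have "integrable (distr lborel borel ((+) y)) f" using f by (simp add: lborel_distr_plus)
  then have "integrable lborel (\<lambda>x. f (y + x))" by (subst (asm) integrable_distr_eq) auto
  then show ?thesis by (simp add: add.commute)
qed

lemma integral_lborel_translation:
  fixes f :: "'a::euclidean_space \<Rightarrow> 'b::{banach, second_countable_topology}"
  assumes [measurable]: "f \<in> borel_measurable borel"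
  shows "integral\<^sup>L lborel (\<lambda>x. f (x + y)) = integral\<^sup>L lborel f"
proof -
  have "integral\<^sup>L lborel f = integral\<^sup>L (distr lborel borel ((+) y)) f"
    by (simp add: lborel_distr_plus)
  also have "\<dots> = integral\<^sup>L lborel (\<lambda>x. f (y + x))"
    by (subst integral_distr) auto
  finally show ?thesis by (simp add: add.commute)
qed

text \<open>The shift is an isometry of L1, so the approximation error \<open>f - g\<close> is paid
  twice. This transfers continuity of translations from \<open>g\<close> to
  \<open>f\<close>.\<close>

lemma translation_defect_triangle:
  fixes f g :: "'a::euclidean_space \<Rightarrow> 'b::{banach, second_countable_topology}"
  assumes f: "integrable lborel f" and g: "integrable lborel g"
  shows "(\<integral>x. norm (f (x + y) - f x) \<partial>lborel)
    \<le> (\<integral>x. norm (g (x + y) - g x) \<partial>lborel) + 2 * (\<integral>x. norm (f x - g x) \<partial>lborel)"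
proof -
  note [measurable] = borel_measurable_integrable[OF f] borel_measurable_integrable[OF g]
  have fg: "integrable lborel (\<lambda>x. norm (f x - g x))" using f g by auto
  note fy = integrable_lborel_translation[OF f, of y] integrable_lborel_translation[OF g, of y]
    integrable_lborel_translation[OF fg, of y]
  have "(\<integral>x. norm (f (x + y) - f x) \<partial>lborel)
    \<le> (\<integral>x. norm (g (x + y) - g x) + norm (f (x + y) - g (x + y)) + norm (f x - g x) \<partial>lborel)"
  proof (rule integral_mono)
    fix x show "norm (f (x + y) - f x) \<le> norm (g (x + y) - g x) + norm (f (x + y) - g (x + y)) + norm (f x - g x)"
      by (rule order_trans[OF _ add_mono[OF norm_triangle_ineq order_refl]], rule order_trans[OF _ norm_triangle_ineq4])
         (simp add: algebra_simps)
  qed (use f g fy fg in auto)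
  also have "\<dots> = (\<integral>x. norm (g (x + y) - g x) \<partial>lborel) + (\<integral>x. norm (f (x + y) - g (x + y)) \<partial>lborel) + (\<integral>x. norm (f x - g x) \<partial>lborel)"
    using f g fy fg by (subst Bochner_Integration.integral_add) auto
  also have "(\<integral>x. norm (f (x + y) - g (x + y)) \<partial>lborel) = (\<integral>x. norm (f x - g x) \<partial>lborel)"
    by (rule integral_lborel_translation) measurable
  finally show ?thesis by simp
qed

text \<open>A point of an open set stays inside under small shifts, so the indicator times its shift
  converges at every point. The L1 distance is twice the measure minus twice the integral of this
  product, hence points outside the set need no separate argument.\<close>

lemma translation_defect_open:
  fixes O1 :: "'a::euclidean_space set" and c :: "'b::{banach, second_countable_topology}"
  assumes O1: "open O1" "emeasure lborel O1 < \<infinity>" and y: "y \<longlonglongrightarrow> 0"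
  shows "(\<lambda>n. \<integral>x. norm (indicat_real O1 (x + y n) *\<^sub>R c - indicat_real O1 x *\<^sub>R c) \<partial>lborel) \<longlonglongrightarrow> 0"
proof -
  have [measurable]: "O1 \<in> sets borel" using O1 by auto
  have i: "integrable lborel (indicat_real O1)" using O1 by (simp add: integrable_indicator_iff)
  have iy: "integrable lborel (\<lambda>x. indicat_real O1 (x + y))" for y
    using integrable_lborel_translation[OF i] .
  have i2: "integrable lborel (\<lambda>x. indicat_real O1 x * indicat_real O1 (x + y))" for y
    by (rule Bochner_Integration.integrable_bound[OF i]) (auto simp: indicator_def)
  have eq: "(\<integral>x. norm (indicat_real O1 (x + y) *\<^sub>R c - indicat_real O1 x *\<^sub>R c) \<partial>lborel)
     = norm c * (2 * measure lborel O1 - 2 * (\<integral>x. indicat_real O1 x * indicat_real O1 (x + y) \<partial>lborel))" for y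
  proof -
    have "(\<integral>x. norm (indicat_real O1 (x + y) *\<^sub>R c - indicat_real O1 x *\<^sub>R c) \<partial>lborel) =
       (\<integral>x. norm c * (indicat_real O1 (x + y) + indicat_real O1 x - 2 * (indicat_real O1 x * indicat_real O1 (x + y))) \<partial>lborel)"
      by (rule Bochner_Integration.integral_cong) (auto simp: indicator_def)
    also have "\<dots> = norm c * ((\<integral>x. indicat_real O1 (x + y) \<partial>lborel) + (\<integral>x. indicat_real O1 x \<partial>lborel) - 2 * (\<integral>x. indicat_real O1 x * indicat_real O1 (x + y) \<partial>lborel))"
      using i iy i2 by simp
    also have "(\<integral>x. indicat_real O1 (x + y) \<partial>lborel) = measure lborel O1"
      using integral_lborel_translation[of "indicat_real O1" y] by simp
    finally show ?thesis by simp
  qed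
  have "(\<lambda>n. \<integral>x. indicat_real O1 x * indicat_real O1 (x + y n) \<partial>lborel) \<longlonglongrightarrow> (\<integral>x. indicat_real O1 x \<partial>lborel)"
  proof (rule integral_dominated_convergence[where w = "indicat_real O1"])
    show "AE x in lborel. (\<lambda>n. indicat_real O1 x * indicat_real O1 (x + y n)) \<longlonglongrightarrow> indicat_real O1 x"
    proof (rule AE_I2)
      fix x
      show "(\<lambda>n. indicat_real O1 x * indicat_real O1 (x + y n)) \<longlonglongrightarrow> indicat_real O1 x"
      proof (cases "x \<in> O1")
        case True
        have "(\<lambda>n. x + y n) \<longlonglongrightarrow> x" using tendsto_add[OF tendsto_const y, of x] by simp
        then have "eventually (\<lambda>n. x + y n \<in> O1) sequentially"
          using O1(1) True by (simp add: topological_tendstoD)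
        then have "eventually (\<lambda>n. indicat_real O1 x * indicat_real O1 (x + y n) = indicat_real O1 x) sequentially"
          by eventually_elim (use True in auto)
        then show ?thesis by (rule tendsto_eventually)
      qed auto
    qed
  qed (use i in \<open>auto simp: indicator_def\<close>)
  then have "(\<lambda>n. norm c * (2 * measure lborel O1 - 2 * (\<integral>x. indicat_real O1 x * indicat_real O1 (x + y n) \<partial>lborel)))
     \<longlonglongrightarrow> norm c * (2 * measure lborel O1 - 2 * measure lborel O1)"
    by (intro tendsto_intros) simp
  then show ?thesis by (simp add: eq)
qed

text \<open>Induction over integrable functions: open sets first, sets of finite measure by outer
  regularity, then sums and dominated limits. Each approximation is transported by
  \<open>translation_defect_triangle\<close>.\<close>

lemma translation_continuous_L1_seq:
  fixes f :: "'a::euclidean_space \<Rightarrow> 'b::{banach, second_countable_topology}"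
  assumes "integrable lborel f" and y: "y \<longlonglongrightarrow> 0"
  shows "(\<lambda>n. \<integral>x. norm (f (x + y n) - f x) \<partial>lborel) \<longlonglongrightarrow> 0"
  using assms(1)
proof (induction rule: integrable_induct)
  case (base A c)
  have [measurable]: "A \<in> sets borel" using base by simp
  show ?case
  proof (rule LIMSEQ_I)
    fix e :: real assume e: "e > 0"
    define d where "d = e / (4 * (norm c + 1))"
    \<comment> \<open>The added 1 in \<open>d\<close> avoids a case distinction on
      \<open>c = 0\<close>.\<close>
    have d: "d > 0" using e by (simp add: d_def add_nonneg_pos)
    obtain O1 where O1: "open O1" "A \<subseteq> O1" "emeasure lebesgue (O1 - A) < ennreal d"
      using sets_lebesgue_outer_open[of A d] base d by (metis emeasure_lborel_countable fmeasurableD lborelD sets_completionI_sets)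
    have [measurable]: "O1 \<in> sets borel" using O1 by auto
    have dm: "emeasure lborel (O1 - A) < ennreal d" using O1 by simp
    have "emeasure lborel O1 = emeasure lborel (A \<union> (O1 - A))" using O1(2) by (simp add: Un_absorb1)
    also have "\<dots> \<le> emeasure lborel A + emeasure lborel (O1 - A)" by (rule emeasure_subadditive) auto
    also have "\<dots> < \<infinity>" using base dm by (simp add: ennreal_add_less_top less_trans[OF dm])
    finally have fin: "emeasure lborel O1 < \<infinity>" .
    have iO: "integrable lborel (\<lambda>x. indicat_real O1 x *\<^sub>R c)" using fin
      by (intro integrable_scaleR_left) (simp add: integrable_indicator_iff)
    have iA: "integrable lborel (\<lambda>x. indicat_real A x *\<^sub>R c)" using base
      by (intro integrable_scaleR_left) (simp add: integrable_indicator_iff)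
    have "(\<integral>x. norm (indicat_real A x *\<^sub>R c - indicat_real O1 x *\<^sub>R c) \<partial>lborel) = (\<integral>x. norm c * indicat_real (O1 - A) x \<partial>lborel)"
      by (rule Bochner_Integration.integral_cong) (use O1 in \<open>auto simp: indicator_def\<close>)
    also have "\<dots> = norm c * measure lborel (O1 - A)" by simp
    also have "\<dots> \<le> norm c * d"
    proof (intro mult_left_mono)
      show "measure lborel (O1 - A) \<le> d"
        using dm d unfolding measure_def by (intro enn2real_leI) auto
    qed auto
    also have "\<dots> \<le> (norm c + 1) * d" using d by (intro mult_right_mono) auto
    also have "\<dots> = e / 4"
    proof -
      have "norm c + 1 \<noteq> 0" using norm_ge_zero[of c] by linarith
      moreover have "w * (e / (4 * w)) = e / 4" if "w \<noteq> 0" for w :: real using that by simp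
      ultimately show ?thesis unfolding d_def by blast
    qed
    finally have *: "2 * (\<integral>x. norm (indicat_real A x *\<^sub>R c - indicat_real O1 x *\<^sub>R c) \<partial>lborel) \<le> e / 2" by simp
    obtain N where N: "\<And>n. n \<ge> N \<Longrightarrow> (\<integral>x. norm (indicat_real O1 (x + y n) *\<^sub>R c - indicat_real O1 x *\<^sub>R c) \<partial>lborel) < e / 2"
      using LIMSEQ_D[OF translation_defect_open[OF O1(1) fin y, of c], of "e/2"] e by auto
    show "\<exists>no. \<forall>n\<ge>no. norm ((\<integral>x. norm (indicat_real A (x + y n) *\<^sub>R c - indicat_real A x *\<^sub>R c) \<partial>lborel) - 0) < e"
    proof (intro exI[of _ N] allI impI)
      fix n assume "n \<ge> N"
      then have "(\<integral>x. norm (indicat_real A (x + y n) *\<^sub>R c - indicat_real A x *\<^sub>R c) \<partial>lborel) < e"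
        using translation_defect_triangle[OF iA iO, of "y n"] N[of n] * by linarith
      then show "norm ((\<integral>x. norm (indicat_real A (x + y n) *\<^sub>R c - indicat_real A x *\<^sub>R c) \<partial>lborel) - 0) < e"
        by simp
    qed
  qed
next
  case (add f g)
  have "(\<lambda>n. (\<integral>x. norm (f (x + y n) - f x) \<partial>lborel) + (\<integral>x. norm (g (x + y n) - g x) \<partial>lborel)) \<longlonglongrightarrow> 0"
    using tendsto_add[OF add.IH] by simp
  then show ?case
  proof (rule Lim_null_comparison[rotated], intro always_eventually allI)
    fix n
    note i = integrable_lborel_translation[OF add.hyps(1), of "y n"] integrable_lborel_translation[OF add.hyps(2), of "y n"]
    have "(\<integral>x. norm (f (x + y n) + g (x + y n) - (f x + g x)) \<partial>lborel) \<le> (\<integral>x. norm (f (x + y n) - f x) + norm (g (x + y n) - g x) \<partial>lborel)"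
      using i add.hyps by (intro integral_mono) (auto intro!: norm_diff_triangle_ineq)
    also have "\<dots> = (\<integral>x. norm (f (x + y n) - f x) \<partial>lborel) + (\<integral>x. norm (g (x + y n) - g x) \<partial>lborel)"
      using i add.hyps by (intro Bochner_Integration.integral_add) auto
    finally show "norm (\<integral>x. norm (f (x + y n) + g (x + y n) - (f x + g x)) \<partial>lborel) \<le> (\<integral>x. norm (f (x + y n) - f x) \<partial>lborel) + (\<integral>x. norm (g (x + y n) - g x) \<partial>lborel)"
      by simp
  qed
next
  case (lim f s)
  note [measurable] = borel_measurable_integrable[OF lim.hyps(1)] borel_measurable_integrable[OF lim.hyps(4)]
  have L: "(\<lambda>i. \<integral>x. norm (f x - s i x) \<partial>lborel) \<longlonglongrightarrow> (\<integral>x. norm (f x - f x) \<partial>lborel)"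
  proof (rule integral_dominated_convergence[where w = "\<lambda>x. 3 * norm (f x)"])
    show "AE x in lborel. (\<lambda>i. norm (f x - s i x)) \<longlonglongrightarrow> norm (f x - f x)"
      using lim.hyps(2) by (intro AE_I2 tendsto_intros) auto
    show "AE x in lborel. norm (norm (f x - s i x)) \<le> 3 * norm (f x)" for i
    proof (rule AE_I2)
      fix x show "norm (norm (f x - s i x)) \<le> 3 * norm (f x)"
        using lim.hyps(3)[of x i] norm_triangle_ineq4[of "f x" "s i x"] by simp
    qed
  qed (use lim.hyps(4) in auto)
  show ?case
  proof (rule LIMSEQ_I)
    fix e :: real assume e: "e > 0"
    obtain i where "norm (\<integral>x. norm (f x - s i x) \<partial>lborel) < e / 4"
      using LIMSEQ_D[OF L, of "e/4"] e by auto
    then have i: "2 * (\<integral>x. norm (f x - s i x) \<partial>lborel) < e / 2" by simp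
    obtain N where N: "\<And>n. n \<ge> N \<Longrightarrow> (\<integral>x. norm (s i (x + y n) - s i x) \<partial>lborel) < e / 2"
      using LIMSEQ_D[OF lim.IH[of i], of "e/2"] e by auto
    show "\<exists>no. \<forall>n\<ge>no. norm ((\<integral>x. norm (f (x + y n) - f x) \<partial>lborel) - 0) < e"
    proof (intro exI[of _ N] allI impI)
      fix n assume "n \<ge> N"
      then have "(\<integral>x. norm (f (x + y n) - f x) \<partial>lborel) < e"
        using translation_defect_triangle[OF lim.hyps(4) lim.hyps(1)[of i], of "y n"] N[of n] i by linarith
      then show "norm ((\<integral>x. norm (f (x + y n) - f x) \<partial>lborel) - 0) < e" by simp
    qed
  qed
qed

lemma translation_continuous_L1:
  fixes f :: "'a::euclidean_space \<Rightarrow> 'b::{banach, second_countable_topology}"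
  assumes f: "integrable lborel f" and e: "e > 0"
  shows "\<exists>d>0. \<forall>y. norm y < d \<longrightarrow> (\<integral>x. norm (f (x + y) - f x) \<partial>lborel) < e"
proof (rule ccontr)
  assume "\<not> ?thesis"
  then have "\<forall>n::nat. \<exists>y. norm y < inverse (real (Suc n)) \<and> \<not> (\<integral>x. norm (f (x + y) - f x) \<partial>lborel) < e"
    by (metis inverse_positive_iff_positive of_nat_0_less_iff zero_less_Suc)
  then obtain y where y: "\<And>n::nat. norm (y n) < inverse (real (Suc n))" "\<And>n. \<not> (\<integral>x. norm (f (x + y n) - f x) \<partial>lborel) < e"
    by metis
  have "y \<longlonglongrightarrow> 0"
    by (rule Lim_null_comparison[OF always_eventually LIMSEQ_inverse_real_of_nat]) (use y(1) less_imp_le in blast)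
  from LIMSEQ_D[OF translation_continuous_L1_seq[OF f this] e] y(2) show False by force
qed

section \<open>Convergence of mollifications in L1 and almost everywhere\<close>

definition bump_mass :: "'a::euclidean_space itself \<Rightarrow> real \<Rightarrow> real" where
  "bump_mass _ \<epsilon> = integral\<^sup>L lborel (bump (\<epsilon>\<^sup>2) (0::'a))"

definition mollify :: "real \<Rightarrow> ('a::euclidean_space \<Rightarrow> 'b::euclidean_space) \<Rightarrow> 'a \<Rightarrow> 'b" where
  "mollify \<epsilon> f c = (\<integral>z. (bump (\<epsilon>\<^sup>2) c z / bump_mass TYPE('a) \<epsilon>) *\<^sub>R f z \<partial>lborel)"

lemma psi_2_bound: "psi 2 s \<le> 24 * s\<^sup>2"
  using psi_bound[of 2 s] by (simp add: fact_numeral)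

lemma bump_le_1: "bump a c z \<le> 1"
  by (simp add: bump_def psi_def)

lemma bump_integrable: "integrable lborel (bump a (c::'a::euclidean_space))"
proof -
  have z: "bump a c z = 0" if "z \<notin> cball c (sqrt \<bar>a\<bar>)" for z
  proof (rule bump_eq_0)
    have "sqrt \<bar>a\<bar> \<le> norm (z - c)" using that by (simp add: dist_norm norm_minus_commute)
    then have "(sqrt \<bar>a\<bar>)\<^sup>2 \<le> (norm (z - c))\<^sup>2" by (intro power_mono) auto
    then show "a \<le> (norm (z - c))\<^sup>2" by simp
  qed
  have "integrable lborel (\<lambda>z. indicator (cball c (sqrt \<bar>a\<bar>)) z *\<^sub>R bump a c z)"
    by (rule borel_integrable_compact) (auto intro: bump_continuous)
  moreover have "(\<lambda>z. indicator (cball c (sqrt \<bar>a\<bar>)) z *\<^sub>R bump a c z) = bump a c"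
    using z by (auto simp: indicator_def fun_eq_iff)
  ultimately show ?thesis by simp
qed

lemma bump_mass_pos:
  assumes "\<epsilon> > 0" shows "bump_mass TYPE('a::euclidean_space) \<epsilon> > 0"
proof -
  have n: "bump_mass TYPE('a) \<epsilon> \<ge> 0" unfolding bump_mass_def
    by (intro Bochner_Integration.integral_nonneg) (auto simp: bump_nonneg)
  have "bump_mass TYPE('a) \<epsilon> \<noteq> 0"
  proof
    assume "bump_mass TYPE('a) \<epsilon> = 0"
    then have "AE z in lborel. bump (\<epsilon>\<^sup>2) (0::'a) z = 0"
      using integral_nonneg_eq_0_iff_AE[OF bump_integrable[of "\<epsilon>\<^sup>2" "0::'a"]] by (simp add: bump_mass_def bump_nonneg)
    then have "AE z in lborel. z \<notin> ball (0::'a) \<epsilon>"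
    proof eventually_elim
      case (elim z)
      have "\<not> norm z < \<epsilon>"
      proof
        assume "norm z < \<epsilon>"
        then have "(norm z)\<^sup>2 < \<epsilon>\<^sup>2" by (intro power_strict_mono) auto
        then show False using elim by (simp add: bump_def psi_def)
      qed
      then show ?case by simp
    qed
    then have "emeasure lborel (ball (0::'a) \<epsilon>) = 0"
      by (subst (asm) AE_iff_measurable[of "ball 0 \<epsilon>"]) auto
    then show False using assms content_ball_pos[of \<epsilon> "0::'a"] by (simp add: measure_def)
  qed
  with n show ?thesis by linarith
qed

lemma bump_integral: "(\<integral>z. bump (\<epsilon>\<^sup>2) (c::'a::euclidean_space) z \<partial>lborel) = bump_mass TYPE('a) \<epsilon>"
  using integral_lborel_translation[of "bump (\<epsilon>\<^sup>2) c" c]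
  by (simp add: bump_mass_def bump_def[abs_def])

lemma integrable_bounded_scaleR:
  fixes f :: "'a::euclidean_space \<Rightarrow> 'b::{banach, second_countable_topology}"
  assumes f: "integrable lborel f" and [measurable]: "k \<in> borel_measurable borel" and k: "\<And>z. \<bar>k z\<bar> \<le> B"
  shows "integrable lborel (\<lambda>z. k z *\<^sub>R f z)"
proof (rule Bochner_Integration.integrable_bound)
  show "integrable lborel (\<lambda>z. B * norm (f z))" using f by auto
  show "AE z in lborel. norm (k z *\<^sub>R f z) \<le> norm (B * norm (f z))"
  proof (rule AE_I2)
    fix z
    have "\<bar>k z\<bar> * norm (f z) \<le> B * norm (f z)" using k by (intro mult_right_mono) auto
    also have "\<dots> \<le> \<bar>B * norm (f z)\<bar>" by simp
    finally show "norm (k z *\<^sub>R f z) \<le> norm (B * norm (f z))" by simp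
  qed
qed (use f in measurable)

lemma mollify_integrand:
  fixes f :: "'a::euclidean_space \<Rightarrow> 'b::euclidean_space"
  assumes "integrable lborel f"
  shows "integrable lborel (\<lambda>z. (bump (\<epsilon>\<^sup>2) c z / bump_mass TYPE('a) \<epsilon>) *\<^sub>R f z)"
  by (rule integrable_bounded_scaleR[OF assms, where B = "1 / \<bar>bump_mass TYPE('a) \<epsilon>\<bar>"])
     (auto simp: bump_le_1 bump_nonneg abs_mult divide_right_mono)

lemma mollify_measurable [measurable]:
  fixes f :: "'a::euclidean_space \<Rightarrow> 'b::euclidean_space"
  assumes [measurable]: "f \<in> borel_measurable borel"
  shows "mollify \<epsilon> f \<in> borel_measurable borel"
proof -
  have "(\<lambda>c. \<integral>z. (bump (\<epsilon>\<^sup>2) c z / bump_mass TYPE('a) \<epsilon>) *\<^sub>R f z \<partial>lborel) \<in> borel_measurable lborel"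
    unfolding bump_def by (rule lborel.borel_measurable_lebesgue_integral) measurable
  then show ?thesis by (simp add: mollify_def[abs_def])
qed

text \<open>At \<open>c\<close> the error is a kernel average of \<open>f (c + y) - f c\<close>.
  After exchanging the integrals, only shifts shorter than \<epsilon> carry weight, each of them
  costs at most \<open>d\<close>, and the kernel has total mass 1.\<close>

lemma mollify_L1_bound:
  fixes f :: "'a::euclidean_space \<Rightarrow> 'b::euclidean_space"
  assumes f: "integrable lborel f" and \<epsilon>: "\<epsilon> > 0"
    and d: "\<And>y. norm y < \<epsilon> \<Longrightarrow> (\<integral>x. norm (f (x + y) - f x) \<partial>lborel) \<le> d"
  shows "(\<integral>\<^sup>+c. norm (mollify \<epsilon> f c - f c) \<partial>lborel) \<le> ennreal d"
proof -
  note [measurable] = borel_measurable_integrable[OF f]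
  define m where "m = bump_mass TYPE('a) \<epsilon>"
  have m: "m > 0" using bump_mass_pos[OF \<epsilon>] by (simp add: m_def)
  have bi: "integrable lborel (\<lambda>z. bump (\<epsilon>\<^sup>2) c z / m)" for c :: 'a
    using bump_integrable by auto
  have d0: "d \<ge> 0" using d[of 0] \<epsilon> by simp
  have pw: "ennreal (norm (mollify \<epsilon> f c - f c)) \<le> (\<integral>\<^sup>+y. ennreal (bump (\<epsilon>\<^sup>2) 0 y / m) * ennreal (norm (f (c + y) - f c)) \<partial>lborel)" for c
  proof -
    have i1: "integrable lborel (\<lambda>z. (bump (\<epsilon>\<^sup>2) c z / m) *\<^sub>R f z)"
      using mollify_integrand[OF f] by (simp add: m_def)
    have i2: "integrable lborel (\<lambda>z. (bump (\<epsilon>\<^sup>2) c z / m) *\<^sub>R f c)"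
      using bi by (intro integrable_scaleR_left) auto
    have "(\<integral>z. (bump (\<epsilon>\<^sup>2) c z / m) *\<^sub>R f c \<partial>lborel) = (\<integral>z. bump (\<epsilon>\<^sup>2) c z / m \<partial>lborel) *\<^sub>R f c"
      using bi by (intro integral_scaleR_left) auto
    also have "\<dots> = f c" using m by (simp add: bump_integral m_def)
    finally have "mollify \<epsilon> f c - f c = (\<integral>z. (bump (\<epsilon>\<^sup>2) c z / m) *\<^sub>R f z - (bump (\<epsilon>\<^sup>2) c z / m) *\<^sub>R f c \<partial>lborel)"
      using i1 i2 by (simp add: mollify_def m_def)
    also have "ennreal (norm \<dots>) \<le> (\<integral>\<^sup>+z. norm ((bump (\<epsilon>\<^sup>2) c z / m) *\<^sub>R f z - (bump (\<epsilon>\<^sup>2) c z / m) *\<^sub>R f c) \<partial>lborel)"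
      using i1 i2 by (intro integral_norm_bound_ennreal) auto
    also have "\<dots> = (\<integral>\<^sup>+z. ennreal (bump (\<epsilon>\<^sup>2) c z / m) * ennreal (norm (f z - f c)) \<partial>lborel)"
      using m by (intro nn_integral_cong) (simp add: ennreal_mult[symmetric] bump_nonneg flip: scaleR_diff_right)
    also have "\<dots> = (\<integral>\<^sup>+y. ennreal (bump (\<epsilon>\<^sup>2) c (y + c) / m) * ennreal (norm (f (y + c) - f c)) \<partial>lborel)"
      by (rule nn_integral_lborel_translation[symmetric]) measurable
    finally show ?thesis by (simp add: bump_def add.commute)
  qed
  have "(\<integral>\<^sup>+c. norm (mollify \<epsilon> f c - f c) \<partial>lborel) \<le> (\<integral>\<^sup>+c. \<integral>\<^sup>+y. ennreal (bump (\<epsilon>\<^sup>2) 0 y / m) * ennreal (norm (f (c + y) - f c)) \<partial>lborel \<partial>lborel)"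
    by (intro nn_integral_mono pw)
  also have "\<dots> = (\<integral>\<^sup>+y. \<integral>\<^sup>+c. ennreal (bump (\<epsilon>\<^sup>2) 0 y / m) * ennreal (norm (f (c + y) - f c)) \<partial>lborel \<partial>lborel)"
    by (rule lborel_pair.Fubini'[symmetric]) measurable
  also have "\<dots> = (\<integral>\<^sup>+y. ennreal (bump (\<epsilon>\<^sup>2) 0 y / m) * (\<integral>\<^sup>+c. ennreal (norm (f (c + y) - f c)) \<partial>lborel) \<partial>lborel)"
    by (intro nn_integral_cong nn_integral_cmult) measurable
  also have "\<dots> \<le> (\<integral>\<^sup>+y. ennreal (bump (\<epsilon>\<^sup>2) (0::'a) y / m) * ennreal d \<partial>lborel)"
  proof (rule nn_integral_mono)
    fix y :: 'a
    show "ennreal (bump (\<epsilon>\<^sup>2) 0 y / m) * (\<integral>\<^sup>+c. ennreal (norm (f (c + y) - f c)) \<partial>lborel) \<le> ennreal (bump (\<epsilon>\<^sup>2) 0 y / m) * ennreal d"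
    proof (cases "norm y < \<epsilon>")
      case True
      have "(\<integral>\<^sup>+c. ennreal (norm (f (c + y) - f c)) \<partial>lborel) = ennreal (\<integral>c. norm (f (c + y) - f c) \<partial>lborel)"
        using f integrable_lborel_translation[OF f, of y] by (intro nn_integral_eq_integral) auto
      also have "\<dots> \<le> ennreal d" using d[OF True] by (rule ennreal_leI)
      finally show ?thesis by (rule mult_left_mono) simp
    next
      case False
      then have "bump (\<epsilon>\<^sup>2) 0 y = 0" using \<epsilon> by (intro bump_eq_0) (simp add: power_mono)
      then show ?thesis by simp
    qed
  qed
  also have "\<dots> = (\<integral>\<^sup>+y. ennreal (bump (\<epsilon>\<^sup>2) (0::'a) y / m) \<partial>lborel) * ennreal d"
    by (rule nn_integral_multc) measurable
  also have "(\<integral>\<^sup>+y. ennreal (bump (\<epsilon>\<^sup>2) (0::'a) y / m) \<partial>lborel) = ennreal (\<integral>y. bump (\<epsilon>\<^sup>2) (0::'a) y / m \<partial>lborel)"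
    using bi m by (intro nn_integral_eq_integral) (auto simp: bump_nonneg)
  also have "(\<integral>y. bump (\<epsilon>\<^sup>2) (0::'a) y / m \<partial>lborel) = 1"
    using m by (simp add: m_def bump_integral)
  finally show ?thesis by simp
qed

text \<open>The integrability clause speaks of large indices because it is read off from the error
  estimate with tolerance 1.\<close>

lemma mollify_L1:
  fixes f :: "'a::euclidean_space \<Rightarrow> 'b::euclidean_space"
  assumes f: "integrable lborel f" and \<epsilon>: "\<epsilon> \<longlonglongrightarrow> 0" "\<And>n. \<epsilon> n > 0"
  shows "(\<lambda>n. \<integral>c. norm (mollify (\<epsilon> n) f c - f c) \<partial>lborel) \<longlonglongrightarrow> 0"
    and mollify_diff_integrable: "\<exists>N. \<forall>n\<ge>N. integrable lborel (\<lambda>c. mollify (\<epsilon> n) f c - f c)"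
proof -
  note [measurable] = borel_measurable_integrable[OF f]
  have *: "\<exists>N. \<forall>n\<ge>N. (\<integral>\<^sup>+c. norm (mollify (\<epsilon> n) f c - f c) \<partial>lborel) \<le> ennreal e" if e: "e > 0" for e
  proof -
    obtain d where d: "d > 0" "\<And>y. norm y < d \<Longrightarrow> (\<integral>x. norm (f (x + y) - f x) \<partial>lborel) < e"
      using translation_continuous_L1[OF f e] by blast
    obtain N where N: "\<And>n. n \<ge> N \<Longrightarrow> \<bar>\<epsilon> n\<bar> < d" using LIMSEQ_D[OF \<epsilon>(1) d(1)] by auto
    show ?thesis
    proof (intro exI[of _ N] allI impI)
      fix n assume n: "n \<ge> N"
      show "(\<integral>\<^sup>+c. norm (mollify (\<epsilon> n) f c - f c) \<partial>lborel) \<le> ennreal e"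
        by (rule mollify_L1_bound[OF f \<epsilon>(2)]) (use N[OF n] d(2) in \<open>force intro: less_imp_le\<close>)
    qed
  qed
  show "\<exists>N. \<forall>n\<ge>N. integrable lborel (\<lambda>c. mollify (\<epsilon> n) f c - f c)"
  proof -
    obtain N where N: "\<And>n. n \<ge> N \<Longrightarrow> (\<integral>\<^sup>+c. norm (mollify (\<epsilon> n) f c - f c) \<partial>lborel) \<le> ennreal 1"
      using *[of 1] by auto
    show ?thesis
    proof (intro exI[of _ N] allI impI integrableI_bounded)
      fix n assume "n \<ge> N"
      from N[OF this] show "(\<integral>\<^sup>+c. ennreal (norm (mollify (\<epsilon> n) f c - f c)) \<partial>lborel) < \<infinity>"
        by (rule le_less_trans) simp
    qed measurable
  qed
  show "(\<lambda>n. \<integral>c. norm (mollify (\<epsilon> n) f c - f c) \<partial>lborel) \<longlonglongrightarrow> 0"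
  proof (rule LIMSEQ_I)
    fix r :: real assume r: "r > 0"
    obtain N where N: "\<And>n. n \<ge> N \<Longrightarrow> (\<integral>\<^sup>+c. norm (mollify (\<epsilon> n) f c - f c) \<partial>lborel) \<le> ennreal (r/2)"
      using *[of "r/2"] r by auto
    show "\<exists>no. \<forall>n\<ge>no. norm ((\<integral>c. norm (mollify (\<epsilon> n) f c - f c) \<partial>lborel) - 0) < r"
    proof (intro exI[of _ N] allI impI)
      fix n assume n: "n \<ge> N"
      have "(\<integral>c. norm (mollify (\<epsilon> n) f c - f c) \<partial>lborel) \<le> r/2"
        using enn2real_leI[OF _ N[OF n]] r by (subst integral_eq_nn_integral) auto
      then show "norm ((\<integral>c. norm (mollify (\<epsilon> n) f c - f c) \<partial>lborel) - 0) < r"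
        using r by simp
    qed
  qed
qed


lemma mollify_AE_subseq:
  fixes f :: "'a::euclidean_space \<Rightarrow> 'b::euclidean_space"
  assumes f: "integrable lborel f" and \<epsilon>: "\<epsilon> \<longlonglongrightarrow> 0" "\<And>n. \<epsilon> n > 0"
  shows "\<exists>r. strict_mono r \<and> (AE c in lborel. (\<lambda>n. mollify (\<epsilon> (r n)) f c) \<longlonglongrightarrow> f c)"
proof -
  obtain N where N: "\<And>n. n \<ge> N \<Longrightarrow> integrable lborel (\<lambda>c. mollify (\<epsilon> n) f c - f c)"
    using mollify_diff_integrable[OF f \<epsilon>] by blast
  have "(\<lambda>n. \<integral>c. norm (mollify (\<epsilon> (n + N)) f c - f c) \<partial>lborel) \<longlonglongrightarrow> 0"
    by (rule LIMSEQ_ignore_initial_segment[OF mollify_L1(1)[OF f \<epsilon>]])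
  from tendsto_L1_AE_subseq[OF _ this] N
  obtain r where r: "strict_mono r" "AE c in lborel. (\<lambda>n. mollify (\<epsilon> (r n + N)) f c - f c) \<longlonglongrightarrow> 0" by auto
  have "AE c in lborel. (\<lambda>n. mollify (\<epsilon> (r n + N)) f c) \<longlonglongrightarrow> f c"
    using r(2) by eventually_elim (simp add: LIM_zero_iff)
  moreover have "strict_mono (\<lambda>n. r n + N)" using r(1) by (simp add: strict_mono_def)
  ultimately show ?thesis by (intro exI[of _ "\<lambda>n. r n + N"]) auto
qed

text \<open>Dominated convergence for the difference quotient: the Lipschitz bound on the kernel and
  the bound on its derivative together give the majorant \<open>2 * B * norm (f z)\<close>.\<close>

lemma has_derivative_integral_kernel:
  fixes f :: "'a::euclidean_space \<Rightarrow> 'b::euclidean_space"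
    and k :: "'a \<Rightarrow> 'a \<Rightarrow> real"
  assumes f: "integrable lborel f"
    and k: "\<And>z. ((\<lambda>c. k c z) has_derivative k' z) (at c0)"
    and meas [measurable]: "\<And>c. k c \<in> borel_measurable borel" "\<And>h. (\<lambda>z. k' z h) \<in> borel_measurable borel"
    and bd: "\<And>c z. \<bar>k c z\<bar> \<le> B0" "\<And>z h. \<bar>k' z h\<bar> \<le> B * norm h"
    and lip: "\<And>c z. \<bar>k c z - k c0 z\<bar> \<le> B * norm (c - c0)"
  shows "((\<lambda>c. \<integral>z. k c z *\<^sub>R f z \<partial>lborel) has_derivative (\<lambda>h. \<integral>z. k' z h *\<^sub>R f z \<partial>lborel)) (at c0)"
proof -
  note [measurable] = borel_measurable_integrable[OF f]
  have i1: "integrable lborel (\<lambda>z. k c z *\<^sub>R f z)" for c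
    by (rule integrable_bounded_scaleR[OF f]) (auto intro: bd)
  have i2: "integrable lborel (\<lambda>z. k' z h *\<^sub>R f z)" for h
    by (rule integrable_bounded_scaleR[OF f]) (auto intro: bd)
  have lin: "linear (k' z)" for z using k has_derivative_linear by blast
  have bl: "bounded_linear (\<lambda>h. \<integral>z. k' z h *\<^sub>R f z \<partial>lborel)"
  proof (rule linear_conv_bounded_linear[THEN iffD1], rule linearI)
    fix h1 h2 show "(\<integral>z. k' z (h1 + h2) *\<^sub>R f z \<partial>lborel) = (\<integral>z. k' z h1 *\<^sub>R f z \<partial>lborel) + (\<integral>z. k' z h2 *\<^sub>R f z \<partial>lborel)"
      using i2 by (simp add: linear_add[OF lin] scaleR_add_left)
  next
    fix r h show "(\<integral>z. k' z (r *\<^sub>R h) *\<^sub>R f z \<partial>lborel) = r *\<^sub>R (\<integral>z. k' z h *\<^sub>R f z \<partial>lborel)"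
      by (simp add: linear_scale[OF lin] flip: integral_scaleR_right) 
  qed
  show ?thesis
    unfolding has_derivative_at
  proof (intro conjI bl)
    show "(\<lambda>h. norm ((\<integral>z. k (c0 + h) z *\<^sub>R f z \<partial>lborel) - (\<integral>z. k c0 z *\<^sub>R f z \<partial>lborel) - (\<integral>z. k' z h *\<^sub>R f z \<partial>lborel)) / norm h) \<midarrow>0\<rightarrow> 0"
      unfolding tendsto_at_iff_sequentially
    proof (intro allI impI)
      fix X :: "nat \<Rightarrow> 'a" assume X: "\<forall>i. X i \<in> UNIV - {0}" "X \<longlonglongrightarrow> 0"
      have X0: "X i \<noteq> 0" for i using X(1) by auto
      let ?q = "\<lambda>i z. (k (c0 + X i) z - k c0 z - k' z (X i)) / norm (X i)"
      have eq: "norm ((\<integral>z. k (c0 + X i) z *\<^sub>R f z \<partial>lborel) - (\<integral>z. k c0 z *\<^sub>R f z \<partial>lborel) - (\<integral>z. k' z (X i) *\<^sub>R f z \<partial>lborel)) / norm (X i)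
         = norm (\<integral>z. ?q i z *\<^sub>R f z \<partial>lborel)" for i
      proof -
        have "(\<integral>z. k (c0 + X i) z *\<^sub>R f z \<partial>lborel) - (\<integral>z. k c0 z *\<^sub>R f z \<partial>lborel) - (\<integral>z. k' z (X i) *\<^sub>R f z \<partial>lborel)
          = (\<integral>z. (k (c0 + X i) z - k c0 z - k' z (X i)) *\<^sub>R f z \<partial>lborel)"
          using i1 i2 by (simp add: scaleR_diff_left)
        moreover have "(\<integral>z. ?q i z *\<^sub>R f z \<partial>lborel) = (1 / norm (X i)) *\<^sub>R (\<integral>z. (k (c0 + X i) z - k c0 z - k' z (X i)) *\<^sub>R f z \<partial>lborel)"
          by (simp flip: integral_scaleR_right)
        ultimately show ?thesis by simp
      qed
      have "(\<lambda>i. \<integral>z. ?q i z *\<^sub>R f z \<partial>lborel) \<longlonglongrightarrow> (\<integral>z. 0 \<partial>(lborel :: 'a measure))"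
      proof (rule integral_dominated_convergence[where w = "\<lambda>z. (2 * B) * norm (f z)"])
        show "AE z in lborel. (\<lambda>i. ?q i z *\<^sub>R f z) \<longlonglongrightarrow> 0"
        proof (rule AE_I2)
          fix z
          have "(\<lambda>h. norm (k (c0 + h) z - k c0 z - k' z h) / norm h) \<midarrow>0\<rightarrow> 0"
            using k[of z] unfolding has_derivative_at by blast
          then have "(\<lambda>i. norm (k (c0 + X i) z - k c0 z - k' z (X i)) / norm (X i)) \<longlonglongrightarrow> 0"
            using X unfolding tendsto_at_iff_sequentially o_def by blast
          then have "(\<lambda>i. \<bar>?q i z\<bar>) \<longlonglongrightarrow> 0" by simp
          then have "(\<lambda>i. ?q i z) \<longlonglongrightarrow> 0" by (rule tendsto_rabs_zero_cancel)
          from tendsto_scaleR[OF this tendsto_const, of "f z"] show "(\<lambda>i. ?q i z *\<^sub>R f z) \<longlonglongrightarrow> 0" by simp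
        qed
        show "AE z in lborel. norm (?q i z *\<^sub>R f z) \<le> (2 * B) * norm (f z)" for i
        proof (rule AE_I2)
          fix z
          have "\<bar>k (c0 + X i) z - k c0 z - k' z (X i)\<bar> \<le> 2 * B * norm (X i)"
            using lip[of "c0 + X i" z] bd(2)[of z "X i"] by simp
          then have "\<bar>?q i z\<bar> \<le> 2 * B" using X0[of i] by (simp add: field_simps)
          then show "norm (?q i z *\<^sub>R f z) \<le> (2 * B) * norm (f z)"
            unfolding norm_scaleR by (rule mult_right_mono) simp
        qed
      qed (use f in auto)
      then have "(\<lambda>i. norm (\<integral>z. ?q i z *\<^sub>R f z \<partial>lborel)) \<longlonglongrightarrow> 0"
        by (simp add: tendsto_norm_zero_iff)
      then show "((\<lambda>h. norm ((\<integral>z. k (c0 + h) z *\<^sub>R f z \<partial>lborel) - (\<integral>z. k c0 z *\<^sub>R f z \<partial>lborel) - (\<integral>z. k' z h *\<^sub>R f z \<partial>lborel)) / norm h) \<circ> X) \<longlonglongrightarrow> 0"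
        by (simp add: o_def eq)
    qed
  qed
qed

lemma continuous_integral_kernel:
  fixes f :: "'a::euclidean_space \<Rightarrow> 'b::euclidean_space"
  assumes f: "integrable lborel f"
    and k: "\<And>z. continuous_on UNIV (\<lambda>c. k c z)"
    and meas [measurable]: "\<And>c::'a. k c \<in> borel_measurable borel"
    and bd: "\<And>c z. \<bar>k c z\<bar> \<le> B"
  shows "continuous_on UNIV (\<lambda>c. \<integral>z. k c z *\<^sub>R f z \<partial>lborel)"
  unfolding continuous_on_sequentially
proof (intro allI ballI impI)
  fix x and c :: 'a assume x: "(\<forall>n. x n \<in> UNIV) \<and> x \<longlonglongrightarrow> c"
  note [measurable] = borel_measurable_integrable[OF f]
  show "((\<lambda>c. \<integral>z. k c z *\<^sub>R f z \<partial>lborel) \<circ> x) \<longlonglongrightarrow> (\<integral>z. k c z *\<^sub>R f z \<partial>lborel)"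
    unfolding o_def
  proof (rule integral_dominated_convergence[where w = "\<lambda>z. B * norm (f z)"])
    show "AE z in lborel. (\<lambda>i. k (x i) z *\<^sub>R f z) \<longlonglongrightarrow> k c z *\<^sub>R f z"
    proof (intro AE_I2 tendsto_intros)
      fix z show "(\<lambda>i. k (x i) z) \<longlonglongrightarrow> k c z"
        using k[of z] x unfolding continuous_on_sequentially o_def by blast
    qed
    show "AE z in lborel. norm (k (x i) z *\<^sub>R f z) \<le> B * norm (f z)" for i
      by (intro AE_I2) (simp add: bd mult_right_mono)
  qed (use f in auto)
qed

text \<open>The factor 48 is 2 from the derivative of the square times 24 from
  \<open>psi_2_bound\<close>; the fourth power bounds the squared argument of \<open>psi 2\<close>,
  and the last \<epsilon> bounds the distance to the centre.\<close>

lemma dbump_bound: "\<bar>dbump (\<epsilon>\<^sup>2) c z h\<bar> \<le> 48 * \<epsilon> ^ 4 * \<bar>\<epsilon>\<bar> * norm h"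
proof (cases "(norm (z - c))\<^sup>2 < \<epsilon>\<^sup>2")
  case True
  let ?s = "\<epsilon>\<^sup>2 - (norm (z - c))\<^sup>2"
  have n: "norm (z - c) \<le> \<bar>\<epsilon>\<bar>" using True by (metis abs_norm_cancel less_imp_le real_sqrt_abs real_sqrt_le_iff)
  have "?s\<^sup>2 \<le> (\<epsilon>\<^sup>2)\<^sup>2" by (rule power_mono) (use True in auto)
  then have p: "psi 2 ?s \<le> 24 * \<epsilon> ^ 4" using psi_2_bound[of ?s] by (simp flip: power_mult)
  have "\<bar>(z - c) \<bullet> h\<bar> \<le> \<bar>\<epsilon>\<bar> * norm h"
    using Cauchy_Schwarz_ineq2[of "z - c" h] mult_right_mono[OF n norm_ge_zero[of h]] by linarith
  then have "psi 2 ?s * \<bar>(z - c) \<bullet> h\<bar> \<le> (24 * \<epsilon> ^ 4) * (\<bar>\<epsilon>\<bar> * norm h)"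
    using p by (intro mult_mono) auto
  then show ?thesis by (simp add: dbump_def abs_mult psi_nonneg mult_ac)
next
  case False
  then show ?thesis by (simp add: dbump_eq_0)
qed

lemma bump_lipschitz: "\<bar>bump (\<epsilon>\<^sup>2) z c - bump (\<epsilon>\<^sup>2) z c0\<bar> \<le> 48 * \<epsilon> ^ 4 * \<bar>\<epsilon>\<bar> * norm (c - c0)"
proof -
  have "norm (bump (\<epsilon>\<^sup>2) z c - bump (\<epsilon>\<^sup>2) z c0) \<le> (48 * \<epsilon> ^ 4 * \<bar>\<epsilon>\<bar>) * norm (c - c0)"
  proof (rule differentiable_bound[of UNIV _ "\<lambda>x. dbump (\<epsilon>\<^sup>2) z x"])
    show "onorm (dbump (\<epsilon>\<^sup>2) z x) \<le> 48 * \<epsilon> ^ 4 * \<bar>\<epsilon>\<bar>" for x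
      by (rule onorm_le) (simp add: dbump_bound)
  qed (auto intro: has_derivative_at_withinI has_derivative_bump)
  then show ?thesis by simp
qed

text \<open>The derivative falls on the centre of the kernel, which produces the minus sign of
  \<open>dbump_commute\<close>. With this sign, the weak formulation tested with the kernel becomes
  a statement about derivatives of the mollified function.\<close>

lemma mollify_has_derivative:
  fixes f :: "'a::euclidean_space \<Rightarrow> 'b::euclidean_space"
  assumes f: "integrable lborel f" and \<epsilon>: "\<epsilon> > 0"
  shows "(mollify \<epsilon> f has_derivative (\<lambda>h. \<integral>z. (- dbump (\<epsilon>\<^sup>2) c z h / bump_mass TYPE('a) \<epsilon>) *\<^sub>R f z \<partial>lborel)) (at c)"
    and mollify_derivative_continuous: "continuous_on UNIV (\<lambda>c. \<integral>z. (- dbump (\<epsilon>\<^sup>2) c z h / bump_mass TYPE('a) \<epsilon>) *\<^sub>R f z \<partial>lborel)"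
proof -
  define m where "m = bump_mass TYPE('a) \<epsilon>"
  have m: "m > 0" using bump_mass_pos[OF \<epsilon>] by (simp add: m_def)
  define B where "B = 48 * \<epsilon> ^ 4 * \<bar>\<epsilon>\<bar> / m"
  have B: "B \<ge> 0" using m by (simp add: B_def)
  have db: "\<bar>- dbump (\<epsilon>\<^sup>2) c z h / m\<bar> \<le> B * norm h" for c z :: 'a and h
    using dbump_bound[of \<epsilon> c z h] m by (simp add: B_def divide_right_mono)
  have "((\<lambda>c. \<integral>z. (bump (\<epsilon>\<^sup>2) c z / m) *\<^sub>R f z \<partial>lborel) has_derivative (\<lambda>h. \<integral>z. (- dbump (\<epsilon>\<^sup>2) c z h / m) *\<^sub>R f z \<partial>lborel)) (at c)"
  proof (rule has_derivative_integral_kernel[OF f, where B = B and B0 = "1/m"])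
    fix z
    have "((\<lambda>c. bump (\<epsilon>\<^sup>2) z c / m) has_derivative (\<lambda>h. dbump (\<epsilon>\<^sup>2) z c h / m)) (at c)"
      using has_derivative_mult_left[OF has_derivative_bump[of "\<epsilon>\<^sup>2" z c], of "1 / m"] by simp
    then show "((\<lambda>c. bump (\<epsilon>\<^sup>2) c z / m) has_derivative (\<lambda>h. - dbump (\<epsilon>\<^sup>2) c z h / m)) (at c)"
      by (simp add: bump_commute[of _ _ z] dbump_commute[of _ c z])
  next
    fix c' z :: 'a
    show "\<bar>bump (\<epsilon>\<^sup>2) c' z / m\<bar> \<le> 1/m" using m by (simp add: bump_nonneg bump_le_1 divide_right_mono)
    have "\<bar>bump (\<epsilon>\<^sup>2) c' z / m - bump (\<epsilon>\<^sup>2) c z / m\<bar> = \<bar>bump (\<epsilon>\<^sup>2) z c' - bump (\<epsilon>\<^sup>2) z c\<bar> / m"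
      using m by (simp add: bump_commute[of _ _ z] flip: diff_divide_distrib)
    also have "\<dots> \<le> B * norm (c' - c)"
      using bump_lipschitz[of \<epsilon> z c' c] m by (simp add: B_def divide_right_mono)
    finally show "\<bar>bump (\<epsilon>\<^sup>2) c' z / m - bump (\<epsilon>\<^sup>2) c z / m\<bar> \<le> B * norm (c' - c)" .
  qed (use db in auto)
  then show "(mollify \<epsilon> f has_derivative (\<lambda>h. \<integral>z. (- dbump (\<epsilon>\<^sup>2) c z h / bump_mass TYPE('a) \<epsilon>) *\<^sub>R f z \<partial>lborel)) (at c)"
    by (simp add: mollify_def[abs_def] m_def)
  have "continuous_on UNIV (\<lambda>c. \<integral>z. (- dbump (\<epsilon>\<^sup>2) c z h / m) *\<^sub>R f z \<partial>lborel)"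
  proof (rule continuous_integral_kernel[OF f])
    show "continuous_on UNIV (\<lambda>c. - dbump (\<epsilon>\<^sup>2) c z h / m)" for z :: 'a
      using m by (subst dbump_commute) (auto intro!: continuous_intros dbump_continuous)
  qed (use db in auto)
  then show "continuous_on UNIV (\<lambda>c. \<integral>z. (- dbump (\<epsilon>\<^sup>2) c z h / bump_mass TYPE('a) \<epsilon>) *\<^sub>R f z \<partial>lborel)"
    by (simp add: m_def)
qed

subsection \<open>Orlicz functions and the vector field\<close>

locale orlicz =
  fixes g g' :: "real \<Rightarrow> real" and p q :: real
  assumes g_deriv: "\<And>s. s \<ge> 0 \<Longrightarrow> (g has_real_derivative g' s) (at s within {0..})"
    and g_nonneg: "\<And>s. s \<ge> 0 \<Longrightarrow> g s \<ge> 0"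
    and g_pos: "\<And>s. s > 0 \<Longrightarrow> g s > 0"
    and g_growth: "\<And>s. s > 0 \<Longrightarrow> p - 1 \<le> s * g' s / g s \<and> s * g' s / g s \<le> q - 1"
    and p_gt_1: "1 < p" and p_le_q: "p \<le> q"
    and g_normalized: "integral {0..1} g = 1"
begin

abbreviation "G \<equiv> primitive g"

lemma q_gt_1: "1 < q" using p_gt_1 p_le_q by linarith

lemma g_growth_lower: "s > 0 \<Longrightarrow> (p - 1) * g s \<le> s * g' s"
  and g_growth_upper: "s > 0 \<Longrightarrow> s * g' s \<le> (q - 1) * g s"
  using g_growth[of s] g_pos[of s] by (auto simp: field_simps)

lemma g_deriv_at: "s > 0 \<Longrightarrow> (g has_real_derivative g' s) (at s)"
  using g_deriv[of s] at_within_interior[of s "{0..}"] by (simp add: interior_Ici)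

lemma g_continuous: "continuous_on {0..} g"
  using DERIV_continuous_on g_deriv by (metis atLeast_iff)

lemma g_mono: assumes "0 \<le> a" "a \<le> b" shows "g a \<le> g b"
proof (rule DERIV_nonneg_imp_increasing_open[OF assms(2)])
  fix x assume "a < x" "x < b"
  then have x: "x > 0" using assms by simp
  have "x * g' x \<ge> 0" using g_growth_lower[OF x] g_pos[OF x] p_gt_1 by (smt (verit) mult_nonneg_nonneg)
  then have "g' x \<ge> 0" using x by (simp add: zero_le_mult_iff)
  then show "\<exists>y. (g has_real_derivative y) (at x) \<and> 0 \<le> y" using g_deriv_at[OF x] by blast
next
  show "continuous_on {a..b} g" using g_continuous by (rule continuous_on_subset) (use assms in auto)
qed

text \<open>For negative \<open>s\<close> the interval of integration is empty. This default value
  makes \<open>G\<close> monotone and continuous on the whole line.\<close>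

lemma G_zero: "s \<le> 0 \<Longrightarrow> G s = 0"
  by (cases "s = 0") (auto simp: primitive_def)

lemma G_one: "G 1 = 1" by (simp add: primitive_def g_normalized)

lemma G_deriv: assumes "s > 0" shows "(G has_real_derivative g s) (at s)"
proof -
  have c: "continuous_on {0..s + 1} g" by (rule continuous_on_subset[OF g_continuous]) auto
  have "((\<lambda>x. integral {0..x} g) has_real_derivative g s) (at s within {0..s + 1})"
    by (rule integral_has_real_derivative[OF c]) (use assms in auto)
  then show ?thesis
    using at_within_interior[of s "{0..s+1}"] assms by (simp add: primitive_def[abs_def])
qed

lemma G_continuous_nonneg: "continuous_on {0..b} G"
proof -
  have c: "continuous_on {0..b} g" by (rule continuous_on_subset[OF g_continuous]) auto
  then show ?thesis
    unfolding primitive_def[abs_def]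
    by (intro indefinite_integral_continuous_1 integrable_continuous_real)
qed

lemma G_nonneg: "G s \<ge> 0"
proof (cases "s \<le> 0")
  case False
  then show ?thesis unfolding primitive_def
    by (intro Henstock_Kurzweil_Integration.integral_nonneg integrable_continuous_real continuous_on_subset[OF g_continuous])
       (auto intro: g_nonneg)
qed (simp add: G_zero)

lemma G_mono: assumes "a \<le> b" shows "G a \<le> G b"
proof (cases "a \<le> 0")
  case True then show ?thesis by (simp add: G_zero G_nonneg)
next
  case False
  show ?thesis
  proof (rule DERIV_nonneg_imp_increasing_open[OF assms])
    fix x assume "a < x" "x < b"
    then show "\<exists>y. (G has_real_derivative y) (at x) \<and> 0 \<le> y" using G_deriv[of x] g_nonneg[of x] False by force
  qed (rule continuous_on_subset[OF G_continuous_nonneg[of b]], use False in auto)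
qed

lemma G_measurable [measurable]: "G \<in> borel_measurable borel"
  by (rule borel_measurable_mono) (simp add: mono_def G_mono)

lemma G_continuous: "continuous_on UNIV G"
proof -
  have "continuous_on UNIV (\<lambda>s. G (max 0 s))"
  proof (rule continuous_at_imp_continuous_on, rule ballI)
    fix s :: real
    have "continuous_on {..<\<bar>s\<bar> + 1} (\<lambda>s. G (max 0 s))"
      by (rule continuous_on_compose2[OF G_continuous_nonneg[of "\<bar>s\<bar> + 1"]]) (auto intro!: continuous_intros)
    then show "isCont (\<lambda>s. G (max 0 s)) s"
      by (rule continuous_on_interior) (simp add: interior_open abs_real_def)
  qed
  moreover have "(\<lambda>s. G (max 0 s)) = G" by (auto simp: fun_eq_iff max_def G_zero)
  ultimately show ?thesis by (simp only:)
qed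

lemma G_pos: assumes "s > 0" shows "G s > 0"
proof -
  have "G (s/2) < G s"
  proof (rule DERIV_pos_imp_increasing_open[where f = G])
    fix x assume "s/2 < x" "x < s"
    then show "\<exists>y. (G has_real_derivative y) (at x) \<and> y > 0" using G_deriv[of x] g_pos[of x] assms by force
  qed (use assms continuous_on_subset[OF G_continuous_nonneg[of s]] in auto)
  then show ?thesis using G_nonneg[of "s/2"] by linarith
qed

text \<open>The growth condition integrated once: the derivative of \<open>s * g s - p * G s\<close>
  is \<open>s * g' s - (p - 1) * g s\<close>, which is nonnegative. \<open>G_upper\<close> is the
  mirror image.\<close>

lemma G_lower: assumes "s > 0" shows "p * G s \<le> s * g s"
proof -
  have "0 * g 0 - p * G 0 \<le> s * g s - p * G s"
  proof (rule DERIV_nonneg_imp_increasing_open[where f = "\<lambda>s. s * g s - p * G s"])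
    fix x assume x: "0 < x" "x < s"
    have "((\<lambda>s. s * g s - p * G s) has_real_derivative (x * g' x + g x - p * g x)) (at x)"
      by (auto intro!: derivative_eq_intros g_deriv_at G_deriv x)
    moreover have "x * g' x + g x - p * g x \<ge> 0" using g_growth_lower[OF x(1)] by (simp add: algebra_simps)
    ultimately show "\<exists>y. ((\<lambda>s. s * g s - p * G s) has_real_derivative y) (at x) \<and> 0 \<le> y" by blast
  qed (use assms in \<open>auto intro!: continuous_intros G_continuous_nonneg continuous_on_subset[OF g_continuous]\<close>)
  then show ?thesis by (simp add: G_zero)
qed

lemma G_upper: assumes "s > 0" shows "s * g s \<le> q * G s"
proof -
  have "q * G 0 - 0 * g 0 \<le> q * G s - s * g s"
  proof (rule DERIV_nonneg_imp_increasing_open[where f = "\<lambda>s. q * G s - s * g s"])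
    fix x assume x: "0 < x" "x < s"
    have "((\<lambda>s. q * G s - s * g s) has_real_derivative (q * g x - (x * g' x + g x))) (at x)"
      by (auto intro!: derivative_eq_intros g_deriv_at G_deriv x)
    moreover have "q * g x - (x * g' x + g x) \<ge> 0" using g_growth_upper[OF x(1)] by (simp add: algebra_simps)
    ultimately show "\<exists>y. ((\<lambda>s. q * G s - s * g s) has_real_derivative y) (at x) \<and> 0 \<le> y" by blast
  qed (use assms in \<open>auto intro!: continuous_intros G_continuous_nonneg continuous_on_subset[OF g_continuous]\<close>)
  then show ?thesis by (simp add: G_zero)
qed

text \<open>Convexity in the form of a supporting line, from monotonicity of \<open>g\<close>. Both
  \<open>G_shrink\<close> and \<open>G_jensen\<close> rest on it.\<close>

lemma G_tangent: assumes "a \<ge> 0" "b \<ge> 0" shows "G b + g b * (a - b) \<le> G a"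
proof (cases "a \<le> b")
  case True
  have "g b * a - G a \<le> g b * b - G b"
  proof (rule DERIV_nonneg_imp_increasing_open[OF True, where f = "\<lambda>s. g b * s - G s"])
    fix x assume x: "a < x" "x < b"
    have "((\<lambda>s. g b * s - G s) has_real_derivative (g b - g x)) (at x)"
      using x assms by (auto intro!: derivative_eq_intros G_deriv)
    moreover have "g b - g x \<ge> 0" using g_mono[of x b] x assms by simp
    ultimately show "\<exists>y. ((\<lambda>s. g b * s - G s) has_real_derivative y) (at x) \<and> 0 \<le> y" by blast
  qed (use assms in \<open>auto intro!: continuous_intros continuous_on_subset[OF G_continuous_nonneg[of b]]\<close>)
  then show ?thesis by (simp add: algebra_simps)
next
  case False
  then have le: "b \<le> a" by simp
  have "G b - g b * b \<le> G a - g b * a"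
  proof (rule DERIV_nonneg_imp_increasing_open[OF le, where f = "\<lambda>s. G s - g b * s"])
    fix x assume x: "b < x" "x < a"
    have "((\<lambda>s. G s - g b * s) has_real_derivative (g x - g b)) (at x)"
      using x assms by (auto intro!: derivative_eq_intros G_deriv)
    moreover have "g x - g b \<ge> 0" using g_mono[of b x] x assms by simp
    ultimately show "\<exists>y. ((\<lambda>s. G s - g b * s) has_real_derivative y) (at x) \<and> 0 \<le> y" by blast
  qed (use assms in \<open>auto intro!: continuous_intros continuous_on_subset[OF G_continuous_nonneg[of a]]\<close>)
  then show ?thesis by (simp add: algebra_simps)
qed

text \<open>By \<open>G_lower\<close> the logarithmic derivative of \<open>G\<close> is at least
  p/s, so \<open>ln (G s) - p * ln s\<close> is nondecreasing. \<open>G_scale_upper\<close>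
  integrates the opposite bound q/s.\<close>

lemma G_scale_lower: assumes "c \<ge> 1" "s \<ge> 0" shows "c powr p * G s \<le> G (c * s)"
proof (cases "s = 0")
  case True then show ?thesis by (simp add: G_zero)
next
  case False
  then have s: "s > 0" using assms by simp
  have le: "s \<le> c * s" using assms s by simp
  have "ln (G s) - p * ln s \<le> ln (G (c * s)) - p * ln (c * s)"
  proof (rule DERIV_nonneg_imp_increasing_open[OF le, where f = "\<lambda>s. ln (G s) - p * ln s"])
    fix x assume x: "s < x" "x < c * s"
    then have x0: "x > 0" using s by simp
    have "((\<lambda>s. ln (G s) - p * ln s) has_real_derivative (g x / G x - p / x)) (at x)"
      using x0 G_pos[OF x0] by (auto intro!: derivative_eq_intros G_deriv)
    moreover have "g x / G x - p / x \<ge> 0" using G_lower[OF x0] x0 G_pos[OF x0] by (simp add: field_simps)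
    ultimately show "\<exists>y. ((\<lambda>s. ln (G s) - p * ln s) has_real_derivative y) (at x) \<and> 0 \<le> y" by blast
  next
    have "G x \<noteq> 0" if "x \<in> {s..c * s}" for x using that s G_pos[of x] by force
    then show "continuous_on {s..c * s} (\<lambda>s. ln (G s) - p * ln s)"
      using s by (intro continuous_intros continuous_on_subset[OF G_continuous_nonneg[of "c * s"]]) auto
  qed
  then have "ln (c powr p * G s) \<le> ln (G (c * s))"
    using assms s G_pos[OF s] by (simp add: ln_mult ln_powr algebra_simps)
  then show ?thesis using G_pos[of "c * s"] G_pos[OF s] assms s by (subst (asm) ln_le_cancel_iff) auto
qed

lemma G_scale_upper: assumes "c \<ge> 1" "s \<ge> 0" shows "G (c * s) \<le> c powr q * G s"
proof (cases "s = 0")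
  case True then show ?thesis by (simp add: G_zero)
next
  case False
  then have s: "s > 0" using assms by simp
  have le: "s \<le> c * s" using assms s by simp
  have "q * ln s - ln (G s) \<le> q * ln (c * s) - ln (G (c * s))"
  proof (rule DERIV_nonneg_imp_increasing_open[OF le, where f = "\<lambda>s. q * ln s - ln (G s)"])
    fix x assume x: "s < x" "x < c * s"
    then have x0: "x > 0" using s by simp
    have "((\<lambda>s. q * ln s - ln (G s)) has_real_derivative (q / x - g x / G x)) (at x)"
      using x0 G_pos[OF x0] by (auto intro!: derivative_eq_intros G_deriv)
    moreover have "q / x - g x / G x \<ge> 0" using G_upper[OF x0] x0 G_pos[OF x0] by (simp add: field_simps)
    ultimately show "\<exists>y. ((\<lambda>s. q * ln s - ln (G s)) has_real_derivative y) (at x) \<and> 0 \<le> y" by blast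
  next
    have "G x \<noteq> 0" if "x \<in> {s..c * s}" for x using that s G_pos[of x] by force
    then show "continuous_on {s..c * s} (\<lambda>s. q * ln s - ln (G s))"
      using s by (intro continuous_intros continuous_on_subset[OF G_continuous_nonneg[of "c * s"]]) auto
  qed
  then have "ln (G (c * s)) \<le> ln (c powr q * G s)"
    using assms s G_pos[OF s] by (simp add: ln_mult ln_powr algebra_simps)
  then show ?thesis using G_pos[of "c * s"] G_pos[OF s] assms s by (subst (asm) ln_le_cancel_iff) auto
qed

lemma G_sum: assumes "a \<ge> 0" "b \<ge> 0" shows "G (a + b) \<le> 2 powr q * (G a + G b)"
proof -
  have "G (a + b) \<le> G (2 * max a b)" by (intro G_mono) auto
  also have "\<dots> \<le> 2 powr q * G (max a b)" using assms by (intro G_scale_upper) auto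
  also have "\<dots> \<le> 2 powr q * (G a + G b)"
    using G_nonneg[of a] G_nonneg[of b] by (intro mult_left_mono) (auto simp: max_def)
  finally show ?thesis .
qed

lemma G_shrink: assumes "0 \<le> c" "c \<le> 1" "s \<ge> 0" shows "G (c * s) \<le> c * G s"
proof (cases "c * s > 0")
  case False
  then have "c * s \<le> 0" by simp
  then show ?thesis using assms G_nonneg by (simp add: G_zero)
next
  case True
  then have c: "c > 0" "s > 0" using assms by (auto simp: zero_less_mult_iff)
  have "G (c * s) + g (c * s) * (s - c * s) \<le> G s" using assms by (intro G_tangent) auto
  moreover have "G (c * s) + g (c * s) * (0 - c * s) \<le> G 0" using assms by (intro G_tangent) auto
  ultimately have "c * (G (c * s) + g (c * s) * (s - c * s)) + (1 - c) * (G (c * s) + g (c * s) * (0 - c * s)) \<le> c * G s + (1 - c) * G 0"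
    using assms by (intro add_mono mult_left_mono) auto
  then show ?thesis by (simp add: G_zero algebra_simps)
qed

text \<open>If \<open>b\<close> is at most \<open>\<tau> * a\<close>, the product is a small
  multiple of \<open>g a * a\<close>, hence of \<open>G a\<close>. Otherwise \<open>a\<close> is
  below \<open>b / \<tau>\<close>, monotonicity of \<open>g\<close> moves everything to
  \<open>b\<close>, and scaling pays for the division by \<tau>.\<close>

lemma young: assumes "a \<ge> 0" "b \<ge> 0" "0 < \<tau>" "\<tau> \<le> 1"
  shows "g a * b \<le> \<tau> * q * G a + \<tau> * q * (1 / \<tau>) powr q * G b"
proof -
  have key: "g s * s \<le> q * G s" if "s \<ge> 0" for s
    using G_upper[of s] that by (cases "s = 0") (auto simp: G_zero algebra_simps)
  have q: "q > 0" using q_gt_1 by simp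
  show ?thesis
  proof (cases "b \<le> \<tau> * a")
    case True
    have "g a * b \<le> g a * (\<tau> * a)" using True g_nonneg assms by (intro mult_left_mono) auto
    also have "\<dots> = \<tau> * (g a * a)" by simp
    also have "\<dots> \<le> \<tau> * (q * G a)" using key assms by (intro mult_left_mono) auto
    moreover have "\<tau> * q * (1 / \<tau>) powr q * G b \<ge> 0"
      using assms q G_nonneg by (intro mult_nonneg_nonneg) auto
    ultimately show ?thesis by simp
  next
    case False
    then have "a \<le> b / \<tau>" using assms by (simp add: field_simps)
    then have "g a * b \<le> g (b / \<tau>) * b" using g_mono assms by (intro mult_right_mono) auto
    also have "\<dots> = \<tau> * (g (b / \<tau>) * (b / \<tau>))" using assms by simp
    also have "\<dots> \<le> \<tau> * (q * G (b / \<tau>))" using key[of "b / \<tau>"] assms by (intro mult_left_mono[OF _ less_imp_le]) auto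
    also have "\<dots> \<le> \<tau> * (q * ((1 / \<tau>) powr q * G b))"
      using G_scale_upper[of "1 / \<tau>" b] assms q by (intro mult_left_mono) auto
    moreover have "\<tau> * q * G a \<ge> 0"
      using assms q G_nonneg by (intro mult_nonneg_nonneg) auto
    ultimately show ?thesis by simp
  qed
qed

text \<open>The normalization \<open>G 1 = 1\<close> anchors the scaling bounds: \<open>G\<close>
  dominates the power \<open>p\<close> above 1 and, in \<open>G_ge_powr_small\<close>, the power
  \<open>q\<close> below 1.\<close>

lemma G_ge_powr: assumes "s \<ge> 1" shows "s powr p \<le> G s"
  using G_scale_lower[of s 1] assms by (simp add: G_one)

lemma G_ge_powr_small: assumes "0 < s" "s \<le> 1" shows "s powr q \<le> G s"
proof -
  have "G ((1 / s) * s) \<le> (1 / s) powr q * G s" using assms by (intro G_scale_upper) auto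
  then show ?thesis using assms by (simp add: G_one powr_divide field_simps)
qed

lemma G_ge_id: assumes "s \<ge> 0" shows "s \<le> 1 + G s"
proof (cases "s \<ge> 1")
  case True
  have "s = s powr 1" using True by simp
  also have "\<dots> \<le> s powr p" using True p_gt_1 by (intro powr_mono) auto
  also have "\<dots> \<le> G s" using G_ge_powr[OF True] .
  finally show ?thesis by simp
next
  case False then show ?thesis using G_nonneg[of s] by linarith
qed

lemma g_le_G: assumes "s \<ge> 0" shows "g s \<le> g 1 + q * G s"
proof (cases "s \<ge> 1")
  case True
  then have "g s \<le> s * g s" using g_nonneg[of s] by (simp add: mult_le_cancel_right1)
  then show ?thesis using G_upper[of s] True g_nonneg[of 1] by simp
next
  case False
  then have "g s \<le> g 1" using assms by (intro g_mono) auto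
  moreover have "q * G s \<ge> 0" using q_gt_1 G_nonneg[of s] by (intro mult_nonneg_nonneg) auto
  ultimately show ?thesis by linarith
qed

text \<open>The supporting line is taken at \<open>a\<close> and not at the mean. As its slope is
  nonnegative, \<open>a\<close> may be any number below the mean, which is what norm estimates
  deliver.\<close>

lemma G_jensen:
  assumes k: "integrable M k" "\<And>x. k x \<ge> 0" "integral\<^sup>L M k = 1"
    and f: "integrable M (\<lambda>x. k x * f x)" "\<And>x. f x \<ge> 0"
    and Gf: "integrable M (\<lambda>x. k x * G (f x))"
    and a: "0 \<le> a" "a \<le> (\<integral>x. k x * f x \<partial>M)"
  shows "G a \<le> (\<integral>x. k x * G (f x) \<partial>M)"
proof -
  have "G a \<le> G a + g a * ((\<integral>x. k x * f x \<partial>M) - a)"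
    using a g_nonneg[of a] by simp
  also have "\<dots> = (\<integral>x. (G a - g a * a) * k x + g a * (k x * f x) \<partial>M)"
    using k f by (simp add: right_diff_distrib)
  also have "\<dots> \<le> (\<integral>x. k x * G (f x) \<partial>M)"
  proof (rule integral_mono)
    fix x
    have "k x * (G a + g a * (f x - a)) \<le> k x * G (f x)"
      using k f a by (intro mult_left_mono G_tangent) auto
    then show "(G a - g a * a) * k x + g a * (k x * f x) \<le> k x * G (f x)" by (simp add: algebra_simps)
  qed (use k f Gf in auto)
  finally show ?thesis .
qed

end

section \<open>Coercivity and growth of the vector field\<close>

locale orlicz_field = orlicz +
  fixes A :: "'a::euclidean_space \<Rightarrow> 'a" and DA :: "'a \<Rightarrow> 'a \<Rightarrow>\<^sub>L 'a" and \<nu> L :: real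
  assumes A_deriv: "\<And>\<xi>. (A has_derivative blinfun_apply (DA \<xi>)) (at \<xi>)"
    and A_zero: "A 0 = 0"
    and \<nu>_pos: "0 < \<nu>" and L_pos: "0 < L"
    and A_elliptic: "\<And>\<xi> \<zeta>. \<xi> \<noteq> 0 \<Longrightarrow> blinfun_apply (DA \<xi>) \<zeta> \<bullet> \<zeta> \<ge> \<nu> * (g (norm \<xi>) / norm \<xi>) * (norm \<zeta>)\<^sup>2"
    and A_growth: "\<And>\<xi>. \<xi> \<noteq> 0 \<Longrightarrow> norm (DA \<xi>) \<le> L * (g (norm \<xi>) / norm \<xi>)"
begin

lemma A_continuous: "continuous_on S A"
  by (rule has_derivative_continuous_on, rule has_derivative_at_withinI, rule A_deriv)

lemma A_measurable [measurable]: "A \<in> borel_measurable borel"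
  by (rule borel_measurable_continuous_onI, rule A_continuous)

lemma A_ray_deriv: "((\<lambda>s. A (s *\<^sub>R \<xi>) \<bullet> e) has_real_derivative (blinfun_apply (DA (s *\<^sub>R \<xi>)) \<xi> \<bullet> e)) (at s)"
proof -
  have "((\<lambda>s. s *\<^sub>R \<xi>) has_derivative (\<lambda>h. h *\<^sub>R \<xi>)) (at s)"
    by (auto intro!: derivative_eq_intros)
  from diff_chain_at[OF this A_deriv]
  have "((\<lambda>s. A (s *\<^sub>R \<xi>)) has_derivative (\<lambda>h. blinfun_apply (DA (s *\<^sub>R \<xi>)) (h *\<^sub>R \<xi>))) (at s)"
    by (simp add: o_def)
  from has_derivative_inner_left[OF this, of e]
  show ?thesis by (simp add: has_field_derivative_def blinfun.scaleR_right mult_commute_abs)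
qed

lemma A_ray_continuous: "continuous_on S (\<lambda>s. A (s *\<^sub>R \<xi>) \<bullet> e)"
  by (intro continuous_intros continuous_on_compose2[OF A_continuous[of UNIV]]) auto

lemma G_ray_deriv: assumes "s > 0" "\<xi> \<noteq> 0"
  shows "((\<lambda>s. G (s * norm \<xi>)) has_real_derivative (g (s * norm \<xi>) * norm \<xi>)) (at s)"
  by (rule DERIV_chain2[OF G_deriv]) (use assms in \<open>auto intro!: derivative_eq_intros\<close>)

text \<open>Both sides vanish at the origin and are compared by their derivatives along the ray from
  0 to \<xi>.\<close>

lemma A_coercive: "\<nu> * G (norm \<xi>) \<le> A \<xi> \<bullet> \<xi>"
proof (cases "\<xi> = 0")
  case True then show ?thesis by (simp add: G_zero)
next
  case False
  let ?f = "\<lambda>s. A (s *\<^sub>R \<xi>) \<bullet> \<xi> - \<nu> * G (s * norm \<xi>)"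
  have "?f 0 \<le> ?f 1"
  proof (rule DERIV_nonneg_imp_increasing_open[where f = ?f])
    fix s :: real assume s: "0 < s" "s < 1"
    have "(?f has_real_derivative (blinfun_apply (DA (s *\<^sub>R \<xi>)) \<xi> \<bullet> \<xi> - \<nu> * (g (s * norm \<xi>) * norm \<xi>))) (at s)"
      by (intro derivative_intros A_ray_deriv DERIV_cmult G_ray_deriv s False)
    moreover have "blinfun_apply (DA (s *\<^sub>R \<xi>)) \<xi> \<bullet> \<xi> - \<nu> * (g (s * norm \<xi>) * norm \<xi>) \<ge> 0"
    proof -
      have g0: "g (s * norm \<xi>) \<ge> 0" using s by (intro g_nonneg) auto
      have "\<nu> * (g (s * norm \<xi>) / (s * norm \<xi>)) * (norm \<xi>)\<^sup>2 \<le> blinfun_apply (DA (s *\<^sub>R \<xi>)) \<xi> \<bullet> \<xi>"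
        using A_elliptic[of "s *\<^sub>R \<xi>" \<xi>] s False by simp
      moreover have "\<nu> * (g (s * norm \<xi>) / (s * norm \<xi>)) * (norm \<xi>)\<^sup>2 = (\<nu> * (g (s * norm \<xi>) * norm \<xi>)) / s"
        using False by (simp add: power2_eq_square field_simps)
      \<comment> \<open>Ellipticity provides an additional factor 1/s, which is at least 1 on the
        segment and may be dropped.\<close>
      moreover have "\<nu> * (g (s * norm \<xi>) * norm \<xi>) \<le> (\<nu> * (g (s * norm \<xi>) * norm \<xi>)) / s"
        using s g0 \<nu>_pos by (intro divide_left_mono[of s 1, simplified]) (auto intro!: mult_nonneg_nonneg)
      ultimately show ?thesis by linarith
    qed
    ultimately show "\<exists>y. (?f has_real_derivative y) (at s) \<and> 0 \<le> y" by blast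
  next
    show "continuous_on {0..1} ?f"
      by (intro continuous_intros A_ray_continuous continuous_on_compose2[OF G_continuous]) auto
  qed simp
  then show ?thesis by (simp add: A_zero G_zero)
qed

lemma A_bound: "norm (A \<xi>) \<le> (L / (p - 1)) * g (norm \<xi>)"
proof (cases "\<xi> = 0")
  case True then show ?thesis using A_zero g_nonneg[of 0] L_pos p_gt_1 by simp
next
  case False
  \<comment> \<open>Testing with the direction of \<open>A \<xi>\<close> makes the problem scalar.
    If \<open>A \<xi> = 0\<close>, division by zero gives \<open>e = 0\<close>, which serves equally
    well.\<close>
  define e where "e = (1 / norm (A \<xi>)) *\<^sub>R A \<xi>"
  have e: "norm e \<le> 1" by (simp add: e_def)
  let ?c = "L / (p - 1)"
  let ?f = "\<lambda>s. ?c * g (s * norm \<xi>) - A (s *\<^sub>R \<xi>) \<bullet> e"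
  have "?f 0 \<le> ?f 1"
  proof (rule DERIV_nonneg_imp_increasing_open[where f = ?f])
    fix s :: real assume s: "0 < s" "s < 1"
    have sn: "s * norm \<xi> > 0" using s False by simp
    have "((\<lambda>s. g (s * norm \<xi>)) has_real_derivative (g' (s * norm \<xi>) * norm \<xi>)) (at s)"
      by (rule DERIV_chain2[of g _ "\<lambda>s. s * norm \<xi>"], rule g_deriv_at[OF sn]) (auto intro!: derivative_eq_intros)
    then have "(?f has_real_derivative (?c * (g' (s * norm \<xi>) * norm \<xi>) - blinfun_apply (DA (s *\<^sub>R \<xi>)) \<xi> \<bullet> e)) (at s)"
      by (intro derivative_intros A_ray_deriv DERIV_cmult)
    moreover have "blinfun_apply (DA (s *\<^sub>R \<xi>)) \<xi> \<bullet> e \<le> ?c * (g' (s * norm \<xi>) * norm \<xi>)"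
    proof -
      have "blinfun_apply (DA (s *\<^sub>R \<xi>)) \<xi> \<bullet> e \<le> norm (blinfun_apply (DA (s *\<^sub>R \<xi>)) \<xi>) * norm e"
        by (rule norm_cauchy_schwarz)
      also have "\<dots> \<le> norm (DA (s *\<^sub>R \<xi>)) * norm \<xi> * 1"
        using e by (intro mult_mono norm_blinfun) auto
      also have "\<dots> \<le> (L * (g (s * norm \<xi>) / (s * norm \<xi>))) * norm \<xi>"
        unfolding mult_1_right by (rule mult_right_mono) (use A_growth[of "s *\<^sub>R \<xi>"] s False in auto)
      also have "\<dots> = ?c * ((p - 1) * g (s * norm \<xi>)) / s"
      proof -
        have "L * (c / (s * n)) * n = L / w * (w * c) / s" if "w \<noteq> 0" "n \<noteq> 0" for c n w :: real using that by simp
        then show ?thesis using False p_gt_1 by force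
      qed
      \<comment> \<open>The growth bound replaces the possibly singular quotient g(t)/t by g'(t)/(p
        - 1), an exact derivative along the ray; this is the origin of the constant L/(p -
        1).\<close>
      also have "\<dots> \<le> ?c * ((s * norm \<xi>) * g' (s * norm \<xi>)) / s"
        using g_growth_lower[OF sn] s L_pos p_gt_1 by (intro divide_right_mono mult_left_mono) auto
      also have "\<dots> = ?c * (g' (s * norm \<xi>) * norm \<xi>)" using s by simp
      finally show ?thesis .
    qed
    ultimately show "\<exists>y. (?f has_real_derivative y) (at s) \<and> 0 \<le> y" 
      by (intro exI[where x = "?c * (g' (s * norm \<xi>) * norm \<xi>) - blinfun_apply (DA (s *\<^sub>R \<xi>)) \<xi> \<bullet> e"] conjI) simp_all
  next
    show "continuous_on {0..1} ?f"
      by (intro continuous_intros A_ray_continuous continuous_on_compose2[OF g_continuous]) auto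
  qed simp
  moreover have "A \<xi> \<bullet> e = norm (A \<xi>)"
    by (cases "A \<xi> = 0") (auto simp: e_def dot_square_norm power2_eq_square)
  moreover have "?c * g 0 \<ge> 0" using g_nonneg[of 0] L_pos p_gt_1 by simp
  ultimately show ?thesis by (simp add: A_zero)
qed

end

subsection \<open>Truncations, cutoffs and integration by parts\<close>

text \<open>Built backwards from \<open>trunc2\<close>, a continuous substitute for the indicator of
  the positive half-line: \<open>trunc1\<close> and \<open>trunc0\<close> are its successive
  primitives, substitutes for the positive part and half its square.\<close>

definition trunc0 :: "real \<Rightarrow> real" where "trunc0 s = (if s > 0 then s\<^sup>2 / 2 - s + 1 - exp (- s) else 0)"
definition trunc1 :: "real \<Rightarrow> real" where "trunc1 s = (if s > 0 then s - 1 + exp (- s) else 0)"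
definition trunc2 :: "real \<Rightarrow> real" where "trunc2 s = (if s > 0 then 1 - exp (- s) else 0)"

lemma exp_minus_upper: "s \<ge> 0 \<Longrightarrow> exp (- s) \<le> 1 - s + s\<^sup>2" for s :: real
proof -
  assume s: "s \<ge> 0"
  have "exp (- s) \<le> 1 / (1 + s)"
    using exp_ge_add_one_self[of s] s by (simp add: exp_minus field_simps)
  also have "\<dots> \<le> 1 - s + s\<^sup>2"
  proof -
    have "1 \<le> (1 - s + s\<^sup>2) * (1 + s)" using s by (simp add: algebra_simps power2_eq_square power3_eq_cube)
    then show ?thesis using s by (simp add: field_simps)
  qed
  finally show ?thesis .
qed

lemma DERIV_trunc0: "(trunc0 has_real_derivative trunc1 s) (at s)"
  unfolding trunc1_def
proof (rule DERIV_zero_ext_pos[where F = "\<lambda>s. s\<^sup>2 / 2 - s + 1 - exp (- s)" and C = 1])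
  fix s :: real assume s: "s > 0"
  show "((\<lambda>s. s\<^sup>2 / 2 - s + 1 - exp (- s)) has_real_derivative s - 1 + exp (- s)) (at s)"
    by (auto intro!: derivative_eq_intros)
  show "\<bar>s\<^sup>2 / 2 - s + 1 - exp (- s)\<bar> \<le> 1 * s\<^sup>2"
    using exp_minus_upper[of s] exp_ge_add_one_self[of "-s"] s zero_le_power2[of s] by (simp only: abs_le_iff) linarith
qed (auto simp: trunc0_def)

lemma DERIV_trunc1: "(trunc1 has_real_derivative trunc2 s) (at s)"
  unfolding trunc2_def
proof (rule DERIV_zero_ext_pos[where F = "\<lambda>s. s - 1 + exp (- s)" and C = 1])
  fix s :: real assume s: "s > 0"
  show "((\<lambda>s. s - 1 + exp (- s)) has_real_derivative 1 - exp (- s)) (at s)"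
    by (auto intro!: derivative_eq_intros)
  show "\<bar>s - 1 + exp (- s)\<bar> \<le> 1 * s\<^sup>2"
    using exp_minus_upper[of s] exp_ge_add_one_self[of "-s"] s zero_le_power2[of s] by (simp only: abs_le_iff) linarith
qed (auto simp: trunc1_def)

lemma trunc2_nonneg: "trunc2 s \<ge> 0" and trunc2_le_1: "trunc2 s \<le> 1"
  by (auto simp: trunc2_def)

lemma trunc1_nonneg: "trunc1 s \<ge> 0"
  using exp_ge_add_one_self[of "-s"] by (auto simp: trunc1_def)

lemma trunc1_le: "trunc1 s \<le> max 0 s"
  by (auto simp: trunc1_def)

lemma trunc0_le: "trunc0 s \<le> (max 0 s)\<^sup>2 / 2"
  using exp_ge_add_one_self[of "-s"] by (auto simp: trunc0_def)

text \<open>Equivalent to (1 + s) exp(-s) <= 1. In the energy the gradient term carries the weight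
  \<open>trunc2\<close>; this lemma puts the same weight on the mixed term so that it can be
  absorbed.\<close>

lemma trunc1_le_trunc2: "trunc1 s \<le> max 0 s * trunc2 s"
proof (cases "s > 0")
  case True
  have "(1 + s) * exp (- s) \<le> exp s * exp (- s)" using exp_ge_add_one_self[of s] by (intro mult_right_mono) auto
  then show ?thesis using True by (simp add: trunc1_def trunc2_def algebra_simps flip: exp_add)
qed (simp add: trunc1_def)

text \<open>The derivative of the difference is \<open>2 * trunc1 x * (1 - trunc2 x)\<close>, which
  is nonnegative. It turns the slice energy, written with \<open>trunc0\<close>, into an L2 bound
  for \<open>trunc1\<close>.\<close>

lemma trunc1_square: "(trunc1 s)\<^sup>2 \<le> 2 * trunc0 s"
proof (cases "s > 0")
  case True
  have "2 * trunc0 0 - (trunc1 0)\<^sup>2 \<le> 2 * trunc0 s - (trunc1 s)\<^sup>2"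
  proof (rule DERIV_nonneg_imp_nondecreasing[where f = "\<lambda>s. 2 * trunc0 s - (trunc1 s)\<^sup>2"])
    fix x
    have "((\<lambda>s. 2 * trunc0 s - (trunc1 s)\<^sup>2) has_real_derivative (2 * trunc1 x * (1 - trunc2 x))) (at x)"
      by (auto intro!: derivative_eq_intros DERIV_trunc0 DERIV_trunc1 simp: algebra_simps)
    moreover have "2 * trunc1 x * (1 - trunc2 x) \<ge> 0"
      using trunc1_nonneg[of x] trunc2_le_1[of x] by simp
    ultimately show "\<exists>y. ((\<lambda>s. 2 * trunc0 s - (trunc1 s)\<^sup>2) has_real_derivative y) (at x) \<and> 0 \<le> y" by blast
  qed (use True in auto)
  then show ?thesis by (simp add: trunc0_def trunc1_def)
qed (simp add: trunc0_def trunc1_def)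

lemma trunc0_nonneg: "trunc0 s \<ge> 0"
  using trunc1_square[of s] zero_le_power2[of "trunc1 s"] by linarith

text \<open>Up to 2 the function is at least s^2/4, because exp(-s) is at least the square of 1 -
  s/2; beyond 2 it is comparable to \<open>s\<close>. The quadratic behaviour at 0 is what costs the
  factor \<open>d\<close>.\<close>

lemma trunc1_lower: assumes "0 < d" "d \<le> 1" "d \<le> s" shows "s * d / 4 \<le> trunc1 s"
proof (cases "s \<le> 2")
  case True
  have "(1 - s/2)\<^sup>2 \<le> (exp (- (s/2)))\<^sup>2"
    using exp_ge_add_one_self[of "- (s/2)"] True by (intro power_mono) auto
  also have "\<dots> = exp (- s)" by (simp add: power2_eq_square flip: exp_add)
  finally have "s\<^sup>2 / 4 \<le> trunc1 s" using assms by (simp add: trunc1_def power2_eq_square algebra_simps)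
  moreover have "s * d \<le> s\<^sup>2" using assms by (simp add: power2_eq_square)
  ultimately show ?thesis by linarith
next
  case False
  have "s * d \<le> s * 1" using assms by (intro mult_left_mono) auto
  moreover have "exp (- s) > 0" by simp
  ultimately have "s * d / 4 \<le> s - 1 + exp (- s)" using False by linarith
  then show ?thesis using assms by (simp add: trunc1_def)
qed

lemma trunc0_continuous: "continuous_on S trunc0"
  by (rule DERIV_continuous_on, rule has_field_derivative_at_within, rule DERIV_trunc0)
lemma trunc1_continuous: "continuous_on S trunc1"
  by (rule DERIV_continuous_on, rule has_field_derivative_at_within, rule DERIV_trunc1)
lemma trunc2_continuous: "continuous_on S trunc2"
proof -
  have "trunc2 = (\<lambda>s. 1 - exp (- max 0 s))" by (auto simp: trunc2_def fun_eq_iff max_def)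
  moreover have "continuous_on S (\<lambda>s::real. 1 - exp (- max 0 s))" by (intro continuous_intros)
  ultimately show ?thesis by (simp only:)
qed

lemmas trunc_continuous_compose [continuous_intros] =
  continuous_on_compose2[OF trunc0_continuous[of UNIV] _ subset_UNIV]
  continuous_on_compose2[OF trunc1_continuous[of UNIV] _ subset_UNIV]
  continuous_on_compose2[OF trunc2_continuous[of UNIV] _ subset_UNIV]

lemma trunc_measurable [measurable]:
  "trunc0 \<in> borel_measurable borel" "trunc1 \<in> borel_measurable borel" "trunc2 \<in> borel_measurable borel"
  by (auto intro!: borel_measurable_continuous_onI trunc0_continuous trunc1_continuous trunc2_continuous)

section \<open>Cutoff functions of class C1\<close>

definition sqpos :: "real \<Rightarrow> real" where "sqpos s = (max 0 s)\<^sup>2"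

lemma DERIV_sqpos: "(sqpos has_real_derivative 2 * max 0 s) (at s)"
proof -
  have "(sqpos has_real_derivative (if s > 0 then 2 * s else 0)) (at s)"
  proof (rule DERIV_zero_ext_pos[where F = "\<lambda>s. s\<^sup>2" and C = 1])
    fix s :: real show "((\<lambda>s. s\<^sup>2) has_real_derivative 2 * s) (at s)"
      by (auto intro!: derivative_eq_intros)
  qed (auto simp: sqpos_def)
  then show ?thesis by (auto simp: max_def split: if_splits)
qed

lemma sqpos_continuous: "continuous_on S sqpos"
  by (rule DERIV_continuous_on, rule has_field_derivative_at_within, rule DERIV_sqpos)

text \<open>With \<open>A\<close> affine in the squared distance, 0 at radius \<open>a\<close> and 1
  at radius \<open>b\<close>, the cutoff is 1 - A^2 with both positive parts squared. The constant 8
  is three factors 2: two outer squares and the squared norm.\<close>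

lemma cutoff_exists:
  fixes z0 :: "'a::euclidean_space"
  assumes ab: "0 < a" "a < b"
  shows "\<exists>\<phi> \<phi>'. (\<forall>z. (\<phi> has_derivative \<phi>' z) (at z)) \<and> (\<forall>h. continuous_on UNIV (\<lambda>z. \<phi>' z h)) \<and>
    (\<forall>z. 0 \<le> \<phi> z \<and> \<phi> z \<le> 1) \<and> (\<forall>z\<in>cball z0 a. \<phi> z = 1) \<and> (\<forall>z. z \<notin> ball z0 b \<longrightarrow> \<phi> z = 0) \<and>
    (\<forall>z h. \<bar>\<phi>' z h\<bar> \<le> 8 * b / (b\<^sup>2 - a\<^sup>2) * norm h)"
proof -
  define w where "w = b\<^sup>2 - a\<^sup>2"
  have w: "w > 0" using ab by (simp add: w_def power_strict_mono)
  define A where "A z = ((norm (z - z0))\<^sup>2 - a\<^sup>2) / w" for z :: 'a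
  define \<phi> where "\<phi> z = sqpos (1 - sqpos (A z))" for z
  define \<phi>' where "\<phi>' z h = 2 * max 0 (1 - sqpos (A z)) * (- (2 * max 0 (A z) * (2 * ((z - z0) \<bullet> h) / w)))" for z h
  have A': "(A has_derivative (\<lambda>h. 2 * ((z - z0) \<bullet> h) / w)) (at z)" for z
    unfolding A_def[abs_def] power2_norm_eq_inner using w
    by (auto intro!: derivative_eq_intros simp: inner_commute)
  have D: "(\<phi> has_derivative \<phi>' z) (at z)" for z
  proof -
    have s: "(sqpos has_derivative (\<lambda>x. 2 * max 0 s * x)) (at s)" for s
      using DERIV_sqpos[of s] by (simp add: has_field_derivative_def)
    have "((\<lambda>z. sqpos (A z)) has_derivative (\<lambda>h. 2 * max 0 (A z) * (2 * ((z - z0) \<bullet> h) / w))) (at z)"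
      using diff_chain_at[OF A' s] by (simp add: o_def)
    then have "((\<lambda>z. 1 - sqpos (A z)) has_derivative (\<lambda>h. - (2 * max 0 (A z) * (2 * ((z - z0) \<bullet> h) / w)))) (at z)"
      by (auto intro!: derivative_eq_intros)
    from diff_chain_at[OF this s] show ?thesis
      by (simp add: o_def \<phi>_def[abs_def] \<phi>'_def[abs_def])
  qed
  have Ac: "continuous_on UNIV A" unfolding A_def[abs_def] using w by (auto intro!: continuous_intros)
  have C: "continuous_on UNIV (\<lambda>z. \<phi>' z h)" for h
    unfolding \<phi>'_def using w
    by (auto intro!: continuous_intros Ac continuous_on_compose2[OF sqpos_continuous[of UNIV] Ac])
  have lt1: "sqpos s < 1 \<Longrightarrow> s < 1" for s by (auto simp: sqpos_def max_def power_less_one_iff split: if_splits)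
  have Alt: "norm (z - z0) < b" if "A z < 1" for z
  proof -
    have "(norm (z - z0))\<^sup>2 < b\<^sup>2" using that w by (simp add: A_def field_simps) (simp add: w_def)
    then show ?thesis using ab by (auto intro: power2_less_imp_less)
  qed
  have bd: "\<bar>\<phi>' z h\<bar> \<le> 8 * b / w * norm h" for z h
  proof (cases "sqpos (A z) < 1")
    case True
    from lt1[OF True] have A1: "A z < 1" .
    note n = Alt[OF A1]
    have 1: "\<bar>max 0 (1 - sqpos (A z))\<bar> \<le> 1" by (auto simp: sqpos_def)
    have 2: "\<bar>max 0 (A z)\<bar> \<le> 1" using A1 by auto
    have 3: "\<bar>(z - z0) \<bullet> h\<bar> \<le> b * norm h"
      using Cauchy_Schwarz_ineq2[of "z - z0" h] mult_right_mono[OF less_imp_le[OF n] norm_ge_zero[of h]] by linarith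
    have "\<bar>\<phi>' z h\<bar> = (8 / w) * (\<bar>max 0 (1 - sqpos (A z))\<bar> * (\<bar>max 0 (A z)\<bar> * \<bar>(z - z0) \<bullet> h\<bar>))"
      using w by (simp add: \<phi>'_def abs_mult)
    also have "\<dots> \<le> (8 / w) * (1 * (1 * (b * norm h)))"
      using 1 2 3 w ab by (intro mult_left_mono mult_mono) auto
    finally show ?thesis by simp
  next
    case False
    then show ?thesis using w ab by (simp add: \<phi>'_def max_def)
  qed
  have in1: "\<phi> z = 1" if "z \<in> cball z0 a" for z
  proof -
    have "(norm (z - z0))\<^sup>2 \<le> a\<^sup>2" using that by (intro power_mono) (auto simp: dist_norm norm_minus_commute)
    then have "A z \<le> 0" using w by (simp add: A_def divide_nonpos_pos)
    then show ?thesis by (simp add: \<phi>_def sqpos_def)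
  qed
  have out: "\<phi> z = 0" if "z \<notin> ball z0 b" for z
  proof -
    have "\<not> A z < 1" using Alt[of z] that by (auto simp: dist_norm norm_minus_commute)
    then have "\<not> sqpos (A z) < 1" using lt1 by blast
    then show ?thesis by (simp add: \<phi>_def sqpos_def)
  qed
  have r: "0 \<le> \<phi> z \<and> \<phi> z \<le> 1" for z
    by (auto simp: \<phi>_def sqpos_def power_le_one)
  show ?thesis
    by (intro exI[of _ \<phi>] exI[of _ \<phi>']) (use D C bd in1 out r in \<open>auto simp: w_def\<close>)
qed

section \<open>Integration by parts for C1 functions of compact support\<close>

lemma integrable_continuous_compact_support:
  fixes f :: "'a::euclidean_space \<Rightarrow> real"
  assumes c: "continuous_on UNIV f" and z: "\<And>z. norm z > R \<Longrightarrow> f z = 0"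
  shows "integrable lborel f"
proof -
  have "integrable lborel (\<lambda>z. indicator (cball 0 R) z *\<^sub>R f z)"
    by (rule borel_integrable_compact) (auto intro: continuous_on_subset[OF c])
  moreover have "(\<lambda>z. indicator (cball 0 R) z *\<^sub>R f z) = f"
    using z by (auto simp: indicator_def fun_eq_iff)
  ultimately show ?thesis by simp
qed

lemma continuous_compact_support_bounded:
  fixes f :: "'a::euclidean_space \<Rightarrow> real"
  assumes c: "continuous_on UNIV f" and z: "\<And>z. norm z > R \<Longrightarrow> f z = 0"
  shows "\<exists>B\<ge>0. \<forall>z. \<bar>f z\<bar> \<le> B"
proof -
  have "bounded (f ` cball 0 R)"
    by (intro compact_imp_bounded compact_continuous_image continuous_on_subset[OF c]) auto
  then obtain B where B: "\<And>z. z \<in> cball 0 R \<Longrightarrow> \<bar>f z\<bar> \<le> B" unfolding bounded_iff by force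
  have "\<bar>f z\<bar> \<le> max 0 B" for z
    using B[of z] z[of z] by (cases "norm z > R") auto
  then show ?thesis by (intro exI[of _ "max 0 B"]) auto
qed

definition C1_fun :: "('a::euclidean_space \<Rightarrow> 'b::euclidean_space) \<Rightarrow> ('a \<Rightarrow> 'a \<Rightarrow> 'b) \<Rightarrow> bool" where
  "C1_fun f f' \<longleftrightarrow> (\<forall>z. (f has_derivative f' z) (at z)) \<and> (\<forall>h. continuous_on UNIV (\<lambda>z. f' z h))"

lemma C1_fun_deriv: "C1_fun f f' \<Longrightarrow> (f has_derivative f' z) (at z)"
  by (simp add: C1_fun_def)

lemma C1_fun_continuous_deriv: "C1_fun f f' \<Longrightarrow> continuous_on UNIV (\<lambda>z. f' z h)"
  by (simp add: C1_fun_def)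

lemma C1_fun_continuous: assumes "C1_fun f f'" shows "continuous_on UNIV f"
  by (rule has_derivative_continuous_on, rule has_derivative_at_withinI, rule C1_fun_deriv[OF assms])

lemma C1_fun_deriv_outside:
  assumes f: "C1_fun f f'" and z: "\<And>z. norm z > R \<Longrightarrow> f z = 0" and n: "norm z > R"
  shows "f' z h = 0"
proof -
  have "open {z. norm z > R}" by (intro open_Collect_less continuous_intros)
  then have "(f has_derivative (\<lambda>_. 0)) (at z)"
    by (intro has_derivative_transform_within_open[OF has_derivative_const[of 0], of "{z. norm z > R}"]) (use z n in auto)
  with C1_fun_deriv[OF f, of z] have "f' z = (\<lambda>_. 0)" by (rule has_derivative_unique)
  then show ?thesis by simp
qed

lemma C1_fun_line_deriv:
  fixes f :: "'a::euclidean_space \<Rightarrow> real"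
  assumes f: "C1_fun f f'"
  shows "((\<lambda>s. f (z + s *\<^sub>R Y)) has_real_derivative f' (z + s *\<^sub>R Y) Y) (at s)"
proof -
  have "((\<lambda>s. z + s *\<^sub>R Y) has_derivative (\<lambda>h. h *\<^sub>R Y)) (at s)" by (auto intro!: derivative_eq_intros)
  from diff_chain_at[OF this C1_fun_deriv[OF f]]
  have "((\<lambda>s. f (z + s *\<^sub>R Y)) has_derivative (\<lambda>h. f' (z + s *\<^sub>R Y) (h *\<^sub>R Y))) (at s)" by (simp add: o_def)
  moreover have "f' (z + s *\<^sub>R Y) (h *\<^sub>R Y) = f' (z + s *\<^sub>R Y) Y * h" for h
    using linear_scale[OF has_derivative_linear[OF C1_fun_deriv[OF f, of "z + s *\<^sub>R Y"]], of h Y] by simp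
  ultimately show ?thesis by (simp add: has_field_derivative_def)
qed

lemma C1_fun_line_deriv_continuous:
  assumes f: "C1_fun f f'"
  shows "continuous_on S (\<lambda>s. f' (z + s *\<^sub>R Y) h)"
  by (rule continuous_on_compose2[OF C1_fun_continuous_deriv[OF f]]) (auto intro!: continuous_intros)

lemma has_derivative_zero_min:
  fixes f :: "'a::euclidean_space \<Rightarrow> real"
  assumes f: "(f has_derivative f') (at z)" and n: "\<And>z. f z \<ge> 0" and z: "f z = 0"
  shows "f' h = 0"
  using differential_zero_maxmin[of z UNIV f f'] f n z by auto

text \<open>A spatial shift preserves both Lebesgue measure and the half-space
  \<open>snd z \<le> t\<close>, so every difference quotient in direction \<open>Y\<close> has
  integral zero; the mean value theorem provides a bounded majorant with bounded support for the
  limit.\<close>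

lemma C1_fun_integral_deriv_space:
  fixes f :: "'a::euclidean_space \<times> real \<Rightarrow> real"
  assumes f: "C1_fun f f'" and z: "\<And>z. norm z > R \<Longrightarrow> f z = 0" and Y: "snd Y = 0"
  shows "(\<integral>z. indicator {z. snd z \<le> t} z * f' z Y \<partial>lborel) = 0"
proof -
  define I where "I = {z :: 'a \<times> real. snd z \<le> t}"
  have "closed I" unfolding I_def by (intro closed_Collect_le continuous_intros)
  then have [measurable]: "I \<in> sets borel" by simp
  have fc: "continuous_on UNIV f" using C1_fun_continuous[OF f] .
  then have [measurable]: "f \<in> borel_measurable borel" by (rule borel_measurable_continuous_onI)
  have [measurable]: "(\<lambda>z. f' z Y) \<in> borel_measurable borel"
    by (rule borel_measurable_continuous_onI, rule C1_fun_continuous_deriv[OF f])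
  have fi: "integrable lborel f" by (rule integrable_continuous_compact_support[OF fc z])
  have "\<exists>B\<ge>0. \<forall>z. \<bar>f' z Y\<bar> \<le> B"
    by (rule continuous_compact_support_bounded[where R = R])
       (rule C1_fun_continuous_deriv[OF f], rule C1_fun_deriv_outside[OF f z])
  then obtain B where B: "B \<ge> 0" "\<And>z. \<bar>f' z Y\<bar> \<le> B" by blast
  define h where "h n = inverse (real (Suc n))" for n
  have h: "h n > 0" "h n \<le> 1" for n by (auto simp: h_def field_simps)
  have h0: "h \<longlonglongrightarrow> 0" unfolding h_def by (rule LIMSEQ_inverse_real_of_nat)
  define q where "q n z = indicator I z * ((f (z + h n *\<^sub>R Y) - f z) / h n)" for n z
  have iI: "integrable lborel (\<lambda>z. indicator I z * F z)" if "integrable lborel F" for F :: "_ \<Rightarrow> real"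
    using integrable_mult_indicator[OF _ that, of I] by simp
  have q0: "(\<integral>z. q n z \<partial>lborel) = 0" for n
  proof -
    have ish: "indicator I z = (indicator I (z + h n *\<^sub>R Y) :: real)" for z
      using Y by (auto simp: I_def indicator_def)
    have "integrable lborel (\<lambda>z. indicator I z * f (z + h n *\<^sub>R Y))"
      by (rule iI, rule integrable_lborel_translation[OF fi])
    moreover have "(\<integral>z. indicator I z * f (z + h n *\<^sub>R Y) \<partial>lborel) = (\<integral>z. indicator I z * f z \<partial>lborel)"
      by (subst ish, rule integral_lborel_translation) measurable
    ultimately have "(\<integral>z. (indicator I z * f (z + h n *\<^sub>R Y) - indicator I z * f z) / h n \<partial>lborel) = 0"
      using iI[OF fi] by simp
    then show ?thesis by (simp add: q_def right_diff_distrib diff_divide_distrib)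
  qed
  have "(\<lambda>n. \<integral>z. q n z \<partial>lborel) \<longlonglongrightarrow> (\<integral>z. indicator I z * f' z Y \<partial>lborel)"
  proof (rule integral_dominated_convergence[where w = "\<lambda>z. B * indicator (cball 0 (\<bar>R\<bar> + norm Y)) z"])
    show "integrable lborel (\<lambda>z. B * indicat_real (cball (0::'a \<times> real) (\<bar>R\<bar> + norm Y)) z)"
      by (intro integrable_mult_right) (auto simp: integrable_indicator_iff intro!: emeasure_bounded_finite[unfolded infinity_ennreal_def])
    show "AE z in lborel. (\<lambda>n. q n z) \<longlonglongrightarrow> indicator I z * f' z Y"
    proof (rule AE_I2)
      fix z
      have "((\<lambda>s. f (z + s *\<^sub>R Y)) has_real_derivative f' (z + 0 *\<^sub>R Y) Y) (at 0)"
        by (rule C1_fun_line_deriv[OF f])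
      then have "(\<lambda>s. (f (z + s *\<^sub>R Y) - f z) / s) \<midarrow>0\<rightarrow> f' z Y" by (simp add: DERIV_def)
      then have "(\<lambda>n. (f (z + h n *\<^sub>R Y) - f z) / h n) \<longlonglongrightarrow> f' z Y"
      proof (rule filterlim_compose)
        have "h n \<noteq> 0" for n using h(1)[of n] by simp
        then show "filterlim h (at 0) sequentially" using h0 by (simp add: filterlim_at)
      qed
      then show "(\<lambda>n. q n z) \<longlonglongrightarrow> indicator I z * f' z Y"
        unfolding q_def by (intro tendsto_intros)
    qed
    show "AE z in lborel. norm (q n z) \<le> B * indicator (cball 0 (\<bar>R\<bar> + norm Y)) z" for n
    proof (rule AE_I2)
      fix z
      show "norm (q n z) \<le> B * indicator (cball 0 (\<bar>R\<bar> + norm Y)) z"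
      proof (cases "norm z \<le> \<bar>R\<bar> + norm Y")
        case True
        have "\<exists>\<theta>>0. \<theta> < h n \<and> f (z + h n *\<^sub>R Y) - f (z + 0 *\<^sub>R Y) = (h n - 0) * f' (z + \<theta> *\<^sub>R Y) Y"
          by (rule MVT2[OF h(1), where f = "\<lambda>s. f (z + s *\<^sub>R Y)" and f' = "\<lambda>s. f' (z + s *\<^sub>R Y) Y"])
             (rule C1_fun_line_deriv[OF f])
        then obtain \<theta> where \<theta>: "0 < \<theta>" "\<theta> < h n" "f (z + h n *\<^sub>R Y) - f (z + 0 *\<^sub>R Y) = (h n - 0) * f' (z + \<theta> *\<^sub>R Y) Y"
          by blast
        then have "(f (z + h n *\<^sub>R Y) - f z) / h n = f' (z + \<theta> *\<^sub>R Y) Y" using h(1)[of n] by (simp add: field_simps)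
        then have "\<bar>q n z\<bar> \<le> B" using B by (auto simp: q_def indicator_def)
        then show ?thesis using True by simp
      next
        case False
        have "norm (z + h n *\<^sub>R Y) \<ge> norm z - norm (h n *\<^sub>R Y)" using norm_triangle_ineq2[of z "- (h n *\<^sub>R Y)"] by simp
        moreover have "norm (h n *\<^sub>R Y) \<le> norm Y" using h[of n] by (simp add: mult_left_le_one_le)
        ultimately have "norm (z + h n *\<^sub>R Y) > R" using False by linarith
        moreover have "norm z > R" using False norm_ge_zero[of Y] by linarith
        ultimately show ?thesis using z B by (simp add: q_def)
      qed
    qed
  qed (auto simp: q_def)
  then have "(\<integral>z. indicator I z * f' z Y \<partial>lborel) = 0"
    unfolding q0 by (simp add: LIMSEQ_const_iff)
  then show ?thesis by (simp add: I_def)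
qed

lemma integral_lborel_Pair:
  fixes f :: "'a::euclidean_space \<times> 'b::euclidean_space \<Rightarrow> real"
  assumes "integrable lborel f"
  shows "(\<integral>x. \<integral>t. f (x, t) \<partial>lborel \<partial>lborel) = integral\<^sup>L lborel f"
  using lborel_pair.integral_fst'[of f] assms by (simp add: lborel_prod)

lemma nn_integral_lborel_Pair:
  fixes f :: "'a::euclidean_space \<times> 'b::euclidean_space \<Rightarrow> ennreal"
  assumes "f \<in> borel_measurable borel"
  shows "(\<integral>\<^sup>+t. \<integral>\<^sup>+x. f (x, t) \<partial>lborel \<partial>lborel) = integral\<^sup>N lborel f"
  using lborel_pair.nn_integral_snd[of f] assms by (simp add: lborel_prod)

lemma C1_fun_integral_deriv_time:
  fixes f :: "'a::euclidean_space \<times> real \<Rightarrow> real"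
  assumes f: "C1_fun f f'" and z: "\<And>z. norm z > R \<Longrightarrow> f z = 0"
  shows "(\<integral>z. indicator {z. snd z \<le> t} z * f' z (0, 1) \<partial>lborel) = (\<integral>x. f (x, t) \<partial>lborel)"
proof -
  have "closed {z :: 'a \<times> real. snd z \<le> t}" by (intro closed_Collect_le continuous_intros)
  then have [measurable]: "{z :: 'a \<times> real. snd z \<le> t} \<in> sets borel" by simp
  have "integrable lborel (\<lambda>z. f' z (0, 1))"
    by (rule integrable_continuous_compact_support[where R = R])
       (rule C1_fun_continuous_deriv[OF f], rule C1_fun_deriv_outside[OF f z])
  then have i: "integrable lborel (\<lambda>z. indicator {z. snd z \<le> t} z * f' z (0, 1))"
    using integrable_mult_indicator[of "{z :: 'a \<times> real. snd z \<le> t}" lborel "\<lambda>z. f' z (0, 1)"] by simp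
  \<comment> \<open>A time before \<open>t\<close> from which backwards the function vanishes, so
    the lower boundary term of the fundamental theorem is zero.\<close>
  define a where "a = - \<bar>R\<bar> - \<bar>t\<bar> - 1"
  have at: "a \<le> t" by (simp add: a_def)
  have inner: "(\<integral>s. indicator {z. snd z \<le> t} (x, s) * f' (x, s) (0, 1) \<partial>lborel) = f (x, t)" for x
  proof -
    have out: "norm (x, s) > R" if "s \<le> a" for s
    proof -
      have "\<bar>s\<bar> \<le> norm (x, s)" using norm_snd_le[of s x] by simp
      then show ?thesis using that by (auto simp: a_def)
    qed
    have "(\<integral>s. indicator {z. snd z \<le> t} (x, s) * f' (x, s) (0, 1) \<partial>lborel) = (\<integral>s. f' (x, s) (0, 1) * indicator {a..t} s \<partial>lborel)"
    proof (rule Bochner_Integration.integral_cong)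
      fix s
      show "indicator {z. snd z \<le> t} (x, s) * f' (x, s) (0, 1) = f' (x, s) (0, 1) * indicator {a..t} s"
        using C1_fun_deriv_outside[OF f z out, of s "(0, 1)"] by (auto simp: indicator_def)
    qed simp
    also have "\<dots> = f (x, t) - f (x, a)"
    proof (rule integral_FTC_Icc_real[OF at])
      fix s
      have "((\<lambda>s. f ((x, 0) + s *\<^sub>R (0, 1))) has_real_derivative f' ((x, 0) + s *\<^sub>R (0, 1)) (0, 1)) (at s)"
        by (rule C1_fun_line_deriv[OF f])
      then show "((\<lambda>s. f (x, s)) has_real_derivative f' (x, s) (0, 1)) (at s)" by simp
      have "continuous_on UNIV (\<lambda>s. f' ((x, 0) + s *\<^sub>R (0, 1)) (0, 1))" by (rule C1_fun_line_deriv_continuous[OF f])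
      then show "isCont (\<lambda>s. f' (x, s) (0, 1)) s" by (simp add: continuous_on_eq_continuous_at)
    qed
    also have "f (x, a) = 0" using z[OF out[of a]] by simp
    finally show ?thesis by simp
  qed
  show ?thesis using integral_lborel_Pair[OF i] by (simp add: inner)
qed

subsection \<open>The energy inequality for smooth functions\<close>

lemma C1_fun_mult:
  fixes f g :: "'a::euclidean_space \<Rightarrow> real"
  assumes f: "C1_fun f f'" and g: "C1_fun g g'"
  shows "C1_fun (\<lambda>z. f z * g z) (\<lambda>z h. f z * g' z h + f' z h * g z)"
  unfolding C1_fun_def
  by (auto intro!: has_derivative_mult C1_fun_deriv[OF f] C1_fun_deriv[OF g] continuous_intros
      C1_fun_continuous[OF f] C1_fun_continuous[OF g] C1_fun_continuous_deriv[OF f] C1_fun_continuous_deriv[OF g])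

lemma C1_fun_inner_left:
  assumes f: "C1_fun f f'"
  shows "C1_fun (\<lambda>z. f z \<bullet> b) (\<lambda>z h. f' z h \<bullet> b)"
  unfolding C1_fun_def
  by (auto intro!: has_derivative_inner_left C1_fun_deriv[OF f] continuous_intros C1_fun_continuous_deriv[OF f])

lemma C1_fun_compose_real:
  assumes f: "C1_fun f f'" and r: "\<And>s. (r has_real_derivative r' s) (at s)" and c: "continuous_on UNIV r'"
  shows "C1_fun (\<lambda>z. r (f z - k)) (\<lambda>z h. r' (f z - k) * f' z h)"
  unfolding C1_fun_def
proof (intro conjI allI)
  fix z
  have 1: "((\<lambda>z. f z - k) has_derivative f' z) (at z)"
    using C1_fun_deriv[OF f, of z] by (auto intro!: derivative_eq_intros)
  have 2: "(r has_derivative (\<lambda>x. r' (f z - k) * x)) (at (f z - k))"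
    using r[of "f z - k"] by (simp add: has_field_derivative_def)
  show "((\<lambda>z. r (f z - k)) has_derivative (\<lambda>h. r' (f z - k) * f' z h)) (at z)"
    using diff_chain_at[OF 1 2] by (simp add: o_def)
next
  fix h
  show "continuous_on UNIV (\<lambda>z. r' (f z - k) * f' z h)"
    by (intro continuous_intros C1_fun_continuous_deriv[OF f] continuous_on_compose2[OF c] C1_fun_continuous[OF f]) auto
qed

lemma linear_Pair_expand:
  fixes l :: "'a::euclidean_space \<times> real \<Rightarrow> real"
  assumes "linear l" shows "l (v, 0) = (\<Sum>b\<in>Basis. (v \<bullet> b) * l (b, 0))"
proof -
  have "(v, 0::real) = (\<Sum>b\<in>Basis. (v \<bullet> b) *\<^sub>R (b, 0))"
    by (subst (1) euclidean_representation[symmetric], simp add: prod_eq_iff fst_sum snd_sum)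
  then have "l (v, 0) = l (\<Sum>b\<in>Basis. (v \<bullet> b) *\<^sub>R (b, 0))" by simp
  also have "\<dots> = (\<Sum>b\<in>Basis. l ((v \<bullet> b) *\<^sub>R (b, 0)))" by (rule linear_sum[OF assms])
  also have "\<dots> = (\<Sum>b\<in>Basis. (v \<bullet> b) * l (b, 0))" by (intro sum.cong refl) (simp only: linear_scale[OF assms] real_scaleR_def)
  finally show ?thesis .
qed

text \<open>The pointwise inequality is multiplied by \<open>trunc1 (u - k) * \<zeta>\<close>. Its
  time part is a derivative of \<open>F\<close> and its divergence part a sum of derivatives of
  \<open>P b\<close>, up to the terms in \<open>q\<close>. Integrating over
  \<open>snd z \<le> t\<close> leaves the slice of \<open>F\<close> at time
  \<open>t\<close>.\<close>

lemma smooth_energy_inequality: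
  fixes u \<zeta> :: "'a::euclidean_space \<times> real \<Rightarrow> real" and V w :: "'a \<times> real \<Rightarrow> 'a"
  assumes u: "C1_fun u u'" and V: "C1_fun V V'" and \<zeta>: "C1_fun \<zeta> \<zeta>'"
    and \<zeta>_nonneg: "\<And>z. \<zeta> z \<ge> 0" and supp: "\<And>z. norm z > R \<Longrightarrow> \<zeta> z = 0"
    and w: "continuous_on UNIV w"
    and eq: "\<And>z. \<zeta> z \<noteq> 0 \<Longrightarrow> u' z (0, 1) \<le> (\<Sum>b\<in>Basis. V' z (b, 0) \<bullet> b)"
    and grad: "\<And>z b. \<zeta> z \<noteq> 0 \<Longrightarrow> b \<in> Basis \<Longrightarrow> u' z (b, 0) = w z \<bullet> b"
  shows "(\<integral>x. trunc0 (u (x, t) - k) * \<zeta> (x, t) \<partial>lborel) \<le>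
    (\<integral>z. indicator {z. snd z \<le> t} z * (trunc0 (u z - k) * \<zeta>' z (0, 1) - trunc2 (u z - k) * \<zeta> z * (V z \<bullet> w z)
        - trunc1 (u z - k) * \<zeta>' z (V z, 0)) \<partial>lborel)"
proof -
  have "closed {z :: 'a \<times> real. snd z \<le> t}" by (intro closed_Collect_le continuous_intros)
  then have [measurable]: "{z :: 'a \<times> real. snd z \<le> t} \<in> sets borel" by simp
  define I where "I z = indicat_real {z :: 'a \<times> real. snd z \<le> t} z" for z
  have iI: "integrable lborel (\<lambda>z. I z * F z)" if "integrable lborel F" for F :: "'a \<times> real \<Rightarrow> real"
    using integrable_mult_indicator[OF _ that, of "{z :: 'a \<times> real. snd z \<le> t}"] by (simp add: I_def)
  define q where "q z = trunc0 (u z - k) * \<zeta>' z (0, 1) - trunc2 (u z - k) * \<zeta> z * (V z \<bullet> w z)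
     - trunc1 (u z - k) * (\<Sum>b\<in>Basis. (V z \<bullet> b) * \<zeta>' z (b, 0))" for z
  have q_eq: "trunc0 (u z - k) * \<zeta>' z (0, 1) - trunc2 (u z - k) * \<zeta> z * (V z \<bullet> w z) - trunc1 (u z - k) * \<zeta>' z (V z, 0) = q z" for z
    using linear_Pair_expand[OF has_derivative_linear[OF C1_fun_deriv[OF \<zeta>, of z]], of "V z"] by (simp add: q_def)
  define F where "F z = trunc0 (u z - k) * \<zeta> z" for z
  define F' where "F' z h = trunc0 (u z - k) * \<zeta>' z h + trunc1 (u z - k) * u' z h * \<zeta> z" for z h
  define P where "P b z = trunc1 (u z - k) * \<zeta> z * (V z \<bullet> b)" for b z
  define P' where "P' b z h = trunc1 (u z - k) * \<zeta> z * (V' z h \<bullet> b)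
      + (trunc1 (u z - k) * \<zeta>' z h + trunc2 (u z - k) * u' z h * \<zeta> z) * (V z \<bullet> b)" for b z h
  have F: "C1_fun F F'"
    unfolding F_def[abs_def] F'_def[abs_def]
    by (rule C1_fun_mult[OF C1_fun_compose_real[OF u DERIV_trunc0 trunc1_continuous] \<zeta>])
  have P: "C1_fun (P b) (P' b)" for b
    unfolding P_def[abs_def] P'_def[abs_def]
    by (rule C1_fun_mult[OF C1_fun_mult[OF C1_fun_compose_real[OF u DERIV_trunc1 trunc2_continuous] \<zeta>] C1_fun_inner_left[OF V]])
  have sF: "F z = 0" and sP: "P b z = 0" if "norm z > R" for b z using supp[OF that] by (auto simp: F_def P_def)
  \<comment> \<open>The inequality and the gradient identity are available only where \<zeta> is
    nonzero. Zeros of the nonnegative \<zeta> are minima, so the remaining terms vanish there as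
    well.\<close>
  have z': "\<zeta>' z h = 0" if "\<zeta> z = 0" for z h
    by (rule has_derivative_zero_min[OF C1_fun_deriv[OF \<zeta>] \<zeta>_nonneg that])
  have iF: "integrable lborel (\<lambda>z. F' z (0, 1))"
    by (rule integrable_continuous_compact_support[where R = R])
       (rule C1_fun_continuous_deriv[OF F], rule C1_fun_deriv_outside[OF F sF])
  have iP: "integrable lborel (\<lambda>z. P' b z h)" for b h
    by (rule integrable_continuous_compact_support[where R = R])
       (rule C1_fun_continuous_deriv[OF P], rule C1_fun_deriv_outside[OF P sP])
  have iq: "integrable lborel q"
  proof (rule integrable_continuous_compact_support[where R = R])
    show "continuous_on UNIV q" unfolding q_def[abs_def]
      by (intro continuous_intros C1_fun_continuous[OF u] C1_fun_continuous[OF V] C1_fun_continuous[OF \<zeta>] C1_fun_continuous_deriv[OF \<zeta>] w)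
    show "q z = 0" if "norm z > R" for z using supp[OF that] z'[OF supp[OF that]] by (simp add: q_def)
  qed
  have pw: "F' z (0, 1) \<le> q z + (\<Sum>b\<in>Basis. P' b z (b, 0))" for z
  proof (cases "\<zeta> z = 0")
    case True
    then show ?thesis using z'[OF True] by (simp add: F'_def q_def P'_def)
  next
    case False
    have "trunc1 (u z - k) * \<zeta> z * u' z (0, 1) \<le> trunc1 (u z - k) * \<zeta> z * (\<Sum>b\<in>Basis. V' z (b, 0) \<bullet> b)"
      using eq[OF False] trunc1_nonneg \<zeta>_nonneg by (intro mult_left_mono mult_nonneg_nonneg) auto
    moreover have "trunc2 (u z - k) * \<zeta> z * (V z \<bullet> w z) = (\<Sum>b\<in>Basis. trunc2 (u z - k) * u' z (b, 0) * \<zeta> z * (V z \<bullet> b))"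
    proof -
      have "V z \<bullet> w z = (\<Sum>b\<in>Basis. u' z (b, 0) * (V z \<bullet> b))"
        using grad[OF False] by (subst euclidean_inner) (simp add: mult.commute)
      then show ?thesis by (simp add: sum_distrib_left mult_ac)
    qed
    ultimately show ?thesis
      by (simp add: F'_def q_def P'_def sum.distrib sum_distrib_left algebra_simps)
  qed
  have "(\<integral>x. F (x, t) \<partial>lborel) = (\<integral>z. I z * F' z (0, 1) \<partial>lborel)"
    unfolding I_def by (rule C1_fun_integral_deriv_time[OF F sF, symmetric])
  also have "\<dots> \<le> (\<integral>z. I z * q z + (\<Sum>b\<in>Basis. I z * P' b z (b, 0)) \<partial>lborel)"
  proof (rule integral_mono)
    fix z
    have "I z * F' z (0, 1) \<le> I z * (q z + (\<Sum>b\<in>Basis. P' b z (b, 0)))"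
      by (rule mult_left_mono[OF pw]) (simp add: I_def)
    then show "I z * F' z (0, 1) \<le> I z * q z + (\<Sum>b\<in>Basis. I z * P' b z (b, 0))"
      by (simp add: distrib_left sum_distrib_left)
  qed (intro iI iF iq iP Bochner_Integration.integrable_add Bochner_Integration.integrable_sum)+
  also have "\<dots> = (\<integral>z. I z * q z \<partial>lborel) + (\<Sum>b\<in>Basis. (\<integral>z. I z * P' b z (b, 0) \<partial>lborel))"
    by (subst Bochner_Integration.integral_add) (auto intro!: iI iq iP Bochner_Integration.integral_sum)
  also have "(\<Sum>b\<in>Basis. (\<integral>z. I z * P' b z (b, 0) \<partial>lborel)) = 0"
    unfolding I_def by (intro sum.neutral ballI C1_fun_integral_deriv_space[OF P sP]) auto
  finally show ?thesis by (simp add: F_def I_def q_eq)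
qed

text \<open>The increment of \<open>f\<close> along the segment is at most \<open>h\<close> times
  the average of \<open>D\<close> over it. Jensen on the unit interval, Tonelli and translation
  invariance then remove the segment parameter.\<close>

lemma (in orlicz) translation_modular_bound:
  fixes f D :: "'a::euclidean_space \<Rightarrow> real"
  assumes f: "C1_fun f f'" and D: "continuous_on UNIV D" "\<And>z. D z \<ge> 0"
    and h: "h > 0" and bd: "\<And>z. \<bar>f' z Y\<bar> \<le> h * D z"
  shows "(\<integral>\<^sup>+z. G (\<bar>f (z + Y) - f z\<bar> / h) \<partial>lborel) \<le> (\<integral>\<^sup>+z. G (D z) \<partial>lborel)"
proof -
  have [measurable]: "D \<in> borel_measurable borel" "f \<in> borel_measurable borel"
    using D C1_fun_continuous[OF f] by (auto intro: borel_measurable_continuous_onI)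
  define k where "k = indicat_real {0..1::real}"
  have [measurable]: "k \<in> borel_measurable borel" by (simp add: k_def)
  have Dl: "continuous_on S (\<lambda>s. D (z + s *\<^sub>R Y))" for S z
    by (rule continuous_on_compose2[OF D(1)]) (auto intro!: continuous_intros)
  have kc: "integrable lborel (\<lambda>s. k s * F s)" if "continuous_on {0..1} F" for F :: "real \<Rightarrow> real"
    using borel_integrable_compact[OF compact_Icc that] by (simp add: k_def)
  have pw: "ennreal (G (\<bar>f (z + Y) - f z\<bar> / h)) \<le> (\<integral>\<^sup>+s. ennreal (k s) * ennreal (G (D (z + s *\<^sub>R Y))) \<partial>lborel)" for z
  proof -
    let ?d = "\<lambda>s. f' (z + s *\<^sub>R Y) Y"
    have i1: "integrable lborel (\<lambda>s. k s * ?d s)"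
      by (rule kc, rule C1_fun_line_deriv_continuous[OF f])
    have i2: "integrable lborel (\<lambda>s. k s * D (z + s *\<^sub>R Y))" by (rule kc, rule Dl)
    have i3: "integrable lborel (\<lambda>s. k s * G (D (z + s *\<^sub>R Y)))"
      by (rule kc) (intro continuous_on_compose2[OF G_continuous Dl], auto)
    have "(\<integral>s. ?d s * indicator {0..1} s \<partial>lborel) = f (z + 1 *\<^sub>R Y) - f (z + 0 *\<^sub>R Y)"
    proof (rule integral_FTC_Icc_real[where F = "\<lambda>s. f (z + s *\<^sub>R Y)"])
      fix s show "((\<lambda>s. f (z + s *\<^sub>R Y)) has_real_derivative ?d s) (at s)" by (rule C1_fun_line_deriv[OF f])
      have "continuous_on UNIV ?d" by (rule C1_fun_line_deriv_continuous[OF f])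
      then show "isCont ?d s" by (simp add: continuous_on_eq_continuous_at)
    qed simp
    then have ftc: "f (z + Y) - f z = (\<integral>s. k s * ?d s \<partial>lborel)" by (simp add: k_def mult.commute)
    have "\<bar>f (z + Y) - f z\<bar> \<le> (\<integral>s. \<bar>k s * ?d s\<bar> \<partial>lborel)"
      unfolding ftc by (rule integral_abs_bound)
    also have "\<dots> \<le> (\<integral>s. h * (k s * D (z + s *\<^sub>R Y)) \<partial>lborel)"
    proof (rule integral_mono)
      fix s
      have "k s * \<bar>?d s\<bar> \<le> k s * (h * D (z + s *\<^sub>R Y))" by (rule mult_left_mono[OF bd]) (simp add: k_def)
      then show "\<bar>k s * ?d s\<bar> \<le> h * (k s * D (z + s *\<^sub>R Y))" by (simp add: k_def abs_mult mult_ac)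
    qed (use i1 i2 in auto)
    also have "\<dots> = h * (\<integral>s. k s * D (z + s *\<^sub>R Y) \<partial>lborel)" by simp
    finally have "\<bar>f (z + Y) - f z\<bar> / h \<le> (\<integral>s. k s * D (z + s *\<^sub>R Y) \<partial>lborel)"
      using h by (simp add: field_simps)
    then have "G (\<bar>f (z + Y) - f z\<bar> / h) \<le> (\<integral>s. k s * G (D (z + s *\<^sub>R Y)) \<partial>lborel)"
      using h i2 i3 D(2)
      by (intro G_jensen) (auto simp: k_def integrable_indicator_iff)
    then have "ennreal (G (\<bar>f (z + Y) - f z\<bar> / h)) \<le> ennreal (\<integral>s. k s * G (D (z + s *\<^sub>R Y)) \<partial>lborel)"
      by (rule ennreal_leI)
    also have "\<dots> = (\<integral>\<^sup>+s. ennreal (k s * G (D (z + s *\<^sub>R Y))) \<partial>lborel)"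
      by (rule nn_integral_eq_integral[symmetric, OF i3]) (auto simp: k_def G_nonneg)
    finally show ?thesis by (simp add: ennreal_mult'' G_nonneg)
  qed
  have "(\<integral>\<^sup>+z. G (\<bar>f (z + Y) - f z\<bar> / h) \<partial>lborel) \<le> (\<integral>\<^sup>+z. \<integral>\<^sup>+s. ennreal (k s) * ennreal (G (D (z + s *\<^sub>R Y))) \<partial>lborel \<partial>lborel)"
    by (rule nn_integral_mono[OF pw])
  also have "\<dots> = (\<integral>\<^sup>+s. \<integral>\<^sup>+z. ennreal (k s) * ennreal (G (D (z + s *\<^sub>R Y))) \<partial>lborel \<partial>lborel)"
    by (rule lborel_pair.Fubini'[symmetric]) measurable
  also have "\<dots> = (\<integral>\<^sup>+s. ennreal (k s) * (\<integral>\<^sup>+z. ennreal (G (D (z + s *\<^sub>R Y))) \<partial>lborel) \<partial>lborel)"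
    by (intro nn_integral_cong nn_integral_cmult) measurable
  also have "\<dots> = (\<integral>\<^sup>+s. ennreal (k s) * (\<integral>\<^sup>+z. ennreal (G (D z)) \<partial>lborel) \<partial>lborel)"
    by (subst nn_integral_lborel_translation) auto
  also have "\<dots> = (\<integral>\<^sup>+s. ennreal (k s) \<partial>lborel) * (\<integral>\<^sup>+z. ennreal (G (D z)) \<partial>lborel)"
    by (rule nn_integral_multc) measurable
  also have "(\<integral>\<^sup>+s. ennreal (k s) \<partial>lborel) = 1"
    by (simp add: k_def ennreal_indicator)
  finally show ?thesis by simp
qed

subsection \<open>Mollified subsolutions\<close>

text \<open>The majorants vary with \<open>n\<close> but converge in L1. Clipping \<open>q n\<close>
  to the interval between \<open>- D0\<close> and \<open>D0\<close> makes ordinary dominated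
  convergence applicable, and the clipping error is at most the distance of \<open>D n\<close> to
  \<open>D0\<close>.\<close>

lemma dominated_convergence_varying:
  fixes q D :: "nat \<Rightarrow> 'a \<Rightarrow> real" and q0 D0 :: "'a \<Rightarrow> real"
  assumes [measurable]: "\<And>n. q n \<in> borel_measurable M" "q0 \<in> borel_measurable M"
    and D: "\<exists>N. \<forall>n\<ge>N. integrable M (\<lambda>x. D n x - D0 x)" and D0: "integrable M D0" "\<And>x. D0 x \<ge> 0"
    and bd: "\<And>n x. \<bar>q n x\<bar> \<le> D n x"
    and q: "AE x in M. (\<lambda>n. q n x) \<longlonglongrightarrow> q0 x" and DL: "AE x in M. (\<lambda>n. D n x) \<longlonglongrightarrow> D0 x"
    and conv: "(\<lambda>n. \<integral>x. norm (D n x - D0 x) \<partial>M) \<longlonglongrightarrow> 0"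
  shows "integrable M q0" "(\<lambda>n. \<integral>x. q n x \<partial>M) \<longlonglongrightarrow> (\<integral>x. q0 x \<partial>M)"
    "\<exists>N. \<forall>n\<ge>N. integrable M (q n)"
proof -
  have [measurable]: "D0 \<in> borel_measurable M" using D0 by auto
  define r where "r n x = max (- D0 x) (min (D0 x) (q n x))" for n x
  have rm [measurable]: "r n \<in> borel_measurable M" for n unfolding r_def by measurable
  have q0: "AE x in M. \<bar>q0 x\<bar> \<le> D0 x"
    using q DL
  proof eventually_elim
    case (elim x)
    show ?case by (rule LIMSEQ_le[OF tendsto_rabs[OF elim(1)] elim(2)]) (use bd in auto)
  qed
  show iq0: "integrable M q0"
    by (rule Bochner_Integration.integrable_bound[OF D0(1)]) (use q0 in \<open>auto simp: D0(2)\<close>)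
  have ir: "integrable M (r n)" for n
    by (rule Bochner_Integration.integrable_bound[OF D0(1)]) (auto simp: r_def abs_le_iff D0(2) intro: order_trans[OF _ D0(2)])
  obtain N where N: "\<And>n. n \<ge> N \<Longrightarrow> integrable M (\<lambda>x. D n x - D0 x)" using D by blast
  have iD: "integrable M (D n)" if "n \<ge> N" for n
    using Bochner_Integration.integrable_add[OF N[OF that] D0(1)] by simp
  have iq: "integrable M (q n)" if "n \<ge> N" for n
    by (rule Bochner_Integration.integrable_bound[OF iD[OF that]]) (use bd in \<open>auto intro: order_trans[OF bd abs_ge_self]\<close>)
  then show "\<exists>N. \<forall>n\<ge>N. integrable M (q n)" by blast
  have R: "(\<lambda>n. \<integral>x. r n x \<partial>M) \<longlonglongrightarrow> (\<integral>x. q0 x \<partial>M)"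
  proof (rule integral_dominated_convergence[where w = D0])
    show "AE x in M. (\<lambda>n. r n x) \<longlonglongrightarrow> q0 x"
      using q q0
    proof eventually_elim
      case (elim x)
      have "(\<lambda>n. r n x) \<longlonglongrightarrow> max (- D0 x) (min (D0 x) (q0 x))"
        unfolding r_def by (intro tendsto_intros elim)
      moreover have "max (- D0 x) (min (D0 x) (q0 x)) = q0 x" using elim by auto
      ultimately show ?case by simp
    qed
    show "AE x in M. norm (r n x) \<le> D0 x" for n
      using D0(2) by (intro AE_I2) (auto simp: r_def abs_le_iff intro: order_trans[OF _ D0(2)])
  qed (use D0 in auto)
  have "(\<lambda>n. (\<integral>x. q n x \<partial>M) - (\<integral>x. r n x \<partial>M)) \<longlonglongrightarrow> 0"
  proof (rule Lim_null_comparison[OF _ conv])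
    show "\<forall>\<^sub>F n in sequentially. norm ((\<integral>x. q n x \<partial>M) - (\<integral>x. r n x \<partial>M)) \<le> (\<integral>x. norm (D n x - D0 x) \<partial>M)"
      using eventually_ge_at_top[of N]
    proof eventually_elim
      case (elim n)
      have "norm ((\<integral>x. q n x \<partial>M) - (\<integral>x. r n x \<partial>M)) = norm (\<integral>x. q n x - r n x \<partial>M)"
        using iq[OF elim] ir by simp
      also have "\<dots> \<le> (\<integral>x. norm (q n x - r n x) \<partial>M)" by (rule integral_norm_bound)
      also have "\<dots> \<le> (\<integral>x. norm (D n x - D0 x) \<partial>M)"
      proof (rule integral_mono)
        fix x show "norm (q n x - r n x) \<le> norm (D n x - D0 x)"
          using bd[of n x] D0(2)[of x] by (auto simp: r_def max_def min_def)
      qed (use iq[OF elim] ir N[OF elim] in auto)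
      finally show ?case .
    qed
  qed
  from tendsto_add[OF this R] show "(\<lambda>n. \<integral>x. q n x \<partial>M) \<longlonglongrightarrow> (\<integral>x. q0 x \<partial>M)" by simp
qed

section \<open>Pointwise inequalities for mollified functions\<close>

definition moll_kernel :: "real \<Rightarrow> 'a::euclidean_space \<Rightarrow> 'a \<Rightarrow> real" where
  "moll_kernel \<epsilon> c z = bump (\<epsilon>\<^sup>2) c z / bump_mass TYPE('a) \<epsilon>"

lemma mollify_kernel: "mollify \<epsilon> f c = (\<integral>z. moll_kernel \<epsilon> c z *\<^sub>R f z \<partial>lborel)"
  by (simp add: mollify_def moll_kernel_def)

lemma moll_kernel:
  assumes "\<epsilon> > 0"
  shows moll_kernel_integrable: "integrable lborel (moll_kernel \<epsilon> (c::'a::euclidean_space))"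
    and moll_kernel_nonneg: "moll_kernel \<epsilon> c z \<ge> 0"
    and moll_kernel_integral: "integral\<^sup>L lborel (moll_kernel \<epsilon> c) = 1"
  using bump_mass_pos[OF assms, where ?'a = 'a] bump_integrable[of "\<epsilon>\<^sup>2" c]
  by (auto simp: bump_nonneg bump_integral moll_kernel_def[abs_def])

lemma moll_kernel_scaleR:
  fixes f :: "'a::euclidean_space \<Rightarrow> 'b::euclidean_space"
  assumes "integrable lborel f"
  shows "integrable lborel (\<lambda>z. moll_kernel \<epsilon> c z *\<^sub>R f z)"
  using mollify_integrand[OF assms] by (simp add: moll_kernel_def)

lemma moll_kernel_mult:
  fixes f :: "'a::euclidean_space \<Rightarrow> real"
  assumes "integrable lborel f"
  shows "integrable lborel (\<lambda>z. moll_kernel \<epsilon> c z * f z)"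
  using moll_kernel_scaleR[OF assms] by simp

lemma norm_mollify_le:
  fixes f :: "'a::euclidean_space \<Rightarrow> 'b::euclidean_space"
  assumes "\<epsilon> > 0"
  shows "norm (mollify \<epsilon> f c) \<le> (\<integral>z. moll_kernel \<epsilon> c z * norm (f z) \<partial>lborel)"
proof -
  have "norm (mollify \<epsilon> f c) \<le> (\<integral>z. norm (moll_kernel \<epsilon> c z *\<^sub>R f z) \<partial>lborel)"
    unfolding mollify_kernel by (rule integral_norm_bound)
  then show ?thesis using moll_kernel_nonneg[OF assms, of c] by simp
qed

text \<open>The kernel is a probability density, and the difference of the two sides is the variance
  of \<open>f\<close> under it.\<close>

lemma mollify_square_le:
  fixes f :: "'a::euclidean_space \<Rightarrow> real"
  assumes f: "integrable lborel f" "integrable lborel (\<lambda>z. (f z)\<^sup>2)" and \<epsilon>: "\<epsilon> > 0"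
  shows "(mollify \<epsilon> f c)\<^sup>2 \<le> mollify \<epsilon> (\<lambda>z. (f z)\<^sup>2) c"
proof -
  define k where "k = moll_kernel \<epsilon> c"
  note k = moll_kernel[OF \<epsilon>, of c, folded k_def]
  define a where "a = mollify \<epsilon> f c"
  have a: "(\<integral>z. k z * f z \<partial>lborel) = a" by (simp add: a_def mollify_kernel k_def)
  note i = moll_kernel_mult[OF f(1), of \<epsilon> c, folded k_def] moll_kernel_mult[OF f(2), of \<epsilon> c, folded k_def]
  have "0 \<le> (\<integral>z. k z * (f z - a)\<^sup>2 \<partial>lborel)" using k by simp
  also have "\<dots> = (\<integral>z. k z * (f z)\<^sup>2 - 2 * a * (k z * f z) + a\<^sup>2 * k z \<partial>lborel)"
    by (intro Bochner_Integration.integral_cong) (auto simp: power2_eq_square algebra_simps)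
  also have "\<dots> = (\<integral>z. k z * (f z)\<^sup>2 \<partial>lborel) - a\<^sup>2" using k i a by (simp add: power2_eq_square)
  finally show ?thesis by (simp add: a_def mollify_kernel k_def)
qed

lemma mollify_mono:
  fixes f g :: "'a::euclidean_space \<Rightarrow> real"
  assumes "integrable lborel f" "integrable lborel g" "\<epsilon> > 0" "\<And>z. f z \<le> g z"
  shows "mollify \<epsilon> f c \<le> mollify \<epsilon> g c"
  unfolding mollify_kernel
  by (rule integral_mono[OF moll_kernel_scaleR[OF assms(1)] moll_kernel_scaleR[OF assms(2)]])
     (use assms moll_kernel_nonneg[OF assms(3), of c] in \<open>auto intro!: mult_left_mono\<close>)

lemma mollify_C1:
  fixes f :: "'a::euclidean_space \<Rightarrow> 'b::euclidean_space"
  assumes "integrable lborel f" "\<epsilon> > 0"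
  shows "C1_fun (mollify \<epsilon> f) (\<lambda>c h. \<integral>z. (- dbump (\<epsilon>\<^sup>2) c z h / bump_mass TYPE('a) \<epsilon>) *\<^sub>R f z \<partial>lborel)"
  unfolding C1_fun_def using mollify_has_derivative[OF assms] mollify_derivative_continuous[OF assms] by blast

lemma (in orlicz) G_mollify_le:
  fixes f :: "'a::euclidean_space \<Rightarrow> 'b::euclidean_space"
  assumes f: "integrable lborel f" "integrable lborel (\<lambda>z. G (norm (f z)))" and \<epsilon>: "\<epsilon> > 0"
  shows "G (norm (mollify \<epsilon> f c)) \<le> mollify \<epsilon> (\<lambda>z. G (norm (f z))) c"
proof -
  have "G (norm (mollify \<epsilon> f c)) \<le> (\<integral>z. moll_kernel \<epsilon> c z * G (norm (f z)) \<partial>lborel)"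
    by (rule G_jensen[where f = "\<lambda>z. norm (f z)"])
       (use moll_kernel[OF \<epsilon>, of c] norm_mollify_le[OF \<epsilon>, of f c] moll_kernel_mult[of "\<lambda>z. norm (f z)"] moll_kernel_mult[OF f(2)] f in auto)
  then show ?thesis by (simp add: mollify_kernel)
qed

text \<open>The data live on the whole space-time, so that integrals and convolutions need no
  domain; the instance used later is cut to zero outside a cylinder. The equation and the weak
  gradient are retained only as identities against kernels supported in
  \<open>ball z0 R0\<close>.\<close>

locale local_subsolution = orlicz g g' p q for g g' p q +
  fixes A :: "'a::euclidean_space \<Rightarrow> 'a" and \<nu> \<Lambda> :: real
    and U :: "'a \<times> real \<Rightarrow> real" and v :: "'a \<times> real \<Rightarrow> 'a" and z0 :: "'a \<times> real" and R0 :: real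
  assumes \<nu>: "0 < \<nu>" and \<Lambda>: "0 < \<Lambda>"
    and A_coercive: "\<And>\<xi>. \<nu> * G (norm \<xi>) \<le> A \<xi> \<bullet> \<xi>"
    and A_bound: "\<And>\<xi>. norm (A \<xi>) \<le> \<Lambda> * g (norm \<xi>)"
    and U_int: "integrable lborel U" and v_int: "integrable lborel v"
    and V_int: "integrable lborel (\<lambda>z. A (v z))"
    and U2_int: "integrable lborel (\<lambda>z. (U z)\<^sup>2)"
    and GU_int: "integrable lborel (\<lambda>z. G \<bar>U z\<bar>)"
    and Gv_int: "integrable lborel (\<lambda>z. G (norm (v z)))"
    and weak_sub: "\<And>c \<epsilon>. \<epsilon> > 0 \<Longrightarrow> cball c \<epsilon> \<subseteq> ball z0 R0 \<Longrightarrow>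
        - (\<integral>z. dbump (\<epsilon>\<^sup>2) c z (0, 1) * U z \<partial>lborel) +
        (\<Sum>b\<in>Basis. \<integral>z. dbump (\<epsilon>\<^sup>2) c z (b, 0) * (A (v z) \<bullet> b) \<partial>lborel) \<le> 0"
    and weak_grad: "\<And>c \<epsilon> b. \<epsilon> > 0 \<Longrightarrow> cball c \<epsilon> \<subseteq> ball z0 R0 \<Longrightarrow> b \<in> Basis \<Longrightarrow>
        (\<integral>z. dbump (\<epsilon>\<^sup>2) c z (b, 0) * U z \<partial>lborel) = - (\<integral>z. bump (\<epsilon>\<^sup>2) c z * (v z \<bullet> b) \<partial>lborel)"
begin

abbreviation "V \<equiv> \<lambda>z. A (v z)"

definition "H z = (U z)\<^sup>2 + G \<bar>U z\<bar> + G (norm (v z))"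

lemma H_int: "integrable lborel H" unfolding H_def[abs_def] using U2_int GU_int Gv_int by auto
lemma H_nonneg: "H z \<ge> 0" by (auto simp: H_def G_nonneg)

lemmas [measurable] = borel_measurable_integrable[OF U_int, simplified] borel_measurable_integrable[OF v_int, simplified]
  borel_measurable_integrable[OF V_int, simplified] borel_measurable_integrable[OF H_int, simplified]

definition "dmol \<epsilon> f c h = (\<integral>z. (- dbump (\<epsilon>\<^sup>2) c z h / bump_mass TYPE('a \<times> real) \<epsilon>) *\<^sub>R f z \<partial>lborel)"

lemma mollify_gradient:
  assumes \<epsilon>: "\<epsilon> > 0" and c: "cball c \<epsilon> \<subseteq> ball z0 R0" and b: "b \<in> Basis"
  shows "dmol \<epsilon> U c (b, 0) = mollify \<epsilon> v c \<bullet> b"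
proof -
  define m where "m = bump_mass TYPE('a \<times> real) \<epsilon>"
  have m: "m > 0" unfolding m_def by (rule bump_mass_pos[OF \<epsilon>])
  have "dmol \<epsilon> U c (b, 0) = (\<integral>z. (- 1 / m) * (dbump (\<epsilon>\<^sup>2) c z (b, 0) * U z) \<partial>lborel)"
    by (simp add: dmol_def m_def)
  also have "\<dots> = (1 / m) * (\<integral>z. bump (\<epsilon>\<^sup>2) c z * (v z \<bullet> b) \<partial>lborel)"
    using weak_grad[OF \<epsilon> c b] by (simp only: Bochner_Integration.integral_mult_right_zero)
  also have "\<dots> = (\<integral>z. ((bump (\<epsilon>\<^sup>2) c z / m) *\<^sub>R v z) \<bullet> b \<partial>lborel)"
    by (simp flip: integral_mult_right_zero)
  also have "\<dots> = mollify \<epsilon> v c \<bullet> b"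
    unfolding mollify_def m_def
    by (rule integral_inner_left) (use mollify_integrand[OF v_int, of \<epsilon> c] in simp)
  finally show ?thesis .
qed

text \<open>The kernel centred at \<open>c\<close> is an admissible test function as long as its
  ball stays inside \<open>ball z0 R0\<close>. Dividing by its mass, with the sign from
  differentiating in the centre, gives a pointwise inequality.\<close>

lemma mollify_subsolution:
  assumes \<epsilon>: "\<epsilon> > 0" and c: "cball c \<epsilon> \<subseteq> ball z0 R0"
  shows "dmol \<epsilon> U c (0, 1) \<le> (\<Sum>b\<in>Basis. dmol \<epsilon> V c (b, 0) \<bullet> b)"
proof -
  define m where "m = bump_mass TYPE('a \<times> real) \<epsilon>"
  have m: "m > 0" unfolding m_def by (rule bump_mass_pos[OF \<epsilon>])
  have 1: "dmol \<epsilon> U c (0, 1) = (1 / m) * - (\<integral>z. dbump (\<epsilon>\<^sup>2) c z (0, 1) * U z \<partial>lborel)"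
  proof -
    have "dmol \<epsilon> U c (0, 1) = (\<integral>z. (- 1 / m) * (dbump (\<epsilon>\<^sup>2) c z (0, 1) * U z) \<partial>lborel)"
      by (simp add: dmol_def m_def)
    then show ?thesis by simp
  qed
  have 2: "dmol \<epsilon> V c (b, 0) \<bullet> b = (1 / m) * - (\<integral>z. dbump (\<epsilon>\<^sup>2) c z (b, 0) * (A (v z) \<bullet> b) \<partial>lborel)" for b
  proof -
    have "integrable lborel (\<lambda>z. (- dbump (\<epsilon>\<^sup>2) c z (b, 0) / m) *\<^sub>R V z)"
    proof (rule integrable_bounded_scaleR[OF V_int, where B = "48 * \<epsilon> ^ 4 * \<bar>\<epsilon>\<bar> * norm (b, 0::real) / m"])
      fix z show "\<bar>- dbump (\<epsilon>\<^sup>2) c z (b, 0) / m\<bar> \<le> 48 * \<epsilon> ^ 4 * \<bar>\<epsilon>\<bar> * norm (b, 0::real) / m"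
        using dbump_bound[of \<epsilon> c z "(b, 0)"] m by (simp add: divide_right_mono)
    qed measurable
    then have "dmol \<epsilon> V c (b, 0) \<bullet> b = (\<integral>z. ((- dbump (\<epsilon>\<^sup>2) c z (b, 0) / m) *\<^sub>R V z) \<bullet> b \<partial>lborel)"
      unfolding dmol_def m_def by (intro integral_inner_left[symmetric]) simp
    also have "\<dots> = (\<integral>z. (- 1 / m) * (dbump (\<epsilon>\<^sup>2) c z (b, 0) * (A (v z) \<bullet> b)) \<partial>lborel)" by simp
    finally show ?thesis by simp
  qed
  have "(1 / m) * - (\<integral>z. dbump (\<epsilon>\<^sup>2) c z (0, 1) * U z \<partial>lborel) \<le> (1 / m) * (\<Sum>b\<in>Basis. - (\<integral>z. dbump (\<epsilon>\<^sup>2) c z (b, 0) * (A (v z) \<bullet> b) \<partial>lborel))"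
    using weak_sub[OF \<epsilon> c] m by (intro mult_left_mono) (auto simp: sum_negf)
  then show ?thesis unfolding 1 2 sum_distrib_left .
qed

lemma C1_mollify:
  fixes f :: "'a \<times> real \<Rightarrow> 'c::euclidean_space"
  assumes "integrable lborel f" "\<epsilon> > 0"
  shows "C1_fun (mollify \<epsilon> f) (dmol \<epsilon> f)"
  unfolding dmol_def[abs_def] by (rule mollify_C1[OF assms])

text \<open>The first three bounds are Jensen. For the flux, \<open>young\<close> is applied under
  the integral with parameter 1, so only the product of its mollified norm with another quantity is
  estimated.\<close>

lemma mollify_H:
  assumes \<epsilon>: "\<epsilon> > 0"
  shows "(mollify \<epsilon> U c)\<^sup>2 \<le> mollify \<epsilon> H c" "G \<bar>mollify \<epsilon> U c\<bar> \<le> mollify \<epsilon> H c"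
    "G (norm (mollify \<epsilon> v c)) \<le> mollify \<epsilon> H c"
    "b \<ge> 0 \<Longrightarrow> norm (mollify \<epsilon> V c) * b \<le> \<Lambda> * q * (mollify \<epsilon> H c + G b)"
proof -
  show "(mollify \<epsilon> U c)\<^sup>2 \<le> mollify \<epsilon> H c"
    by (rule order_trans[OF mollify_square_le[OF U_int U2_int \<epsilon>] mollify_mono[OF U2_int H_int \<epsilon>]]) (simp add: H_def G_nonneg)
  have "G (norm (mollify \<epsilon> U c)) \<le> mollify \<epsilon> (\<lambda>z. G (norm (U z))) c"
    by (rule G_mollify_le[OF U_int _ \<epsilon>]) (use GU_int in simp)
  also have "\<dots> \<le> mollify \<epsilon> H c"
    by (rule mollify_mono[OF _ H_int \<epsilon>]) (use GU_int in \<open>auto simp: H_def G_nonneg\<close>)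
  finally show "G \<bar>mollify \<epsilon> U c\<bar> \<le> mollify \<epsilon> H c" by simp
  show "G (norm (mollify \<epsilon> v c)) \<le> mollify \<epsilon> H c"
    by (rule order_trans[OF G_mollify_le[OF v_int Gv_int \<epsilon>] mollify_mono[OF Gv_int H_int \<epsilon>]]) (simp add: H_def G_nonneg)
  assume b: "b \<ge> 0"
  define k where "k = moll_kernel \<epsilon> c"
  note k = moll_kernel[OF \<epsilon>, of c, folded k_def]
  have i1: "integrable lborel (\<lambda>z. k z * norm (V z))" 
    using moll_kernel_mult[of "\<lambda>z. norm (V z)" \<epsilon> c] V_int by (simp add: k_def)
  have i2: "integrable lborel (\<lambda>z. k z * H z)"
    using moll_kernel_mult[OF H_int, of \<epsilon> c] by (simp add: k_def)
  have "norm (mollify \<epsilon> V c) * b \<le> (\<integral>z. k z * norm (V z) \<partial>lborel) * b"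
    using norm_mollify_le[OF \<epsilon>, of V c] b by (intro mult_right_mono) (simp_all add: k_def)
  also have "\<dots> = (\<integral>z. k z * norm (V z) * b \<partial>lborel)" by simp
  also have "\<dots> \<le> (\<integral>z. \<Lambda> * q * (k z * H z) + \<Lambda> * q * G b * k z \<partial>lborel)"
  proof (rule integral_mono)
    fix z
    have "norm (V z) * b \<le> \<Lambda> * g (norm (v z)) * b" using A_bound b by (intro mult_right_mono) auto
    also have "\<dots> = \<Lambda> * (g (norm (v z)) * b)" by simp
    also have "\<dots> \<le> \<Lambda> * (q * G (norm (v z)) + q * G b)"
      using young[of "norm (v z)" b 1] b \<Lambda> by (intro mult_left_mono) auto
    also have "\<dots> \<le> \<Lambda> * (q * H z + q * G b)"
      using \<Lambda> q_gt_1 by (intro mult_left_mono add_mono) (auto simp: H_def G_nonneg)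
    finally have "k z * (norm (V z) * b) \<le> k z * (\<Lambda> * (q * H z + q * G b))"
      by (rule mult_left_mono) (rule k)
    then show "k z * norm (V z) * b \<le> \<Lambda> * q * (k z * H z) + \<Lambda> * q * G b * k z" by (simp add: algebra_simps)
  qed (use i1 i2 k in auto)
  also have "\<dots> = \<Lambda> * q * mollify \<epsilon> H c + \<Lambda> * q * G b"
    using i2 k by (simp add: mollify_kernel flip: k_def)
  finally show "norm (mollify \<epsilon> V c) * b \<le> \<Lambda> * q * (mollify \<epsilon> H c + G b)" by (simp add: algebra_simps)
qed

text \<open>Mollifying the tuple \<open>(U, v, V, H)\<close> gives one subsequence for all four components.\<close>

lemma mollify_sequence:
  assumes \<delta>: "\<delta> > 0"
  shows "\<exists>\<epsilon>. (\<forall>n. 0 < \<epsilon> n \<and> \<epsilon> n < \<delta>) \<and>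
    (AE z in lborel. (\<lambda>n. mollify (\<epsilon> n) U z) \<longlonglongrightarrow> U z \<and> (\<lambda>n. mollify (\<epsilon> n) v z) \<longlonglongrightarrow> v z \<and>
       (\<lambda>n. mollify (\<epsilon> n) V z) \<longlonglongrightarrow> V z \<and> (\<lambda>n. mollify (\<epsilon> n) H z) \<longlonglongrightarrow> H z) \<and>
    (\<lambda>n. \<integral>z. norm (mollify (\<epsilon> n) H z - H z) \<partial>lborel) \<longlonglongrightarrow> 0 \<and>
    (\<exists>N. \<forall>n\<ge>N. integrable lborel (\<lambda>z. mollify (\<epsilon> n) H z - H z))"
proof -
  define e where "e n = \<delta> / 2 * inverse (real (Suc n))" for n
  have e: "0 < e n" "e n < \<delta>" for n
  proof -
    have "e n \<le> \<delta> / 2 * 1" unfolding e_def using \<delta> by (intro mult_left_mono) (auto simp: field_simps)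
    then show "e n < \<delta>" using \<delta> by simp
  qed (use \<delta> in \<open>simp add: e_def\<close>)
  have e0: "e \<longlonglongrightarrow> 0"
    using tendsto_mult[OF tendsto_const LIMSEQ_inverse_real_of_nat, of "\<delta> / 2"] by (simp add: e_def[abs_def])
  define F where "F z = (U z, v z, V z, H z)" for z
  have Fi: "integrable lborel F"
  proof -
    have "integrable lborel (\<lambda>z. (U z, 0, 0, 0) + ((0, v z, 0, 0) + ((0, 0, V z, 0) + (0, 0, 0, H z))))"
      using U_int v_int V_int H_int
      by (intro Bochner_Integration.integrable_add)
         (auto intro!: integrable_bounded_linear[where T = "\<lambda>x. (x, 0, 0, 0)"] integrable_bounded_linear[where T = "\<lambda>x. (0, x, 0, 0)"]
            integrable_bounded_linear[where T = "\<lambda>x. (0, 0, x, 0)"] integrable_bounded_linear[where T = "\<lambda>x. (0, 0, 0, x)"]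
            bounded_linear_Pair bounded_linear_zero bounded_linear_ident)
    then show ?thesis by (simp add: F_def[abs_def])
  qed
  obtain r where r: "strict_mono r" "AE c in lborel. (\<lambda>n. mollify (e (r n)) F c) \<longlonglongrightarrow> F c"
    using mollify_AE_subseq[OF Fi e0 e(1)] by blast
  have comp: "mollify \<epsilon> (\<lambda>z. T (F z)) c = T (mollify \<epsilon> F c)" if "bounded_linear T" for \<epsilon> c and T :: "_ \<Rightarrow> 'c::euclidean_space"
    using integral_bounded_linear[OF that mollify_integrand[OF Fi, of \<epsilon> c]]
    by (simp add: mollify_def linear_scale[OF bounded_linear.linear[OF that]])
  have bl: "bounded_linear (\<lambda>x::real \<times> 'a \<times> 'a \<times> real. fst x)" "bounded_linear (\<lambda>x::real \<times> 'a \<times> 'a \<times> real. fst (snd x))"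
    "bounded_linear (\<lambda>x::real \<times> 'a \<times> 'a \<times> real. fst (snd (snd x)))" "bounded_linear (\<lambda>x::real \<times> 'a \<times> 'a \<times> real. snd (snd (snd x)))"
    by (auto intro!: bounded_linear_intros)
  have mF: "mollify \<epsilon> F c = (mollify \<epsilon> U c, mollify \<epsilon> v c, mollify \<epsilon> V c, mollify \<epsilon> H c)" for \<epsilon> c
    using comp[OF bl(1), of \<epsilon> c] comp[OF bl(2), of \<epsilon> c] comp[OF bl(3), of \<epsilon> c] comp[OF bl(4), of \<epsilon> c]
    by (simp add: F_def prod_eq_iff)
  have er0: "(\<lambda>n. e (r n)) \<longlonglongrightarrow> 0" using LIMSEQ_subseq_LIMSEQ[OF e0 r(1)] by (simp add: o_def)
  have "AE z in lborel. (\<lambda>n. mollify (e (r n)) U z) \<longlonglongrightarrow> U z \<and> (\<lambda>n. mollify (e (r n)) v z) \<longlonglongrightarrow> v z \<and>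
       (\<lambda>n. mollify (e (r n)) V z) \<longlonglongrightarrow> V z \<and> (\<lambda>n. mollify (e (r n)) H z) \<longlonglongrightarrow> H z"
    using r(2)
  proof eventually_elim
    case (elim z)
    then have "(\<lambda>n. (mollify (e (r n)) U z, mollify (e (r n)) v z, mollify (e (r n)) V z, mollify (e (r n)) H z)) \<longlonglongrightarrow> (U z, v z, V z, H z)"
      by (simp add: mF F_def)
    from tendsto_fst[OF this] tendsto_fst[OF tendsto_snd[OF this]] tendsto_fst[OF tendsto_snd[OF tendsto_snd[OF this]]]
      tendsto_snd[OF tendsto_snd[OF tendsto_snd[OF this]]]
    show ?case by simp
  qed
  then show ?thesis
    using mollify_L1[OF H_int er0 e(1)] mollify_diff_integrable[OF H_int er0 e(1)] e
    by (intro exI[of _ "\<lambda>n. e (r n)"]) blast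
qed

end

subsection \<open>Passage to the limit\<close>

lemma AE_lborel_translation:
  fixes P :: "'a::euclidean_space \<Rightarrow> bool"
  assumes "AE z in lborel. P z" shows "AE z in lborel. P (z + Y)"
proof -
  have "AE z in distr lborel borel ((+) Y). P z" unfolding lborel_distr_plus by (rule assms)
  then have "AE z in lborel. P (Y + z)" by (rule AE_distrD[rotated]) simp
  then show ?thesis by (simp add: add.commute)
qed

text \<open>A null set of the product has null sections for almost every time; this is how
  convergence in space-time gives convergence on slices.\<close>

lemma AE_lborel_Pair:
  fixes P :: "'a::euclidean_space \<times> 'b::euclidean_space \<Rightarrow> bool"
  assumes "AE z in lborel. P z" shows "AE t in lborel. AE x in lborel. P (x, t)"
proof -
  obtain N where N: "{z. \<not> P z} \<subseteq> N" "emeasure lborel N = 0" "N \<in> sets lborel"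
    using AE_E[OF assms] by auto
  then have [measurable]: "N \<in> sets borel" by simp
  have "(\<integral>\<^sup>+t. \<integral>\<^sup>+x. indicator N (x, t) \<partial>lborel \<partial>lborel) = 0"
    using nn_integral_lborel_Pair[of "indicator N"] N by simp
  moreover have m: "(\<lambda>t. \<integral>\<^sup>+x. indicator N (x, t) \<partial>(lborel :: 'a measure)) \<in> borel_measurable (lborel :: 'b measure)"
    by measurable
  ultimately have "AE t in (lborel :: 'b measure). (\<integral>\<^sup>+x. indicator N (x, t) \<partial>(lborel :: 'a measure)) = 0"
    by (subst (asm) nn_integral_0_iff_AE) auto
  then show ?thesis
  proof eventually_elim
    case (elim t)
    then have "AE x in lborel. indicator N (x, t) = (0::ennreal)"
      by (subst (asm) nn_integral_0_iff_AE) auto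
    then show ?case by eventually_elim (use N in \<open>auto simp: indicator_def split: if_splits\<close>)
  qed
qed

text \<open>The left side of the smooth estimates passes to the limit by Fatou, while the right side
  converges by \<open>dominated_convergence_varying\<close>.\<close>

lemma fatou_bound:
  fixes F :: "nat \<Rightarrow> 'a \<Rightarrow> ennreal"
  assumes [measurable]: "\<And>n. F n \<in> borel_measurable M"
    and lim: "AE x in M. (\<lambda>n. F n x) \<longlonglongrightarrow> F0 x"
    and bd: "\<And>n. n \<ge> N \<Longrightarrow> (\<integral>\<^sup>+x. F n x \<partial>M) \<le> B n" and B: "B \<longlonglongrightarrow> B0"
  shows "(\<integral>\<^sup>+x. F0 x \<partial>M) \<le> B0"
proof -
  have "(\<integral>\<^sup>+x. F0 x \<partial>M) = (\<integral>\<^sup>+x. liminf (\<lambda>n. F n x) \<partial>M)"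
    by (rule nn_integral_cong_AE, use lim in eventually_elim) (simp add: lim_imp_Liminf)
  also have "\<dots> \<le> liminf (\<lambda>n. \<integral>\<^sup>+x. F n x \<partial>M)" by (rule nn_integral_liminf) measurable
  also have "\<dots> \<le> liminf B"
    by (rule Liminf_mono) (use eventually_ge_at_top[of N] in eventually_elim, rule bd)
  also have "\<dots> = B0" using B by (simp add: lim_imp_Liminf)
  finally show ?thesis .
qed

lemma trunc_tendsto:
  assumes "(\<lambda>n. u n) \<longlonglongrightarrow> u0"
  shows "(\<lambda>n. trunc0 (u n - k)) \<longlonglongrightarrow> trunc0 (u0 - k)" "(\<lambda>n. trunc1 (u n - k)) \<longlonglongrightarrow> trunc1 (u0 - k)"
    "(\<lambda>n. trunc2 (u n - k)) \<longlonglongrightarrow> trunc2 (u0 - k)"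
proof -
  have a: "(\<lambda>n. u n - k) \<longlonglongrightarrow> u0 - k" using assms by (intro tendsto_intros)
  show "(\<lambda>n. trunc0 (u n - k)) \<longlonglongrightarrow> trunc0 (u0 - k)"
    by (rule continuous_on_tendsto_compose[OF trunc0_continuous[of UNIV] a]) auto
  show "(\<lambda>n. trunc1 (u n - k)) \<longlonglongrightarrow> trunc1 (u0 - k)"
    by (rule continuous_on_tendsto_compose[OF trunc1_continuous[of UNIV] a]) auto
  show "(\<lambda>n. trunc2 (u n - k)) \<longlonglongrightarrow> trunc2 (u0 - k)"
    by (rule continuous_on_tendsto_compose[OF trunc2_continuous[of UNIV] a]) auto
qed

lemma trunc_bounds:
  assumes "k \<ge> 0"
  shows "trunc0 (s - k) \<le> s\<^sup>2" "trunc1 (s - k) \<le> \<bar>s\<bar>"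
proof -
  have m: "max 0 (s - k) \<le> \<bar>s\<bar>" using assms by auto
  then show "trunc1 (s - k) \<le> \<bar>s\<bar>" using trunc1_le[of "s - k"] by linarith
  have "(max 0 (s - k))\<^sup>2 \<le> \<bar>s\<bar>\<^sup>2" using m by (intro power_mono) auto
  moreover have "s\<^sup>2 \<ge> 0" by simp
  ultimately show "trunc0 (s - k) \<le> s\<^sup>2" using trunc0_le[of "s - k"] by (simp only: power2_abs)
qed

lemma C1_fun_power:
  fixes f :: "'a::euclidean_space \<Rightarrow> real"
  assumes f: "C1_fun f f'"
  shows "C1_fun (\<lambda>z. f z ^ m) (\<lambda>z h. real m * f z ^ (m - 1) * f' z h)"
  unfolding C1_fun_def
proof (intro conjI allI)
  fix z
  have "((\<lambda>x. x ^ m) has_derivative ((*) (real m * f z ^ (m - 1)))) (at (f z))"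
    using DERIV_pow[of m "f z"] by (simp add: has_field_derivative_def)
  from diff_chain_at[OF C1_fun_deriv[OF f] this]
  show "((\<lambda>z. f z ^ m) has_derivative (\<lambda>h. real m * f z ^ (m - 1) * f' z h)) (at z)" by (simp add: o_def)
qed (intro continuous_intros C1_fun_continuous[OF f] C1_fun_continuous_deriv[OF f])

text \<open>The cutoff in the energy is the power \<open>m\<close> of \<phi>. Since \<open>m\<close>
  is at least \<open>q\<close>, it absorbs the factor of order \<open>q\<close> in 1/\<phi> that
  Young's inequality creates; since it is at least 2, the derivative of the power vanishes wherever
  \<phi> does. The gap between \<open>r\<close> and \<open>R0\<close> is room for the
  kernels.\<close>

locale local_energy = local_subsolution +
  fixes \<phi> :: "'a \<times> real \<Rightarrow> real" and \<phi>' :: "'a \<times> real \<Rightarrow> 'a \<times> real \<Rightarrow> real"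
    and c k r :: real and m :: nat
  assumes \<phi>_C1: "C1_fun \<phi> \<phi>'" and \<phi>_range: "\<And>z. 0 \<le> \<phi> z" "\<And>z. \<phi> z \<le> 1"
    and \<phi>_supp: "\<And>z. z \<notin> ball z0 r \<Longrightarrow> \<phi> z = 0" and r: "r < R0"
    and \<phi>'_bound: "\<And>z h. \<bar>\<phi>' z h\<bar> \<le> c * norm h" and c: "c \<ge> 1"
    and m: "m \<ge> 2" "q \<le> real m" and k: "k \<ge> 0"
begin

definition "\<zeta> z = \<phi> z ^ m"
definition "\<zeta>' z h = real m * \<phi> z ^ (m - 1) * \<phi>' z h"

lemma \<zeta>_C1: "C1_fun \<zeta> \<zeta>'"
  unfolding \<zeta>_def[abs_def] \<zeta>'_def[abs_def] by (rule C1_fun_power[OF \<phi>_C1])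

lemma \<zeta>_nonneg: "\<zeta> z \<ge> 0" and \<zeta>_le_1: "\<zeta> z \<le> 1"
  using \<phi>_range by (auto simp: \<zeta>_def power_le_one)

lemma \<zeta>_supp: "norm z > norm z0 + r \<Longrightarrow> \<zeta> z = 0"
proof -
  assume z: "norm z > norm z0 + r"
  have "z \<notin> ball z0 r"
  proof
    assume "z \<in> ball z0 r"
    then have "norm (z - z0) < r" by (simp add: dist_norm norm_minus_commute)
    then show False using z norm_triangle_ineq2[of z z0] by linarith
  qed
  then show "\<zeta> z = 0" using \<phi>_supp m by (simp add: \<zeta>_def)
qed

lemma \<zeta>'_bound: "\<bar>\<zeta>' z h\<bar> \<le> real m * \<phi> z ^ (m - 1) * (c * norm h)"
proof -
  have "real m * \<phi> z ^ (m - 1) * \<bar>\<phi>' z h\<bar> \<le> real m * \<phi> z ^ (m - 1) * (c * norm h)"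
    by (intro mult_left_mono \<phi>'_bound mult_nonneg_nonneg zero_le_power \<phi>_range) simp
  then show ?thesis using \<phi>_range(1)[of z] by (simp add: \<zeta>'_def abs_mult)
qed

lemma \<zeta>'_bound': "\<bar>\<zeta>' z h\<bar> \<le> real m * c * norm h"
proof -
  have "\<phi> z ^ (m - 1) \<le> 1" using \<phi>_range by (simp add: power_le_one)
  then have "real m * \<phi> z ^ (m - 1) * (c * norm h) \<le> real m * 1 * (c * norm h)"
    using c by (intro mult_right_mono mult_left_mono) auto
  then show ?thesis using \<zeta>'_bound[of z h] by simp
qed

definition "Q z = trunc0 (U z - k) * \<zeta>' z (0, 1) - trunc2 (U z - k) * \<zeta> z * (V z \<bullet> v z) - trunc1 (U z - k) * \<zeta>' z (V z, 0)"

text \<open>Fixing one sequence as a constant of the locale lets the energy and the difference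
  quotients pass to the limit along the same subsequence.\<close>

definition "eps = (SOME \<epsilon>. (\<forall>n. 0 < \<epsilon> n \<and> \<epsilon> n < R0 - r) \<and>
    (AE z in lborel. (\<lambda>n. mollify (\<epsilon> n) U z) \<longlonglongrightarrow> U z \<and> (\<lambda>n. mollify (\<epsilon> n) v z) \<longlonglongrightarrow> v z \<and>
       (\<lambda>n. mollify (\<epsilon> n) V z) \<longlonglongrightarrow> V z \<and> (\<lambda>n. mollify (\<epsilon> n) H z) \<longlonglongrightarrow> H z) \<and>
    (\<lambda>n. \<integral>z. norm (mollify (\<epsilon> n) H z - H z) \<partial>lborel) \<longlonglongrightarrow> 0 \<and>
    (\<exists>N. \<forall>n\<ge>N. integrable lborel (\<lambda>z. mollify (\<epsilon> n) H z - H z)))"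

definition "un n = mollify (eps n) U"
definition "vn n = mollify (eps n) v"
definition "Vn n = mollify (eps n) V"
definition "Hn n = mollify (eps n) H"

lemma eps_properties:
  "0 < eps n" "eps n < R0 - r"
  "AE z in lborel. (\<lambda>n. un n z) \<longlonglongrightarrow> U z \<and> (\<lambda>n. vn n z) \<longlonglongrightarrow> v z \<and> (\<lambda>n. Vn n z) \<longlonglongrightarrow> V z \<and> (\<lambda>n. Hn n z) \<longlonglongrightarrow> H z"
  "(\<lambda>n. \<integral>z. norm (Hn n z - H z) \<partial>lborel) \<longlonglongrightarrow> 0"
  "\<exists>N. \<forall>n\<ge>N. integrable lborel (\<lambda>z. Hn n z - H z)"
  using someI_ex[OF mollify_sequence[of "R0 - r"], folded eps_def] r
  by (simp_all add: un_def vn_def Vn_def Hn_def)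

lemma smooth_C1: "C1_fun (un n) (dmol (eps n) U)" "C1_fun (vn n) (dmol (eps n) v)" "C1_fun (Vn n) (dmol (eps n) V)"
  unfolding un_def vn_def Vn_def 
  by (rule C1_mollify[OF U_int eps_properties(1)], rule C1_mollify[OF v_int eps_properties(1)], rule C1_mollify[OF V_int eps_properties(1)])

lemma smooth_continuous: "continuous_on S (un n)" "continuous_on S (vn n)" "continuous_on S (Vn n)"
  by (rule continuous_on_subset[OF C1_fun_continuous[OF smooth_C1(1)]], simp)
     (rule continuous_on_subset[OF C1_fun_continuous[OF smooth_C1(2)]], simp,
      rule continuous_on_subset[OF C1_fun_continuous[OF smooth_C1(3)]], simp)

lemma smooth_measurable [measurable]: "un n \<in> borel_measurable borel" "vn n \<in> borel_measurable borel" "Vn n \<in> borel_measurable borel"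
  by (rule borel_measurable_continuous_onI, rule smooth_continuous)+

lemma \<zeta>_measurable [measurable]: "\<zeta> \<in> borel_measurable borel" "(\<lambda>z. \<zeta>' z h) \<in> borel_measurable borel" "\<phi> \<in> borel_measurable borel"
  by (rule borel_measurable_continuous_onI, rule C1_fun_continuous[OF \<zeta>_C1])
     (rule borel_measurable_continuous_onI, rule C1_fun_continuous_deriv[OF \<zeta>_C1],
      rule borel_measurable_continuous_onI, rule C1_fun_continuous[OF \<phi>_C1])

lemma \<zeta>'_Pair_measurable [measurable]:
  assumes [measurable]: "f \<in> borel_measurable borel"
  shows "(\<lambda>z. \<zeta>' z (f z, 0)) \<in> borel_measurable borel"
proof -
  have "\<zeta>' z (f z, 0) = (\<Sum>b\<in>Basis. (f z \<bullet> b) * \<zeta>' z (b, 0))" for z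
    by (rule linear_Pair_expand[OF has_derivative_linear[OF C1_fun_deriv[OF \<zeta>_C1]]])
  then show ?thesis by simp
qed

lemma cball_eps: "\<zeta> z \<noteq> 0 \<Longrightarrow> cball z (eps n) \<subseteq> ball z0 R0"
proof
  fix y assume "\<zeta> z \<noteq> 0" and y: "y \<in> cball z (eps n)"
  then have "z \<in> ball z0 r" using \<phi>_supp[of z] m by (auto simp: \<zeta>_def)
  then have "dist z0 z < r" by simp
  moreover have "dist z y \<le> eps n" using y by simp
  ultimately show "y \<in> ball z0 R0" using eps_properties(2)[of n] dist_triangle[of z0 y z] by simp
qed

lemma smooth_gradient: assumes "\<zeta> z \<noteq> 0" shows "dmol (eps n) U z (y, 0) = vn n z \<bullet> y"
proof -
  have "dmol (eps n) U z (y, 0) = (\<Sum>b\<in>Basis. (y \<bullet> b) * dmol (eps n) U z (b, 0))"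
    by (rule linear_Pair_expand[OF has_derivative_linear[OF C1_fun_deriv[OF smooth_C1(1)]]])
  also have "\<dots> = (\<Sum>b\<in>Basis. (vn n z \<bullet> b) * (y \<bullet> b))"
    by (intro sum.cong refl) (simp add: mollify_gradient[OF eps_properties(1) cball_eps[OF assms]] vn_def)
  finally show ?thesis by (simp only: euclidean_inner[of "vn n z" y])
qed

definition "qn n z = trunc0 (un n z - k) * \<zeta>' z (0, 1) - trunc2 (un n z - k) * \<zeta> z * (Vn n z \<bullet> vn n z) - trunc1 (un n z - k) * \<zeta>' z (Vn n z, 0)"

definition "I t z = indicat_real {z :: 'a \<times> real. snd z \<le> t} z"

lemma I_measurable [measurable]: "I t \<in> borel_measurable borel"
proof -
  have "closed {z :: 'a \<times> real. snd z \<le> t}" by (intro closed_Collect_le continuous_intros)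
  then have [measurable]: "{z :: 'a \<times> real. snd z \<le> t} \<in> sets borel" by simp
  show ?thesis unfolding I_def[abs_def] by measurable
qed

lemma I_range: "0 \<le> I t z" "I t z \<le> 1" by (auto simp: I_def)

lemma smooth_energy: "(\<integral>x. trunc0 (un n (x, t) - k) * \<zeta> (x, t) \<partial>lborel) \<le> (\<integral>z. I t z * qn n z \<partial>lborel)"
  unfolding I_def qn_def
proof (rule smooth_energy_inequality[OF smooth_C1(1) smooth_C1(3) \<zeta>_C1 \<zeta>_nonneg \<zeta>_supp smooth_continuous(2)])
  fix z assume z: "\<zeta> z \<noteq> 0"
  show "dmol (eps n) U z (0, 1) \<le> (\<Sum>b\<in>Basis. dmol (eps n) V z (b, 0) \<bullet> b)"
    by (rule mollify_subsolution[OF eps_properties(1) cball_eps[OF z]])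
  fix b :: 'a assume "b \<in> Basis"
  show "dmol (eps n) U z (b, 0) = vn n z \<bullet> b" by (rule smooth_gradient[OF z])
qed

text \<open>The three summands bound the time derivative of the cutoff, the coercive term and the
  mixed term of \<open>qn\<close>.\<close>

definition "C0 = real m * c + 2 * (\<Lambda> * q) + real m * c * (2 * (\<Lambda> * q))"

lemma C0_nonneg: "C0 \<ge> 0" using c \<Lambda> q_gt_1 by (simp add: C0_def)

lemma qn_bound: "\<bar>qn n z\<bar> \<le> C0 * Hn n z"
proof -
  note mH = mollify_H[OF eps_properties(1)[of n], where c = z, folded un_def vn_def Vn_def Hn_def]
  have Lq: "\<Lambda> * q \<ge> 0" using \<Lambda> q_gt_1 by simp
  have t0: "\<bar>trunc0 (un n z - k) * \<zeta>' z (0, 1)\<bar> \<le> Hn n z * (real m * c)"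
  proof -
    have "\<bar>trunc0 (un n z - k)\<bar> \<le> Hn n z" using trunc_bounds(1)[OF k, of "un n z"] mH(1) trunc0_nonneg[of "un n z - k"] by linarith
    moreover have "\<bar>\<zeta>' z (0, 1)\<bar> \<le> real m * c" using \<zeta>'_bound'[of z "(0, 1)"] by (simp add: norm_Pair)
    ultimately show ?thesis unfolding abs_mult by (intro mult_mono) auto
  qed
  have t1: "\<bar>trunc2 (un n z - k) * \<zeta> z * (Vn n z \<bullet> vn n z)\<bar> \<le> 2 * (\<Lambda> * q) * Hn n z"
  proof -
    have "\<bar>Vn n z \<bullet> vn n z\<bar> \<le> norm (Vn n z) * norm (vn n z)" by (rule Cauchy_Schwarz_ineq2)
    also have "\<dots> \<le> \<Lambda> * q * (Hn n z + G (norm (vn n z)))" by (rule mH(4)) simp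
    also have "\<dots> \<le> \<Lambda> * q * (Hn n z + Hn n z)" using mH(3) Lq by (intro mult_left_mono) auto
    finally have a: "\<bar>Vn n z \<bullet> vn n z\<bar> \<le> 2 * (\<Lambda> * q) * Hn n z" by simp
    have "\<bar>trunc2 (un n z - k) * \<zeta> z\<bar> \<le> 1 * 1"
      unfolding abs_mult using trunc2_nonneg[of "un n z - k"] trunc2_le_1[of "un n z - k"] \<zeta>_nonneg[of z] \<zeta>_le_1[of z] by (intro mult_mono) auto
    then have "\<bar>trunc2 (un n z - k) * \<zeta> z\<bar> * \<bar>Vn n z \<bullet> vn n z\<bar> \<le> (1 * 1) * (2 * (\<Lambda> * q) * Hn n z)"
      using a by (intro mult_mono) auto
    then show ?thesis by (simp add: abs_mult)
  qed
  have t2: "\<bar>trunc1 (un n z - k) * \<zeta>' z (Vn n z, 0)\<bar> \<le> real m * c * (2 * (\<Lambda> * q)) * Hn n z"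
  proof -
    have "\<bar>trunc1 (un n z - k) * \<zeta>' z (Vn n z, 0)\<bar> \<le> \<bar>un n z\<bar> * (real m * c * norm (Vn n z))"
      unfolding abs_mult using trunc1_nonneg[of "un n z - k"] trunc_bounds(2)[OF k, of "un n z"] \<zeta>'_bound'[of z "(Vn n z, 0)"]
      by (intro mult_mono) (auto simp: norm_Pair)
    also have "\<dots> = real m * c * (norm (Vn n z) * \<bar>un n z\<bar>)" by simp
    also have "\<dots> \<le> real m * c * (\<Lambda> * q * (Hn n z + G \<bar>un n z\<bar>))"
      using c by (intro mult_left_mono mH(4)) auto
    also have "\<dots> \<le> real m * c * (\<Lambda> * q * (Hn n z + Hn n z))" using mH(2) Lq c by (intro mult_left_mono) auto
    finally show ?thesis by simp
  qed
  show ?thesis unfolding qn_def C0_def using t0 t1 t2 by (simp add: algebra_simps abs_le_iff)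
qed

lemma Hn_scaled_conv:
  assumes "C \<ge> 0"
  shows "\<exists>N. \<forall>n\<ge>N. integrable lborel (\<lambda>z. C * Hn n z - C * H z)"
    "AE z in lborel. (\<lambda>n. C * Hn n z) \<longlonglongrightarrow> C * H z"
    "(\<lambda>n. \<integral>z. norm (C * Hn n z - C * H z) \<partial>lborel) \<longlonglongrightarrow> 0"
proof -
  have eq: "C * Hn n z - C * H z = C * (Hn n z - H z)" for n z by (simp add: right_diff_distrib)
  show "\<exists>N. \<forall>n\<ge>N. integrable lborel (\<lambda>z. C * Hn n z - C * H z)"
  proof -
    obtain N where "\<And>n. n \<ge> N \<Longrightarrow> integrable lborel (\<lambda>z. Hn n z - H z)" using eps_properties(5) by blast
    then show ?thesis unfolding eq by (intro exI[of _ N] allI impI integrable_mult_right)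
  qed
  show "AE z in lborel. (\<lambda>n. C * Hn n z) \<longlonglongrightarrow> C * H z"
    using eps_properties(3) by eventually_elim (auto intro!: tendsto_intros)
  show "(\<lambda>n. \<integral>z. norm (C * Hn n z - C * H z) \<partial>lborel) \<longlonglongrightarrow> 0"
    using tendsto_mult[OF tendsto_const eps_properties(4), of C] assms
    by (simp add: eq abs_mult)
qed

text \<open>The majorant \<open>C0 * Hn n z\<close> changes with \<open>n\<close>, so the limit
  needs the version of dominated convergence with L1-convergent majorants.\<close>

lemma energy_conv:
  shows "integrable lborel (\<lambda>z. I t z * Q z)"
    "(\<lambda>n. \<integral>z. I t z * qn n z \<partial>lborel) \<longlonglongrightarrow> (\<integral>z. I t z * Q z \<partial>lborel)"
proof -
  have [measurable]: "qn n \<in> borel_measurable borel" for n unfolding qn_def by measurable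
  have [measurable]: "Q \<in> borel_measurable borel" unfolding Q_def by measurable
  have bd: "\<bar>I t z * qn n z\<bar> \<le> C0 * Hn n z" for n z
  proof -
    have "\<bar>I t z\<bar> * \<bar>qn n z\<bar> \<le> 1 * \<bar>qn n z\<bar>" using I_range[of t z] by (intro mult_right_mono) auto
    then show ?thesis using qn_bound[of n z] by (simp add: abs_mult)
  qed
  have lim: "AE z in lborel. (\<lambda>n. I t z * qn n z) \<longlonglongrightarrow> I t z * Q z"
    using eps_properties(3)
  proof eventually_elim
    case (elim z)
    have "bounded_linear (\<zeta>' z)" using C1_fun_deriv[OF \<zeta>_C1, of z] by (rule has_derivative_bounded_linear)
    moreover have "(\<lambda>n. (Vn n z, 0::real)) \<longlonglongrightarrow> (V z, 0)" using elim by (intro tendsto_intros) auto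
    ultimately have l: "(\<lambda>n. \<zeta>' z (Vn n z, 0)) \<longlonglongrightarrow> \<zeta>' z (V z, 0)" by (rule bounded_linear.tendsto)
    show ?case unfolding qn_def Q_def using elim
      by (intro tendsto_intros trunc_tendsto l) auto
  qed
  note dc = dominated_convergence_varying[of "\<lambda>n z. I t z * qn n z" lborel "\<lambda>z. I t z * Q z" "\<lambda>n z. C0 * Hn n z" "\<lambda>z. C0 * H z",
      OF _ _ Hn_scaled_conv(1)[OF C0_nonneg] _ _ bd lim Hn_scaled_conv(2)[OF C0_nonneg] Hn_scaled_conv(3)[OF C0_nonneg]]
  show "integrable lborel (\<lambda>z. I t z * Q z)" "(\<lambda>n. \<integral>z. I t z * qn n z \<partial>lborel) \<longlonglongrightarrow> (\<integral>z. I t z * Q z \<partial>lborel)"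
    by (rule dc; use H_int H_nonneg C0_nonneg in simp)+
qed

lemma energy_slice_nonneg: "0 \<le> (\<integral>x. trunc0 (un n (x, t) - k) * \<zeta> (x, t) \<partial>lborel)"
  by (intro Bochner_Integration.integral_nonneg mult_nonneg_nonneg trunc0_nonneg \<zeta>_nonneg)

lemma energy_Q_nonneg: "0 \<le> (\<integral>z. I t z * Q z \<partial>lborel)"
  by (rule LIMSEQ_le_const[OF energy_conv(2)]) (intro exI allI impI order_trans[OF energy_slice_nonneg smooth_energy])

text \<open>The mollified functions converge almost everywhere on almost every slice, and the
  integrand is nonnegative, so Fatou applies slice by slice; the right side is a space-time integral
  that converges for every \<open>t\<close>.\<close>

lemma energy_slice:
  "AE t in lborel. (\<integral>\<^sup>+x. ennreal (trunc0 (U (x, t) - k) * \<zeta> (x, t)) \<partial>lborel) \<le> ennreal (\<integral>z. I t z * Q z \<partial>lborel)"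
  using AE_lborel_Pair[OF eps_properties(3)]
proof eventually_elim
  case (elim t)
  show ?case
  proof (rule fatou_bound[where N = 0])
    show "AE x in lborel. (\<lambda>n. ennreal (trunc0 (un n (x, t) - k) * \<zeta> (x, t))) \<longlonglongrightarrow> ennreal (trunc0 (U (x, t) - k) * \<zeta> (x, t))"
      using elim by eventually_elim (rule tendsto_ennrealI, rule tendsto_mult_right, rule trunc_tendsto(1), simp)
    show "(\<lambda>n. ennreal (\<integral>z. I t z * qn n z \<partial>lborel)) \<longlonglongrightarrow> ennreal (\<integral>z. I t z * Q z \<partial>lborel)"
      by (rule tendsto_ennrealI[OF energy_conv(2)])
    fix n
    show "(\<integral>\<^sup>+x. ennreal (trunc0 (un n (x, t) - k) * \<zeta> (x, t)) \<partial>lborel) \<le> ennreal (\<integral>z. I t z * qn n z \<partial>lborel)"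
    proof -
      have "integrable lborel (\<lambda>x. trunc0 (un n (x, t) - k) * \<zeta> (x, t))"
      proof (rule integrable_continuous_compact_support[where R = "norm z0 + r"])
        show "continuous_on UNIV (\<lambda>x. trunc0 (un n (x, t) - k) * \<zeta> (x, t))"
          by (intro continuous_intros continuous_on_compose2[OF smooth_continuous(1)[of UNIV]] continuous_on_compose2[OF C1_fun_continuous[OF \<zeta>_C1]]) auto
        fix x :: 'a assume "norm x > norm z0 + r"
        then have "norm (x, t) > norm z0 + r" using norm_fst_le[of x t] by simp
        then show "trunc0 (un n (x, t) - k) * \<zeta> (x, t) = 0" by (simp add: \<zeta>_supp)
      qed
      then have "(\<integral>\<^sup>+x. ennreal (trunc0 (un n (x, t) - k) * \<zeta> (x, t)) \<partial>lborel) = ennreal (\<integral>x. trunc0 (un n (x, t) - k) * \<zeta> (x, t) \<partial>lborel)"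
        by (rule nn_integral_eq_integral) (auto intro!: mult_nonneg_nonneg trunc0_nonneg \<zeta>_nonneg)
      also have "\<dots> \<le> ennreal (\<integral>z. I t z * qn n z \<partial>lborel)" by (rule ennreal_leI[OF smooth_energy])
      finally show ?thesis .
    qed
  qed measurable
qed

section \<open>The truncated function and its difference quotients\<close>

definition "f z = trunc1 (U z - k) * \<zeta> z"
text \<open>What the product rule would give as a bound for the spatial gradient of
  \<open>f\<close>. The product rule is applied to the mollified functions only; for
  \<open>f\<close> itself the bound is expressed through difference quotients.\<close>

definition "Df z = trunc2 (U z - k) * \<zeta> z * norm (v z) + real m * c * (\<phi> z ^ (m - 1) * trunc1 (U z - k))"

definition "fn n z = trunc1 (un n z - k) * \<zeta> z"
definition "Dfn n z = trunc2 (un n z - k) * \<zeta> z * norm (vn n z) + real m * c * (\<phi> z ^ (m - 1) * trunc1 (un n z - k))"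

lemma f_measurable [measurable]: "f \<in> borel_measurable borel" "Df \<in> borel_measurable borel"
  "fn n \<in> borel_measurable borel" "Dfn n \<in> borel_measurable borel"
  unfolding f_def Df_def fn_def Dfn_def by measurable

lemma Dfn_nonneg: "Dfn n z \<ge> 0"
  unfolding Dfn_def using c \<phi>_range \<zeta>_nonneg trunc2_nonneg trunc1_nonneg
  by (intro add_nonneg_nonneg mult_nonneg_nonneg) auto

lemma G_Dfn_bound: "\<bar>G (Dfn n z)\<bar> \<le> 2 powr q * (1 + (real m * c) powr q) * Hn n z"
proof -
  note mH = mollify_H[OF eps_properties(1)[of n], where c = z, folded un_def vn_def Vn_def Hn_def]
  have mc: "real m * c \<ge> 1" using m c mult_mono[of 1 "real m" 1 c] by simp
  have "Dfn n z \<le> norm (vn n z) + real m * c * \<bar>un n z\<bar>"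
  proof -
    have "trunc2 (un n z - k) * \<zeta> z * norm (vn n z) \<le> 1 * 1 * norm (vn n z)"
      using trunc2_nonneg[of "un n z - k"] trunc2_le_1[of "un n z - k"] \<zeta>_nonneg[of z] \<zeta>_le_1[of z] by (intro mult_right_mono mult_mono) auto
    moreover have "\<phi> z ^ (m - 1) * trunc1 (un n z - k) \<le> 1 * \<bar>un n z\<bar>"
      using \<phi>_range trunc1_nonneg[of "un n z - k"] trunc_bounds(2)[OF k, of "un n z"] by (intro mult_mono power_le_one) auto
    ultimately show ?thesis unfolding Dfn_def using mc by (intro add_mono mult_left_mono) auto
  qed
  then have "G (Dfn n z) \<le> G (norm (vn n z) + real m * c * \<bar>un n z\<bar>)" by (rule G_mono)
  also have "\<dots> \<le> 2 powr q * (G (norm (vn n z)) + G (real m * c * \<bar>un n z\<bar>))" using mc by (intro G_sum) auto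
  also have "\<dots> \<le> 2 powr q * (Hn n z + (real m * c) powr q * Hn n z)"
  proof -
    have "G (real m * c * \<bar>un n z\<bar>) \<le> (real m * c) powr q * G \<bar>un n z\<bar>" using mc by (intro G_scale_upper) auto
    also have "\<dots> \<le> (real m * c) powr q * Hn n z" using mH(2) by (intro mult_left_mono) auto
    finally show ?thesis using mH(3) by (intro mult_left_mono add_mono) auto
  qed
  finally show ?thesis using G_nonneg[of "Dfn n z"] by (simp add: algebra_simps)
qed

lemma modular_conv:
  shows "integrable lborel (\<lambda>z. G (Df z))"
    "(\<lambda>n. \<integral>z. G (Dfn n z) \<partial>lborel) \<longlonglongrightarrow> (\<integral>z. G (Df z) \<partial>lborel)"
    "\<exists>N. \<forall>n\<ge>N. integrable lborel (\<lambda>z. G (Dfn n z))"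
proof -
  define C where "C = 2 powr q * (1 + (real m * c) powr q)"
  have C: "C \<ge> 0" by (simp add: C_def)
  have lim: "AE z in lborel. (\<lambda>n. G (Dfn n z)) \<longlonglongrightarrow> G (Df z)"
    using eps_properties(3)
  proof eventually_elim
    case (elim z)
    have "(\<lambda>n. Dfn n z) \<longlonglongrightarrow> Df z" unfolding Dfn_def Df_def using elim
      by (intro tendsto_intros trunc_tendsto) auto
    then show ?case by (rule continuous_on_tendsto_compose[OF G_continuous]) auto
  qed
  note dc = dominated_convergence_varying[of "\<lambda>n z. G (Dfn n z)" lborel "\<lambda>z. G (Df z)" "\<lambda>n z. C * Hn n z" "\<lambda>z. C * H z",
      OF _ _ Hn_scaled_conv(1)[OF C] _ _ G_Dfn_bound[folded C_def] lim Hn_scaled_conv(2)[OF C] Hn_scaled_conv(3)[OF C]]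
  show "integrable lborel (\<lambda>z. G (Df z))" "(\<lambda>n. \<integral>z. G (Dfn n z) \<partial>lborel) \<longlonglongrightarrow> (\<integral>z. G (Df z) \<partial>lborel)"
    "\<exists>N. \<forall>n\<ge>N. integrable lborel (\<lambda>z. G (Dfn n z))"
    by (rule dc; use H_int H_nonneg C in simp)+
qed

text \<open>For the mollified functions this is \<open>translation_modular_bound\<close>; difference
  quotients, unlike derivatives, then survive almost everywhere convergence.\<close>

lemma translation_estimate:
  assumes h: "h > 0" and y: "norm y \<le> h"
  shows "(\<integral>\<^sup>+z. G (\<bar>f (z + (y, 0)) - f z\<bar> / h) \<partial>lborel) \<le> ennreal (\<integral>z. G (Df z) \<partial>lborel)"
proof -
  obtain N where N: "\<And>n. n \<ge> N \<Longrightarrow> integrable lborel (\<lambda>z. G (Dfn n z))" using modular_conv(3) by blast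
  show ?thesis
  proof (rule fatou_bound[where N = N])
    have "AE z in lborel. (\<lambda>n. fn n z) \<longlonglongrightarrow> f z"
      using eps_properties(3) by eventually_elim (auto simp: fn_def f_def intro!: tendsto_intros trunc_tendsto)
    moreover from this have "AE z in lborel. (\<lambda>n. fn n (z + (y, 0))) \<longlonglongrightarrow> f (z + (y, 0))"
      by (rule AE_lborel_translation)
    ultimately show "AE z in lborel. (\<lambda>n. ennreal (G (\<bar>fn n (z + (y, 0)) - fn n z\<bar> / h))) \<longlonglongrightarrow> ennreal (G (\<bar>f (z + (y, 0)) - f z\<bar> / h))"
    proof eventually_elim
      case (elim z)
      have "(\<lambda>n. \<bar>fn n (z + (y, 0)) - fn n z\<bar> / h) \<longlonglongrightarrow> \<bar>f (z + (y, 0)) - f z\<bar> / h"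
        using elim h by (intro tendsto_intros) auto
      then show ?case by (intro tendsto_ennrealI, intro continuous_on_tendsto_compose[OF G_continuous]) auto
    qed
    show "(\<lambda>n. ennreal (\<integral>z. G (Dfn n z) \<partial>lborel)) \<longlonglongrightarrow> ennreal (\<integral>z. G (Df z) \<partial>lborel)"
      by (rule tendsto_ennrealI[OF modular_conv(2)])
    fix n assume n: "n \<ge> N"
    have "(\<integral>\<^sup>+z. G (\<bar>fn n (z + (y, 0)) - fn n z\<bar> / h) \<partial>lborel) \<le> (\<integral>\<^sup>+z. G (Dfn n z) \<partial>lborel)"
    proof (rule translation_modular_bound[OF _ _ Dfn_nonneg h])
      show "C1_fun (fn n) (\<lambda>z h. trunc1 (un n z - k) * \<zeta>' z h + trunc2 (un n z - k) * dmol (eps n) U z h * \<zeta> z)"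
        unfolding fn_def[abs_def]
        by (rule C1_fun_mult[OF C1_fun_compose_real[OF smooth_C1(1) DERIV_trunc1 trunc2_continuous] \<zeta>_C1])
      show "continuous_on UNIV (Dfn n)" unfolding Dfn_def[abs_def]
        by (intro continuous_intros smooth_continuous C1_fun_continuous[OF \<zeta>_C1] C1_fun_continuous[OF \<phi>_C1])
      fix z
      have 1: "\<bar>trunc1 (un n z - k) * \<zeta>' z (y, 0)\<bar> \<le> h * (real m * c * (\<phi> z ^ (m - 1) * trunc1 (un n z - k)))"
      proof -
        have "\<bar>\<zeta>' z (y, 0)\<bar> \<le> real m * \<phi> z ^ (m - 1) * (c * h)"
          using \<zeta>'_bound[of z "(y, 0)"] mult_left_mono[OF mult_left_mono[OF y, of c], of "real m * \<phi> z ^ (m - 1)"] c \<phi>_range(1)[of z]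
          by (simp add: norm_Pair)
        from mult_left_mono[OF this trunc1_nonneg[of "un n z - k"]] show ?thesis
          using trunc1_nonneg[of "un n z - k"] by (simp add: abs_mult mult_ac)
      qed
      have 2: "\<bar>trunc2 (un n z - k) * dmol (eps n) U z (y, 0) * \<zeta> z\<bar> \<le> h * (trunc2 (un n z - k) * \<zeta> z * norm (vn n z))"
      proof (cases "\<zeta> z = 0")
        case False
        have "\<bar>dmol (eps n) U z (y, 0)\<bar> \<le> norm (vn n z) * h"
          unfolding smooth_gradient[OF False]
          using Cauchy_Schwarz_ineq2[of "vn n z" y] mult_left_mono[OF y norm_ge_zero[of "vn n z"]] by linarith
        then have "trunc2 (un n z - k) * \<zeta> z * \<bar>dmol (eps n) U z (y, 0)\<bar> \<le> trunc2 (un n z - k) * \<zeta> z * (norm (vn n z) * h)"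
          using trunc2_nonneg \<zeta>_nonneg by (intro mult_left_mono mult_nonneg_nonneg) auto
        then show ?thesis using trunc2_nonneg[of "un n z - k"] \<zeta>_nonneg[of z] by (simp add: abs_mult mult_ac)
      qed simp
      show "\<bar>trunc1 (un n z - k) * \<zeta>' z (y, 0) + trunc2 (un n z - k) * dmol (eps n) U z (y, 0) * \<zeta> z\<bar> \<le> h * Dfn n z"
        using 1 2 by (simp add: Dfn_def distrib_left)
    qed
    also have "\<dots> = ennreal (\<integral>z. G (Dfn n z) \<partial>lborel)"
      by (rule nn_integral_eq_integral[OF N[OF n]]) (simp add: G_nonneg)
    finally show "(\<integral>\<^sup>+z. G (\<bar>fn n (z + (y, 0)) - fn n z\<bar> / h) \<partial>lborel) \<le> ennreal (\<integral>z. G (Dfn n z) \<partial>lborel)" .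
  qed measurable
qed

end

subsection \<open>Energy and level set estimates\<close>

text \<open>The Young parameter for which the gradient part of the mixed term is at most half of the
  coercive term; the minimum with 1 keeps \<open>young\<close> applicable.\<close>

definition young_par :: "real \<Rightarrow> real \<Rightarrow> real \<Rightarrow> nat \<Rightarrow> real" where
  "young_par q \<nu> \<Lambda> m = min 1 (\<nu> / (2 * (real m * \<Lambda> * q)))"

definition energy_const0 :: "real \<Rightarrow> real \<Rightarrow> real \<Rightarrow> nat \<Rightarrow> real" where
  "energy_const0 q \<nu> \<Lambda> m = real m + real m * \<Lambda> * (young_par q \<nu> \<Lambda> m * q * (1 / young_par q \<nu> \<Lambda> m) powr q)"

text \<open>The sum of the constant for the time slices and the constant for the modular of
  \<open>Df\<close>, so that one number serves for both estimates.\<close>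

definition energy_const :: "real \<Rightarrow> real \<Rightarrow> real \<Rightarrow> nat \<Rightarrow> real" where
  "energy_const q \<nu> \<Lambda> m = 2 * energy_const0 q \<nu> \<Lambda> m + 2 powr q * (2 / \<nu> * energy_const0 q \<nu> \<Lambda> m + real m powr q)"

context local_energy
begin

definition "w z = max 0 (U z - k)"
text \<open>No power of the cutoff is left here: Young's inequality uses up all of \<zeta>, and only
  its support remains visible.\<close>

definition "E z = (if \<phi> z > 0 then (w z)\<^sup>2 + G (w z) else 0)"

lemma w_nonneg: "w z \<ge> 0" by (simp add: w_def)

lemma E_nonneg: "E z \<ge> 0" by (auto simp: E_def G_nonneg)

lemma E_measurable [measurable]: "E \<in> borel_measurable borel" unfolding E_def w_def by measurable

lemma E_le_H: "E z \<le> H z"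
proof -
  have le: "w z \<le> \<bar>U z\<bar>" using k by (auto simp: w_def)
  then have "(w z)\<^sup>2 \<le> \<bar>U z\<bar>\<^sup>2" using w_nonneg by (intro power_mono) auto
  then show ?thesis using G_mono[OF le] G_nonneg[of "norm (v z)"] H_nonneg[of z] by (auto simp: E_def H_def)
qed

lemma E_int: "integrable lborel E"
  by (rule Bochner_Integration.integrable_bound[OF H_int]) (use E_nonneg E_le_H H_nonneg in auto)

abbreviation "\<tau> \<equiv> young_par q \<nu> \<Lambda> m"
abbreviation "K1 \<equiv> energy_const0 q \<nu> \<Lambda> m"

lemma \<tau>: "0 < \<tau>" "\<tau> \<le> 1" "real m * \<Lambda> * (\<tau> * q) \<le> \<nu> / 2"
proof -
  have pos: "real m * \<Lambda> * q > 0" using m \<Lambda> q_gt_1 by simp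
  then show "0 < \<tau>" "\<tau> \<le> 1" using \<nu> by (auto simp: young_par_def)
  have "\<tau> \<le> \<nu> / (2 * (real m * \<Lambda> * q))" by (simp add: young_par_def)
  then have "\<tau> * (real m * \<Lambda> * q) \<le> \<nu> / (2 * (real m * \<Lambda> * q)) * (real m * \<Lambda> * q)"
    using pos by (intro mult_right_mono) auto
  also have "\<dots> = \<nu> / 2"
  proof -
    have "\<nu> / (2 * a) * a = \<nu> / 2" if "a > 0" for a :: real using that by simp
    then show ?thesis using pos by blast
  qed
  finally show "real m * \<Lambda> * (\<tau> * q) \<le> \<nu> / 2" by (simp add: mult_ac)
qed

lemma K1_nonneg: "K1 \<ge> 0"
  using \<tau>(1) \<Lambda> q_gt_1 by (simp add: energy_const0_def)

lemma c_powr_le: "c powr q \<le> c ^ m"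
proof -
  have "c powr q \<le> c powr real m" using c m by (intro powr_mono) auto
  also have "\<dots> = c ^ m" using c by (simp add: powr_realpow)
  finally show ?thesis .
qed

lemma c_le_power: "c \<le> c ^ m"
  using power_increasing[of 1 m c] c m by simp

text \<open>The Caccioppoli estimate before integration. Coercivity gives a full multiple \<nu> of
  the gradient term, and half of it is spent on the mixed term.\<close>

lemma Q_pointwise: "Q z \<le> K1 * c ^ m * E z - \<nu> / 2 * (trunc2 (U z - k) * \<zeta> z * G (norm (v z)))"
proof (cases "\<phi> z > 0")
  case False
  then have z: "\<phi> z = 0" using \<phi>_range(1)[of z] by simp
  have "m - 1 \<noteq> 0" "m \<noteq> 0" using m by auto
  then have "\<zeta> z = 0" "\<zeta>' z h = 0" for h using z by (auto simp: \<zeta>_def \<zeta>'_def power_0_left)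
  then show ?thesis by (simp add: Q_def E_def z)
next
  case True
  let ?t2 = "trunc2 (U z - k)" and ?Gv = "G (norm (v z))" and ?Gw = "G (w z)"
  have t2: "0 \<le> ?t2" "?t2 \<le> 1" by (rule trunc2_nonneg trunc2_le_1)+
  have \<phi>m: "\<phi> z ^ m > 0" using True by simp
  have Ez: "E z = (w z)\<^sup>2 + ?Gw" using True by (simp add: E_def)
  have 1: "trunc0 (U z - k) * \<zeta>' z (0, 1) \<le> real m * c ^ m * (w z)\<^sup>2"
  proof -
    have "trunc0 (U z - k) * \<zeta>' z (0, 1) \<le> trunc0 (U z - k) * (real m * c * 1)"
      using \<zeta>'_bound'[of z "(0, 1)"] by (intro mult_left_mono trunc0_nonneg) (auto simp: norm_Pair)
    also have "\<dots> \<le> (w z)\<^sup>2 * (real m * c * 1)"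
    proof (rule mult_right_mono)
      show "trunc0 (U z - k) \<le> (w z)\<^sup>2"
        using trunc0_le[of "U z - k"] zero_le_power2[of "w z"] unfolding w_def by linarith
    qed (use c in simp)
    also have "\<dots> \<le> (w z)\<^sup>2 * (real m * c ^ m * 1)"
      using c_le_power by (intro mult_left_mono mult_right_mono) auto
    finally show ?thesis by (simp add: mult_ac)
  qed
  have 2: "\<nu> * (?t2 * \<zeta> z * ?Gv) \<le> ?t2 * \<zeta> z * (V z \<bullet> v z)"
    using mult_left_mono[OF A_coercive[of "v z"], of "?t2 * \<zeta> z"] t2 \<zeta>_nonneg[of z] by (simp add: mult_ac)
  have 3: "- (trunc1 (U z - k) * \<zeta>' z (V z, 0)) \<le> \<nu> / 2 * (?t2 * \<zeta> z * ?Gv) + (K1 - real m) * c ^ m * ?Gw"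
  proof -
    have "- (trunc1 (U z - k) * \<zeta>' z (V z, 0)) \<le> trunc1 (U z - k) * \<bar>\<zeta>' z (V z, 0)\<bar>"
      using mult_left_mono[OF abs_ge_minus_self[of "\<zeta>' z (V z, 0)"] trunc1_nonneg[of "U z - k"]] by simp
    also have "\<dots> \<le> (w z * ?t2) * (real m * \<phi> z ^ (m - 1) * (c * (\<Lambda> * g (norm (v z)))))"
    proof (rule mult_mono)
      show "trunc1 (U z - k) \<le> w z * ?t2" using trunc1_le_trunc2 by (simp add: w_def)
      have "\<bar>\<zeta>' z (V z, 0)\<bar> \<le> real m * \<phi> z ^ (m - 1) * (c * norm (V z, 0::real))" by (rule \<zeta>'_bound)
      also have "\<dots> \<le> real m * \<phi> z ^ (m - 1) * (c * (\<Lambda> * g (norm (v z))))"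
        using A_bound[of "v z"] c True by (intro mult_left_mono) (auto simp: norm_Pair)
      finally show "\<bar>\<zeta>' z (V z, 0)\<bar> \<le> real m * \<phi> z ^ (m - 1) * (c * (\<Lambda> * g (norm (v z))))" .
    qed (use t2 w_nonneg in auto)
    \<comment> \<open>The derivative of \<zeta> has one power of \<phi> fewer. The missing power is
      moved into the argument of \<open>G\<close>, so that the gradient keeps the full weight
      \<zeta>.\<close>
    also have "\<dots> = real m * \<Lambda> * (?t2 * \<zeta> z * (g (norm (v z)) * (c / \<phi> z * w z)))"
    proof -
      have "\<phi> z ^ (m - 1) = \<zeta> z / \<phi> z" using True m power_Suc[of "\<phi> z" "m - 1"] by (simp add: \<zeta>_def field_simps)
      then show ?thesis by (simp add: mult_ac)
    qed
    also have "\<dots> \<le> real m * \<Lambda> * (?t2 * \<zeta> z * (\<tau> * q * ?Gv + \<tau> * q * (1 / \<tau>) powr q * G (c / \<phi> z * w z)))"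
      using \<tau> \<Lambda> t2 \<zeta>_nonneg[of z] True c w_nonneg[of z]
      by (intro mult_left_mono young mult_nonneg_nonneg) auto
    also have "\<dots> = (real m * \<Lambda> * (\<tau> * q)) * (?t2 * \<zeta> z * ?Gv) + (K1 - real m) * (?t2 * (\<zeta> z * G (c / \<phi> z * w z)))"
      by (simp add: energy_const0_def algebra_simps)
    also have "\<dots> \<le> \<nu> / 2 * (?t2 * \<zeta> z * ?Gv) + (K1 - real m) * (1 * (c ^ m * ?Gw))"
    proof (rule add_mono)
      show "real m * \<Lambda> * (\<tau> * q) * (?t2 * \<zeta> z * ?Gv) \<le> \<nu> / 2 * (?t2 * \<zeta> z * ?Gv)"
        using \<tau>(3) t2 \<zeta>_nonneg[of z] G_nonneg by (intro mult_right_mono mult_nonneg_nonneg) auto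
      \<comment> \<open>This is where \<open>c \<ge> 1\<close> and \<open>\<phi> z \<le> 1\<close>
        matter: upward scaling applies, its exponent \<open>q\<close> may be raised to
        \<open>m\<close>, and the weight \<zeta> cancels the power of 1/\<phi>.\<close>
      have c\<phi>: "c / \<phi> z \<ge> 1" using True c \<phi>_range(2)[of z] by (simp add: field_simps)
      have "G (c / \<phi> z * w z) \<le> (c / \<phi> z) powr q * ?Gw" by (rule G_scale_upper[OF c\<phi> w_nonneg])
      also have "\<dots> \<le> (c / \<phi> z) powr real m * ?Gw"
        using c\<phi> m by (intro mult_right_mono powr_mono) (auto simp: G_nonneg)
      also have "\<dots> = c ^ m / \<zeta> z * ?Gw"
        using c True by (simp add: powr_realpow \<zeta>_def power_divide)
      finally have "\<zeta> z * G (c / \<phi> z * w z) \<le> \<zeta> z * (c ^ m / \<zeta> z * ?Gw)"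
        by (rule mult_left_mono[OF _ \<zeta>_nonneg])
      then have "\<zeta> z * G (c / \<phi> z * w z) \<le> c ^ m * ?Gw" using \<phi>m True by (simp add: \<zeta>_def)
      then have "?t2 * (\<zeta> z * G (c / \<phi> z * w z)) \<le> 1 * (c ^ m * ?Gw)"
        using t2 \<zeta>_nonneg[of z] G_nonneg by (intro mult_mono[OF t2(2)]) auto
      moreover have "0 \<le> K1 - real m" using \<tau>(1) \<Lambda> q_gt_1 by (simp add: energy_const0_def)
      ultimately show "(K1 - real m) * (?t2 * (\<zeta> z * G (c / \<phi> z * w z))) \<le> (K1 - real m) * (1 * (c ^ m * ?Gw))"
        by (rule mult_left_mono)
    qed
    finally show ?thesis by simp
  qed
  have "real m * c ^ m * (w z)\<^sup>2 \<le> K1 * c ^ m * (w z)\<^sup>2"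
    using \<tau>(1) \<Lambda> q_gt_1 c by (intro mult_right_mono) (auto simp: energy_const0_def)
  moreover have "(K1 - real m) * c ^ m * ?Gw \<le> K1 * c ^ m * ?Gw"
    using c by (intro mult_right_mono) (auto simp: G_nonneg)
  ultimately show ?thesis unfolding Q_def Ez using 1 2 3 by (simp add: algebra_simps)
qed

lemma IQ_integral_le: "(\<integral>z. I t z * Q z \<partial>lborel) \<le> K1 * c ^ m * (\<integral>z. E z \<partial>lborel)"
proof -
  have "(\<integral>z. I t z * Q z \<partial>lborel) \<le> (\<integral>z. K1 * c ^ m * E z \<partial>lborel)"
  proof (rule integral_mono[OF energy_conv(1)])
    show "integrable lborel (\<lambda>z. K1 * c ^ m * E z)" using E_int by simp
    fix z
    have nn: "0 \<le> K1 * c ^ m * E z" using K1_nonneg c E_nonneg[of z] by simp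
    have "0 \<le> \<nu> / 2 * (trunc2 (U z - k) * \<zeta> z * G (norm (v z)))"
      using \<nu> trunc2_nonneg \<zeta>_nonneg G_nonneg by (intro mult_nonneg_nonneg) auto
    then have "Q z \<le> K1 * c ^ m * E z" using Q_pointwise[of z] by linarith
    then show "I t z * Q z \<le> K1 * c ^ m * E z" using nn by (cases "I t z = 0") (auto simp: I_def indicator_def split: if_splits)
  qed
  then show ?thesis by simp
qed

text \<open>The slice energies are nonnegative, hence so is the integral of \<open>Q\<close> over
  all times; the negative gradient term in \<open>Q_pointwise\<close> is therefore controlled by the
  rest.\<close>

lemma gradient_energy:
  "integrable lborel (\<lambda>z. trunc2 (U z - k) * \<zeta> z * G (norm (v z)))"
  "\<nu> / 2 * (\<integral>z. trunc2 (U z - k) * \<zeta> z * G (norm (v z)) \<partial>lborel) \<le> K1 * c ^ m * (\<integral>z. E z \<partial>lborel)"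
proof -
  have le1: "\<bar>trunc2 (U z - k) * \<zeta> z\<bar> \<le> 1 * 1" for z
    unfolding abs_mult using trunc2_nonneg[of "U z - k"] trunc2_le_1[of "U z - k"] \<zeta>_nonneg[of z] \<zeta>_le_1[of z] by (intro mult_mono) auto
  show i: "integrable lborel (\<lambda>z. trunc2 (U z - k) * \<zeta> z * G (norm (v z)))"
    using integrable_bounded_scaleR[OF Gv_int _ le1[simplified]] by simp
  \<comment> \<open>A time beyond the support of the cutoff, so that the half-space no longer cuts
    anything off.\<close>
  define t where "t = norm z0 + r"
  have IQ: "I t z * Q z = Q z" for z
  proof (cases "snd z \<le> t")
    case False
    then have "norm z > norm z0 + r" using norm_snd_le[of "snd z" "fst z"] by (simp add: t_def)
    then have z: "\<zeta> z = 0" by (rule \<zeta>_supp)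
    have "\<zeta>' z h = 0" for h by (rule has_derivative_zero_min[OF C1_fun_deriv[OF \<zeta>_C1] \<zeta>_nonneg z])
    then show ?thesis by (simp add: Q_def z)
  qed (simp add: I_def)
  have "0 \<le> (\<integral>z. I t z * Q z \<partial>lborel)" by (rule energy_Q_nonneg)
  also have "\<dots> \<le> (\<integral>z. K1 * c ^ m * E z - \<nu> / 2 * (trunc2 (U z - k) * \<zeta> z * G (norm (v z))) \<partial>lborel)"
  proof (rule integral_mono[OF energy_conv(1)])
    show "integrable lborel (\<lambda>z. K1 * c ^ m * E z - \<nu> / 2 * (trunc2 (U z - k) * \<zeta> z * G (norm (v z))))"
      using E_int i by auto
  qed (simp only: IQ Q_pointwise)
  also have "\<dots> = K1 * c ^ m * (\<integral>z. E z \<partial>lborel) - \<nu> / 2 * (\<integral>z. trunc2 (U z - k) * \<zeta> z * G (norm (v z)) \<partial>lborel)"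
    using E_int i by simp
  finally show "\<nu> / 2 * (\<integral>z. trunc2 (U z - k) * \<zeta> z * G (norm (v z)) \<partial>lborel) \<le> K1 * c ^ m * (\<integral>z. E z \<partial>lborel)" by simp
qed

text \<open>By convexity the weight \<open>trunc2 (U z - k) * \<zeta> z\<close>, being at most 1,
  can be pulled out of \<open>G\<close> linearly (\<open>G_shrink\<close>), which is the weight in
  \<open>gradient_energy\<close>.\<close>

lemma G_Df_le: "G (Df z) \<le> 2 powr q * (trunc2 (U z - k) * \<zeta> z * G (norm (v z)) + real m powr q * c ^ m * E z)"
proof -
  have t: "0 \<le> trunc2 (U z - k) * \<zeta> z" "trunc2 (U z - k) * \<zeta> z \<le> 1"
    using mult_mono[OF trunc2_le_1[of "U z - k"] \<zeta>_le_1[of z]] trunc2_nonneg[of "U z - k"] \<zeta>_nonneg[of z] by auto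
  have mc: "real m * c \<ge> 1" using m c mult_mono[of 1 "real m" 1 c] by simp
  have "G (Df z) \<le> 2 powr q * (G (trunc2 (U z - k) * \<zeta> z * norm (v z)) + G (real m * c * (\<phi> z ^ (m - 1) * trunc1 (U z - k))))"
    unfolding Df_def using t mc \<phi>_range trunc1_nonneg[of "U z - k"] by (intro G_sum) auto
  also have "\<dots> \<le> 2 powr q * (trunc2 (U z - k) * \<zeta> z * G (norm (v z)) + real m powr q * c ^ m * E z)"
  proof (intro mult_left_mono add_mono)
    show "G (trunc2 (U z - k) * \<zeta> z * norm (v z)) \<le> trunc2 (U z - k) * \<zeta> z * G (norm (v z))"
      by (rule G_shrink[OF t]) simp
    show "G (real m * c * (\<phi> z ^ (m - 1) * trunc1 (U z - k))) \<le> real m powr q * c ^ m * E z"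
    proof (cases "\<phi> z > 0")
      case False
      then have "\<phi> z = 0" using \<phi>_range(1)[of z] by simp
      moreover have "m - 1 \<noteq> 0" using m by auto
      ultimately show ?thesis by (simp add: G_zero E_def power_0_left)
    next
      case True
      have "\<phi> z ^ (m - 1) * trunc1 (U z - k) \<le> 1 * w z"
        using \<phi>_range trunc1_nonneg[of "U z - k"] trunc1_le[of "U z - k"] by (intro mult_mono power_le_one) (auto simp: w_def)
      then have "G (real m * c * (\<phi> z ^ (m - 1) * trunc1 (U z - k))) \<le> G (real m * c * w z)"
        using mc by (intro G_mono mult_left_mono) auto
      also have "\<dots> \<le> (real m * c) powr q * G (w z)" by (rule G_scale_upper[OF mc w_nonneg])
      also have "\<dots> = real m powr q * c powr q * G (w z)" using c by (simp add: powr_mult)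
      also have "\<dots> \<le> real m powr q * c ^ m * E z"
        using c_powr_le True c by (intro mult_mono) (auto simp: E_def G_nonneg)
      finally show ?thesis .
    qed
  qed simp
  finally show ?thesis .
qed

theorem energy_estimate:
  defines "Z \<equiv> energy_const q \<nu> \<Lambda> m * c ^ m * (\<integral>z. E z \<partial>lborel)"
  shows "AE t in lborel. (\<integral>\<^sup>+x. ennreal ((f (x, t))\<^sup>2) \<partial>lborel) \<le> ennreal Z"
    and "h > 0 \<Longrightarrow> norm y \<le> h \<Longrightarrow> (\<integral>\<^sup>+z. G (\<bar>f (z + (y, 0)) - f z\<bar> / h) \<partial>lborel) \<le> ennreal Z"
proof -
  define Y where "Y = c ^ m * (\<integral>z. E z \<partial>lborel)"
  have Y: "Y \<ge> 0" unfolding Y_def using c E_nonneg by (intro mult_nonneg_nonneg Bochner_Integration.integral_nonneg) auto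
  have Zeq: "Z = 2 * (K1 * Y) + 2 powr q * (2 / \<nu> * (K1 * Y) + real m powr q * Y)"
    by (simp add: Z_def energy_const_def Y_def algebra_simps)
  have a: "2 * (K1 * Y) \<le> Z" unfolding Zeq using K1_nonneg Y \<nu> by simp
  have b: "2 powr q * (2 / \<nu> * (K1 * Y) + real m powr q * Y) \<le> Z" unfolding Zeq using K1_nonneg Y by simp
  show "AE t in lborel. (\<integral>\<^sup>+x. ennreal ((f (x, t))\<^sup>2) \<partial>lborel) \<le> ennreal Z"
    using energy_slice
  proof eventually_elim
    case (elim t)
    have "(\<integral>\<^sup>+x. ennreal ((f (x, t))\<^sup>2) \<partial>lborel) \<le> (\<integral>\<^sup>+x. 2 * ennreal (trunc0 (U (x, t) - k) * \<zeta> (x, t)) \<partial>lborel)"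
    proof (rule nn_integral_mono)
      fix x
      have "(f (x, t))\<^sup>2 = (trunc1 (U (x, t) - k))\<^sup>2 * (\<zeta> (x, t) * \<zeta> (x, t))" by (simp add: f_def power_mult_distrib power2_eq_square)
      also have "\<dots> \<le> (2 * trunc0 (U (x, t) - k)) * (1 * \<zeta> (x, t))"
        using trunc1_square[of "U (x, t) - k"] \<zeta>_nonneg[of "(x, t)"] \<zeta>_le_1[of "(x, t)"] trunc0_nonneg[of "U (x, t) - k"] by (intro mult_mono) auto
      finally have "ennreal ((f (x, t))\<^sup>2) \<le> ennreal (2 * (trunc0 (U (x, t) - k) * \<zeta> (x, t)))" by (intro ennreal_leI) simp
      then show "ennreal ((f (x, t))\<^sup>2) \<le> 2 * ennreal (trunc0 (U (x, t) - k) * \<zeta> (x, t))"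
        by (simp add: ennreal_mult')
    qed
    also have "\<dots> = 2 * (\<integral>\<^sup>+x. ennreal (trunc0 (U (x, t) - k) * \<zeta> (x, t)) \<partial>lborel)"
      by (rule nn_integral_cmult) measurable
    also have "\<dots> \<le> 2 * ennreal (K1 * Y)"
      using order_trans[OF elim ennreal_leI[OF IQ_integral_le]] by (intro mult_left_mono) (auto simp: Y_def mult.assoc)
    also have "\<dots> = ennreal (2 * (K1 * Y))" by (simp add: ennreal_mult')
    also have "\<dots> \<le> ennreal Z" by (rule ennreal_leI[OF a])
    finally show ?case .
  qed
  assume h: "h > 0" and y: "norm y \<le> h"
  have "(\<integral>z. G (Df z) \<partial>lborel) \<le> (\<integral>z. 2 powr q * (trunc2 (U z - k) * \<zeta> z * G (norm (v z)) + real m powr q * c ^ m * E z) \<partial>lborel)"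
    by (rule integral_mono[OF modular_conv(1) _ G_Df_le]) (use E_int gradient_energy(1) in auto)
  also have "\<dots> = 2 powr q * ((\<integral>z. trunc2 (U z - k) * \<zeta> z * G (norm (v z)) \<partial>lborel) + real m powr q * Y)"
    using E_int gradient_energy(1) by (simp add: Y_def mult.assoc)
  also have "\<dots> \<le> 2 powr q * (2 / \<nu> * (K1 * Y) + real m powr q * Y)"
  proof (intro mult_left_mono add_mono)
    show "(\<integral>z. trunc2 (U z - k) * \<zeta> z * G (norm (v z)) \<partial>lborel) \<le> 2 / \<nu> * (K1 * Y)"
      using gradient_energy(2) \<nu> by (simp add: Y_def field_simps)
  qed auto
  also have "\<dots> \<le> Z" by (rule b)
  finally have "ennreal (\<integral>z. G (Df z) \<partial>lborel) \<le> ennreal Z" by (rule ennreal_leI)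
  with translation_estimate[OF h y] show "(\<integral>\<^sup>+z. G (\<bar>f (z + (y, 0)) - f z\<bar> / h) \<partial>lborel) \<le> ennreal Z"
    by (rule order_trans)
qed

end

text \<open>The preimage of a null set of times is null in space-time, so a slice bound valid for
  almost every time may be used at almost every point.\<close>

lemma AE_lborel_snd:
  assumes "AE t in (lborel :: 'b::euclidean_space measure). P t"
  shows "AE z in (lborel :: ('a::euclidean_space \<times> 'b) measure). P (snd z)"
proof -
  obtain N where N: "{t. \<not> P t} \<subseteq> N" "emeasure lborel N = 0" "N \<in> sets lborel"
    using AE_E[OF assms] by auto
  then have [measurable]: "N \<in> sets borel" by simp
  have ae: "AE t in lborel. t \<notin> N" using N by (intro AE_not_in) auto
  have [measurable]: "snd -` N \<in> sets (borel :: ('a \<times> 'b) measure)"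
    using measurable_sets[of snd borel borel N] by (simp add: borel_measurable_continuous_onI continuous_on_snd)
  have "emeasure lborel (snd -` N :: ('a \<times> 'b) set) = (\<integral>\<^sup>+z. indicator (snd -` N) z \<partial>(lborel :: ('a \<times> 'b) measure))"
    by simp
  also have "\<dots> = (\<integral>\<^sup>+t. \<integral>\<^sup>+x. indicator (snd -` N) (x, t) \<partial>(lborel :: 'a measure) \<partial>lborel)"
    by (rule nn_integral_lborel_Pair[symmetric]) measurable
  also have "\<dots> = (\<integral>\<^sup>+t. 0 \<partial>(lborel :: 'b measure))"
    by (rule nn_integral_cong_AE, use ae in eventually_elim) (simp add: indicator_def)
  finally have "snd -` N \<in> null_sets (lborel :: ('a \<times> 'b) measure)" by auto
  then have "AE z in (lborel :: ('a \<times> 'b) measure). z \<notin> snd -` N" by (rule AE_not_in)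
  then show ?thesis by eventually_elim (use N in auto)
qed

text \<open>A weak-type Nash inequality: at a point where \<open>f > l\<close>, Chebyshev's inequality forces
  \<open>f \<le> l / 2\<close> on half of the ball of radius \<open>h\<close> around it, so the difference quotients of
  order \<open>h\<close> control the level set.\<close>

lemma (in orlicz) level_set_estimate:
  fixes f :: "'a::euclidean_space \<times> real \<Rightarrow> real"
  assumes [measurable]: "f \<in> borel_measurable borel" and f: "\<And>z. f z \<ge> 0"
    and slice: "AE t in lborel. (\<integral>\<^sup>+x. ennreal ((f (x, t))\<^sup>2) \<partial>lborel) \<le> ennreal Z"
    and trans: "\<And>y. norm y \<le> h \<Longrightarrow> (\<integral>\<^sup>+z. G (\<bar>f (z + (y, 0)) - f z\<bar> / h) \<partial>lborel) \<le> ennreal Z"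
    and h: "h > 0" and l: "l > 0" and Z: "Z \<ge> 0"
    and big: "8 * Z \<le> l\<^sup>2 * measure lborel (ball (0::'a) h)"
  shows "ennreal (G (l / (2 * h))) * emeasure lborel {z. f z > l} \<le> ennreal (2 * Z)"
proof -
  define B where "B = ball (0::'a) h"
  define b where "b = measure lborel B"
  define GG where "GG = G (l / (2 * h))"
  have b: "b > 0" unfolding b_def B_def using h by simp
  have [measurable]: "B \<in> sets borel" by (simp add: B_def)
  have eB: "emeasure lborel B = ennreal b"
    unfolding b_def B_def by (rule emeasure_eq_ennreal_measure) (use emeasure_lborel_ball_finite[of "0::'a" h] in auto)
  have key: "ennreal (b / 2 * GG) \<le> (\<integral>\<^sup>+y. indicator B y * ennreal (G (\<bar>f (z + (y, 0)) - f z\<bar> / h)) \<partial>lborel)"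
    if z: "f z > l" and gd: "(\<integral>\<^sup>+x. ennreal ((f (x, snd z))\<^sup>2) \<partial>lborel) \<le> ennreal Z" for z
  proof -
    define W where "W = {y. f (z + (y, 0)) > l / 2}"
    have [measurable]: "W \<in> sets borel" unfolding W_def by measurable
    have "ennreal (l\<^sup>2 / 4) * emeasure lborel W = (\<integral>\<^sup>+y. ennreal (l\<^sup>2 / 4) * indicator W y \<partial>lborel)"
      by (simp add: nn_integral_cmult_indicator)
    also have "\<dots> \<le> (\<integral>\<^sup>+y. ennreal ((f (y + fst z, snd z))\<^sup>2) \<partial>lborel)"
    proof (rule nn_integral_mono)
      fix y :: 'a
      have "z + (y, 0) = (y + fst z, snd z)" by (simp add: prod_eq_iff add.commute)
      moreover have "l\<^sup>2 / 4 \<le> (f (z + (y, 0)))\<^sup>2" if "y \<in> W"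
        using power_mono[of "l / 2" "f (z + (y, 0))" 2] that l by (simp add: W_def power_divide)
      ultimately show "ennreal (l\<^sup>2 / 4) * indicator W y \<le> ennreal ((f (y + fst z, snd z))\<^sup>2)"
        by (auto simp: indicator_def intro!: ennreal_leI)
    qed
    also have "\<dots> = (\<integral>\<^sup>+x. ennreal ((f (x, snd z))\<^sup>2) \<partial>lborel)"
      using nn_integral_lborel_translation[of "\<lambda>x. ennreal ((f (x, snd z))\<^sup>2)" "fst z"] by simp
    also note gd
    finally have W: "ennreal (l\<^sup>2 / 4) * emeasure lborel W \<le> ennreal Z" .
    then have Wfin: "emeasure lborel W < \<infinity>"
      using l by (auto simp: less_top[symmetric] ennreal_mult_eq_top_iff top_unique)
    have "l\<^sup>2 / 4 * measure lborel W \<le> Z"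
      using W Wfin l Z by (simp add: emeasure_eq_ennreal_measure less_top flip: ennreal_mult')
    \<comment> \<open>Chebyshev at height l/2 gives measure at most 4Z/l^2, and the factor 8 in
      \<open>big\<close> makes this at most half of the ball.\<close>
    then have "l\<^sup>2 * measure lborel W \<le> l\<^sup>2 * (b / 2)"
      using big by (simp add: b_def B_def)
    then have mW: "measure lborel W \<le> b / 2" using l by simp
    have "b \<le> measure lborel (B - W) + measure lborel W"
    proof -
      have "b \<le> measure lborel ((B - W) \<union> W)"
        unfolding b_def
      proof (rule measure_mono_fmeasurable)
        show "(B - W) \<union> W \<in> fmeasurable lborel"
          using eB Wfin by (intro fmeasurable.Un fmeasurable_Diff fmeasurableI) auto
      qed auto
      also have "\<dots> \<le> measure lborel (B - W) + measure lborel W"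
        by (rule measure_Un_le) auto
      finally show ?thesis .
    qed
    then have mBW: "b / 2 \<le> measure lborel (B - W)" using mW by simp
    have fBW: "emeasure lborel (B - W) < \<infinity>"
      using emeasure_mono[of "B - W" B lborel] eB by (auto simp: less_top[symmetric] top_unique)
    have "ennreal (b / 2 * GG) \<le> ennreal (measure lborel (B - W) * GG)"
      using mBW by (intro ennreal_leI mult_right_mono) (auto simp: GG_def G_nonneg)
    also have "\<dots> = (\<integral>\<^sup>+y. ennreal GG * indicator (B - W) y \<partial>lborel)"
    proof -
      have "ennreal (measure lborel (B - W)) = emeasure lborel (B - W)"
        using fBW by (intro emeasure_eq_ennreal_measure[symmetric]) auto
      then show ?thesis
        by (subst nn_integral_cmult_indicator) (auto simp: ennreal_mult'' GG_def G_nonneg mult.commute)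
    qed
    also have "\<dots> \<le> (\<integral>\<^sup>+y. indicator B y * ennreal (G (\<bar>f (z + (y, 0)) - f z\<bar> / h)) \<partial>lborel)"
    proof (rule nn_integral_mono)
      fix y
      have "GG \<le> G (\<bar>f (z + (y, 0)) - f z\<bar> / h)" if "y \<notin> W"
      proof -
        have "l / 2 \<le> \<bar>f (z + (y, 0)) - f z\<bar>" using that z abs_ge_minus_self[of "f (z + (y, 0)) - f z"] by (simp add: W_def)
        then have "l / (2 * h) \<le> \<bar>f (z + (y, 0)) - f z\<bar> / h" using h by (simp add: field_simps)
        then show ?thesis unfolding GG_def by (rule G_mono)
      qed
      then show "ennreal GG * indicator (B - W) y \<le> indicator B y * ennreal (G (\<bar>f (z + (y, 0)) - f z\<bar> / h))"
        by (auto simp: indicator_def intro!: ennreal_leI)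
    qed
    finally show ?thesis .
  qed
  have "ennreal (b / 2 * GG) * emeasure lborel {z. f z > l} = (\<integral>\<^sup>+z. ennreal (b / 2 * GG) * indicator {z. f z > l} z \<partial>lborel)"
    by (rule nn_integral_cmult_indicator[symmetric]) measurable
  also have "\<dots> \<le> (\<integral>\<^sup>+z. \<integral>\<^sup>+y. indicator B y * ennreal (G (\<bar>f (z + (y, 0)) - f z\<bar> / h)) \<partial>lborel \<partial>lborel)"
    by (rule nn_integral_mono_AE, use AE_lborel_snd[OF slice] in eventually_elim) (use key in \<open>auto simp: indicator_def\<close>)
  \<comment> \<open>Exchanging the order of integration leaves, for each shift in the ball, the
    translation bound \<open>trans\<close>.\<close>
  also have "\<dots> = (\<integral>\<^sup>+y. \<integral>\<^sup>+z. indicator B y * ennreal (G (\<bar>f (z + (y, 0)) - f z\<bar> / h)) \<partial>lborel \<partial>lborel)"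
    by (rule lborel_pair.Fubini'[symmetric]) measurable
  also have "\<dots> = (\<integral>\<^sup>+y. indicator B y * (\<integral>\<^sup>+z. ennreal (G (\<bar>f (z + (y, 0)) - f z\<bar> / h)) \<partial>lborel) \<partial>lborel)"
    by (intro nn_integral_cong nn_integral_cmult) measurable
  also have "\<dots> \<le> (\<integral>\<^sup>+y. ennreal Z * indicator B y \<partial>lborel)"
    using trans by (intro nn_integral_mono) (auto simp: indicator_def B_def)
  also have "\<dots> = ennreal (b * Z)"
    using b Z by (simp add: nn_integral_cmult_indicator eB ennreal_mult' mult.commute)
  finally have "ennreal (2 / b) * (ennreal (b / 2 * GG) * emeasure lborel {z. f z > l}) \<le> ennreal (2 / b) * ennreal (b * Z)"
    by (rule mult_left_mono) simp
  moreover have "ennreal (2 / b) * ennreal (b / 2 * GG) = ennreal GG" "ennreal (2 / b) * ennreal (b * Z) = ennreal (2 * Z)"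
    using b by (simp_all flip: ennreal_mult')
  ultimately show ?thesis unfolding GG_def by (simp flip: mult.assoc)
qed

subsection \<open>The De Giorgi iteration\<close>

lemma ennreal_le_divide:
  assumes "ennreal a * X \<le> ennreal b" "a > 0" "b \<ge> 0"
  shows "X \<le> ennreal (b / a)"
proof -
  have "ennreal (1 / a) * (ennreal a * X) \<le> ennreal (1 / a) * ennreal b"
    by (rule mult_left_mono[OF assms(1)]) simp
  moreover have "ennreal (1 / a) * ennreal a = 1" using assms by (simp flip: ennreal_mult')
  moreover have "ennreal (1 / a) * ennreal b = ennreal (b / a)" using assms by (simp flip: ennreal_mult')
  ultimately show ?thesis by (simp flip: mult.assoc)
qed

lemma dyadic_interval:
  fixes w d :: real
  assumes "0 < d" "d < w"
  obtains i :: nat where "2 ^ i * d < w" "w \<le> 2 ^ Suc i * d"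
proof -
  define P where "P j \<longleftrightarrow> w \<le> 2 ^ j * d" for j :: nat
  obtain j0 where "w / d < 2 ^ j0" using real_arch_pow[of 2 "w / d"] by auto
  then have ex: "P j0" using assms by (simp add: P_def field_simps)
  define j where "j = (LEAST j. P j)"
  have Pj: "P j" unfolding j_def by (rule LeastI[of P, OF ex])
  have "j \<noteq> 0"
  proof
    assume "j = 0" then show False using Pj assms by (simp add: P_def)
  qed
  then obtain i where i: "j = Suc i" using not0_implies_Suc by blast
  then have "\<not> P i" using not_less_Least[of i P] by (simp add: j_def)
  then show ?thesis using that[of i] Pj by (simp add: P_def i)
qed

section \<open>One De Giorgi step\<close>

context orlicz
begin

text \<open>For levels above 1 the choice of \<beta> leaves a genuine gain, a negative power of
  \<open>l\<close>: it is subtracted from p(1 + 2/n) - 2 for the square and from 2p/n for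
  \<open>G\<close>. Levels below 1 lie above \<open>d\<close>, so there the lower bound by the power
  \<open>q\<close> of \<open>G\<close> costs only a power of \<open>d\<close>.\<close>

lemma dyadic_ratio:
  fixes n d :: real and i :: nat
  assumes n: "n > 0" and d: "0 < d" "d \<le> 1"
    and \<beta>: "0 < \<beta>" "\<beta> \<le> p * (1 + 2 / n) - 2" "\<beta> \<le> 2 * p / n"
  defines "l \<equiv> 2 ^ i * d"
  shows "4 * l\<^sup>2 + 2 powr q * G l \<le> (4 + 2 powr q) * (l powr (- \<beta>) * d powr (- (q * (1 + 2 / n)))) * G (l powr (1 + 2 / n))"
proof -
  define a where "a = 1 + 2 / n"
  have a: "a > 0" using n by (simp add: a_def add_pos_pos)
  have l: "l > 0" using d by (simp add: l_def)
  have dl: "d \<le> l" using d by (simp add: l_def)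
  have qa: "q * a > 0" using q_gt_1 a by simp
  define X where "X = l powr (- \<beta>) * d powr (- (q * a)) * G (l powr a)"
  have "l\<^sup>2 \<le> X \<and> G l \<le> X"
  proof (cases "l \<ge> 1")
    case True
    have d1: "1 \<le> d powr (- (q * a))"
      using powr_mono2'[of "- (q * a)" d 1] d qa by simp
    have X: "l powr (- \<beta>) * G (l powr a) \<le> X"
      unfolding X_def using mult_right_mono[OF d1, of "l powr (- \<beta>) * G (l powr a)"] G_nonneg by (simp add: mult_ac)
    have la: "l powr a \<ge> 1" using True a by (simp add: ge_one_powr_ge_zero)
    have "l\<^sup>2 = l powr 2" using l by (simp add: powr_numeral)
    also have "\<dots> \<le> l powr (- \<beta> + a * p)" using True \<beta> by (intro powr_mono) (auto simp: a_def mult.commute)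
    also have "\<dots> = l powr (- \<beta>) * (l powr a) powr p" by (simp only: powr_add powr_powr)
    also have "\<dots> \<le> l powr (- \<beta>) * G (l powr a)" using G_ge_powr[OF la] by (intro mult_left_mono) auto
    finally have 1: "l\<^sup>2 \<le> X" using X by simp
    have "l powr 0 \<le> l powr (- \<beta> + 2 / n * p)" using True \<beta> by (intro powr_mono) (auto simp: mult.commute)
    moreover have "l powr (- \<beta> + 2 / n * p) = l powr (- \<beta>) * (l powr (2 / n)) powr p" by (simp only: powr_add powr_powr)
    ultimately have "1 \<le> l powr (- \<beta>) * (l powr (2 / n)) powr p" using l by simp
    from mult_right_mono[OF this G_nonneg[of l]]
    have "G l \<le> l powr (- \<beta>) * ((l powr (2 / n)) powr p * G l)" by simp
    also have "\<dots> \<le> l powr (- \<beta>) * G (l powr (2 / n) * l)"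
      using True n l by (intro mult_left_mono G_scale_lower ge_one_powr_ge_zero) auto
    also have "l powr (2 / n) * l = l powr a" using l by (simp add: a_def powr_add)
    finally show ?thesis using 1 X by simp
  next
    case False
    have "1 \<le> l powr (- \<beta>)" using powr_mono2'[of "- \<beta>" l 1] l False \<beta> by simp
    moreover have "1 \<le> d powr (- (q * a)) * G (l powr a)"
    proof -
      have "l powr a \<le> 1" using powr_mono2[of a l 1] l False a by simp
      have "d powr (q * a) \<le> l powr (q * a)" using d dl qa by (intro powr_mono2) auto
      also have "\<dots> = (l powr a) powr q" by (simp add: powr_powr mult.commute)
      also have "\<dots> \<le> G (l powr a)" using \<open>l powr a \<le> 1\<close> l by (intro G_ge_powr_small) auto
      finally have "d powr (- (q * a)) * d powr (q * a) \<le> d powr (- (q * a)) * G (l powr a)" by (intro mult_left_mono) auto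
      then show ?thesis using d by (simp flip: powr_add)
    qed
    ultimately have "1 * 1 \<le> l powr (- \<beta>) * (d powr (- (q * a)) * G (l powr a))" by (rule mult_mono) (auto simp: G_nonneg)
    then have X: "1 \<le> X" by (simp add: X_def mult.assoc)
    have "l\<^sup>2 \<le> 1" using l False by (simp add: power_le_one)
    moreover have "G l \<le> 1" using G_mono[of l 1] False by (simp add: G_one)
    ultimately show ?thesis using X by simp
  qed
  then have "4 * l\<^sup>2 + 2 powr q * G l \<le> 4 * X + 2 powr q * X" by (intro add_mono mult_left_mono) auto
  then show ?thesis by (simp add: X_def a_def algebra_simps)
qed

text \<open>Layer by layer: \<open>w\<close> above the dyadic level \<open>l i\<close> forces
  \<open>f\<close> above \<open>l i * d / 4\<close>, and \<open>level_set_estimate\<close> bounds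
  the measure of that set. The radius \<open>h\<close> depends on the level and on \<open>Z\<close>,
  which produces the superlinear power of \<open>Z\<close>; the sum over levels is geometric by
  \<open>dyadic_ratio\<close>.\<close>

lemma degiorgi_step:
  assumes pn: "2 * real DIM('a) / (real DIM('a) + 2) < p"
  shows "\<exists>C \<gamma> \<kappa>. 0 < C \<and> 0 < \<gamma> \<and> 0 < \<kappa> \<and>
    (\<forall>(f :: 'a::euclidean_space \<times> real \<Rightarrow> real) w S d Z. f \<in> borel_measurable borel \<longrightarrow> w \<in> borel_measurable borel \<longrightarrow> S \<in> sets borel \<longrightarrow>
      (\<forall>z. f z \<ge> 0) \<longrightarrow> 0 < d \<longrightarrow> d \<le> 1 \<longrightarrow> 0 < Z \<longrightarrow>
      (AE t in lborel. (\<integral>\<^sup>+x. ennreal ((f (x, t))\<^sup>2) \<partial>lborel) \<le> ennreal Z) \<longrightarrow>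
      (\<forall>y h. 0 < h \<longrightarrow> norm y \<le> h \<longrightarrow> (\<integral>\<^sup>+z. G (\<bar>f (z + (y, 0)) - f z\<bar> / h) \<partial>lborel) \<le> ennreal Z) \<longrightarrow>
      (\<forall>z\<in>S. d \<le> w z \<longrightarrow> w z * d / 4 \<le> f z) \<longrightarrow>
      Z powr (1 / real DIM('a)) \<le> \<kappa> * d powr (1 + 2 / real DIM('a)) \<longrightarrow>
      (\<integral>\<^sup>+z. indicator S z * ennreal ((max 0 (w z - d))\<^sup>2 + G (max 0 (w z - d))) \<partial>lborel)
        \<le> ennreal (C * d powr (- \<gamma>) * Z powr (1 + p / real DIM('a))))"
proof -
  define n where "n = real DIM('a)"
  have n: "n > 0" by (simp add: n_def)
  define a where "a = 1 + 2 / n"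
  have a: "a > 0" using n by (simp add: a_def add_pos_pos)
  define \<beta> where "\<beta> = min (p * a - 2) (2 * p / n)"
  \<comment> \<open>A reformulation of \<open>pn\<close>: the critical exponent is the one for which
    the gain \<beta> would be zero.\<close>
  have "2 < p * a" using pn n by (simp add: a_def field_simps flip: n_def)
  then have \<beta>: "0 < \<beta>" "\<beta> \<le> p * (1 + 2 / n) - 2" "\<beta> \<le> 2 * p / n" using n p_gt_1 by (auto simp: \<beta>_def a_def)
  define \<rho> where "\<rho> = 2 powr (- \<beta>)"
  have \<rho>: "0 < \<rho>" "\<rho> < 1" using \<beta>(1) by (auto simp: \<rho>_def powr_less_one)
  define vb where "vb = unit_ball_vol n"
  have vb: "vb > 0" by (simp add: vb_def n_def)
  define \<kappa> where "\<kappa> = 1 / 2 * (vb / 8) powr (1 / n) * (1 / 4) powr a"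
  have \<kappa>: "\<kappa> > 0" using vb by (simp add: \<kappa>_def)
  define C where "C = 2 * \<kappa> powr (- p) * (4 + 2 powr q) / (1 - \<rho>)"
  have C: "C > 0" using \<kappa> \<rho> by (simp add: C_def add_pos_pos)
  \<comment> \<open>The power \<open>p * a\<close> comes from \<theta>, \<open>q * a\<close> from
    small levels in \<open>dyadic_ratio\<close>, and \<beta> from writing \<open>l i\<close> as a
    multiple of \<open>d\<close>.\<close>
  define \<gamma> where "\<gamma> = p * a + q * a + \<beta>"
  have \<gamma>: "\<gamma> > 0" using p_gt_1 q_gt_1 a \<beta> by (simp add: \<gamma>_def add_pos_pos)
  show ?thesis
  proof (rule exI[of _ C], rule exI[of _ \<gamma>], rule exI[of _ \<kappa>], intro conjI C \<gamma> \<kappa> allI impI, fold n_def, fold a_def)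
    fix f w :: "'a \<times> real \<Rightarrow> real" and S :: "('a \<times> real) set" and d Z :: real
    assume [measurable]: "f \<in> borel_measurable borel" "w \<in> borel_measurable borel" "S \<in> sets borel"
    assume f: "\<forall>z. f z \<ge> 0" and d: "0 < d" "d \<le> 1" and Z: "0 < Z"
      and slice: "AE t in lborel. (\<integral>\<^sup>+x. ennreal ((f (x, t))\<^sup>2) \<partial>lborel) \<le> ennreal Z"
      and trans: "\<forall>y h. 0 < h \<longrightarrow> norm y \<le> h \<longrightarrow> (\<integral>\<^sup>+z. G (\<bar>f (z + (y, 0)) - f z\<bar> / h) \<partial>lborel) \<le> ennreal Z"
      and wf: "\<forall>z\<in>S. d \<le> w z \<longrightarrow> w z * d / 4 \<le> f z"
      and small: "Z powr (1 / n) \<le> \<kappa> * d powr a"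
    \<comment> \<open>The factor by which the difference quotient \<open>s / (2 * h)\<close> exceeds
      \<open>l i powr a\<close>, the same for all levels. The smallness assumption says exactly that
      it is at least 1, so scaling extracts its power \<open>p\<close> from
      \<open>G\<close>.\<close>
    define \<theta> where "\<theta> = \<kappa> * d powr a * Z powr (- (1 / n))"
    have \<theta>: "\<theta> \<ge> 1"
    proof -
      have "Z powr (1 / n) * Z powr (- (1 / n)) \<le> \<theta>" unfolding \<theta>_def by (rule mult_right_mono[OF small]) simp
      then show ?thesis using Z by (simp flip: powr_add)
    qed
    define l where "l i = 2 ^ i * d" for i :: nat
    have l: "l i > 0" "l i \<ge> d" for i using d by (auto simp: l_def)
    define \<Phi> where "\<Phi> s = s\<^sup>2 + G s" for s
    \<comment> \<open>The constants 4 and \<open>2 powr q\<close> come from replacing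
      \<open>2 * l i\<close>, the upper end of the dyadic layer, by \<open>l i\<close>.\<close>
    define T where "T i = (4 * (l i)\<^sup>2 + 2 powr q * G (l i))" for i
    have T0: "T i \<ge> 0" for i by (auto simp: T_def G_nonneg)
    have level: "emeasure lborel {z \<in> S. w z > l i} \<le> ennreal (2 * Z / (\<theta> powr p * G (l i powr a)))" for i
    proof -
      define s where "s = l i * d / 4"
      have s: "s > 0" using l(1)[of i] d by (simp add: s_def)
      \<comment> \<open>The smallest radius allowed by \<open>level_set_estimate\<close>: the
        condition 8Z <= s^2 |B| holds with equality.\<close>
      define h where "h = (8 * Z / (vb * s\<^sup>2)) powr (1 / n)"
      have h: "h > 0" using Z vb s by (simp add: h_def)
      have hn: "h ^ DIM('a) = 8 * Z / (vb * s\<^sup>2)"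
      proof -
        have "h ^ DIM('a) = h powr n" using h by (simp add: n_def powr_realpow)
        also have "\<dots> = 8 * Z / (vb * s\<^sup>2)" using Z vb s n by (simp add: h_def powr_powr)
        finally show ?thesis .
      qed
      have ball: "measure lborel (ball (0::'a) h) = vb * h ^ DIM('a)"
        using content_ball[of h "0::'a"] h by (simp add: vb_def n_def)
      have "ennreal (G (s / (2 * h))) * emeasure lborel {z. f z > s} \<le> ennreal (2 * Z)"
      proof (rule level_set_estimate[OF _ _ slice _ h s])
        show "8 * Z \<le> s\<^sup>2 * measure lborel (ball (0::'a) h)" unfolding ball hn using vb s by simp
      qed (use f trans h Z in auto)
      moreover have "s / (2 * h) = \<theta> * l i powr a"
      proof -
        have "1 / h = (vb * s\<^sup>2 / (8 * Z)) powr (1 / n)"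
          using Z vb s by (simp add: h_def powr_divide)
        also have "\<dots> = (vb / 8 * (s\<^sup>2 * (1 / Z))) powr (1 / n)" by simp
        also have "\<dots> = (vb / 8) powr (1 / n) * ((s\<^sup>2) powr (1 / n) * (1 / Z) powr (1 / n))"
          using Z vb s by (simp only: powr_mult)
        also have "(s\<^sup>2) powr (1 / n) = s powr (2 / n)"
          using s by (simp add: powr_powr flip: powr_numeral)
        also have "(1 / Z) powr (1 / n) = Z powr (- (1 / n))" using Z by (simp add: powr_divide powr_minus_divide)
        finally have h_inv: "1 / h = (vb / 8) powr (1 / n) * (s powr (2 / n) * Z powr (- (1 / n)))" .
        have "s / (2 * h) = 1 / 2 * s * (1 / h)" by simp
        then have "s / (2 * h) = 1 / 2 * (vb / 8) powr (1 / n) * (s * s powr (2 / n)) * Z powr (- (1 / n))"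
          unfolding h_inv by simp
        also have "s * s powr (2 / n) = s powr a" using s by (simp add: a_def powr_add)
        also have "s powr a = (1 / 4) powr a * d powr a * l i powr a"
        proof -
          have "s = (1 / 4 * d) * l i" by (simp add: s_def)
          then show ?thesis using d l(1)[of i] by (simp only: powr_mult)
        qed
        finally show ?thesis by (simp add: \<theta>_def \<kappa>_def)
      qed
      ultimately have "ennreal (G (\<theta> * l i powr a)) * emeasure lborel {z. f z > s} \<le> ennreal (2 * Z)" by simp
      moreover have "ennreal (\<theta> powr p * G (l i powr a)) \<le> ennreal (G (\<theta> * l i powr a))"
        using \<theta> by (intro ennreal_leI G_scale_lower) auto
      ultimately have "ennreal (\<theta> powr p * G (l i powr a)) * emeasure lborel {z. f z > s} \<le> ennreal (2 * Z)"
        by (meson mult_right_mono order_trans zero_le)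
      then have le: "emeasure lborel {z. f z > s} \<le> ennreal (2 * Z / (\<theta> powr p * G (l i powr a)))"
        using \<theta> Z l(1)[of i] by (intro ennreal_le_divide) (auto intro!: mult_pos_pos G_pos)
      have "emeasure lborel {z \<in> S. w z > l i} \<le> emeasure lborel {z. f z > s}"
      proof (rule emeasure_mono)
        show "{z \<in> S. w z > l i} \<subseteq> {z. f z > s}"
        proof
          fix z assume z: "z \<in> {z \<in> S. w z > l i}"
          then have "w z * d / 4 \<le> f z" using wf l(2)[of i] by auto
          moreover have "s < w z * d / 4" using z d by (simp add: s_def)
          ultimately show "z \<in> {z. f z > s}" by simp
        qed
      qed measurable
      with le show ?thesis by (rule order_trans[rotated])
    qed
    have pw: "indicator S z * ennreal ((max 0 (w z - d))\<^sup>2 + G (max 0 (w z - d))) \<le> (\<Sum>i. ennreal (T i) * indicator {z \<in> S. w z > l i} z)" for z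
    proof (cases "z \<in> S \<and> d < w z")
      case False
      then have "max 0 (w z - d) = 0 \<or> z \<notin> S" by auto
      then show ?thesis by (auto simp: G_zero)
    next
      case True
      \<comment> \<open>The single term of the layer containing \<open>w z\<close> already dominates
        the integrand.\<close>
      obtain i where i: "2 ^ i * d < w z" "w z \<le> 2 ^ Suc i * d" using dyadic_interval[OF d(1)] True by blast
      have hle: "max 0 (w z - d) \<le> 2 * l i" using True i d by (auto simp: l_def)
      have le: "(max 0 (w z - d))\<^sup>2 \<le> (2 * l i)\<^sup>2" "G (max 0 (w z - d)) \<le> G (2 * l i)"
        by (rule power_mono[OF hle], simp) (rule G_mono[OF hle])
      have "G (2 * l i) \<le> 2 powr q * G (l i)" using l(1)[of i] by (intro G_scale_upper) auto
      then have "(max 0 (w z - d))\<^sup>2 + G (max 0 (w z - d)) \<le> T i" using le by (simp add: T_def power_mult_distrib)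
      then have "indicator S z * ennreal ((max 0 (w z - d))\<^sup>2 + G (max 0 (w z - d))) \<le> ennreal (T i) * indicator {z \<in> S. w z > l i} z"
        using True i by (simp add: l_def ennreal_leI)
      also have "\<dots> \<le> (\<Sum>i. ennreal (T i) * indicator {z \<in> S. w z > l i} z)"
      proof -
        have "F i \<le> (\<Sum>i. F i)" for F :: "nat \<Rightarrow> ennreal" using sum_le_suminf[of F "{i}"] by simp
        then show ?thesis .
      qed
      finally show ?thesis .
    qed
    define C2 where "C2 = 2 * Z * \<theta> powr (- p) * ((4 + 2 powr q) * d powr (- (q * a) - \<beta>))"
    have C2: "C2 \<ge> 0" using Z by (simp add: C2_def)
    have summand: "ennreal (T i) * emeasure lborel {z \<in> S. w z > l i} \<le> ennreal (C2 * \<rho> ^ i)" for i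
    proof -
      have Gl: "G (l i powr a) > 0" using l(1)[of i] by (intro G_pos) simp
      have "ennreal (T i) * emeasure lborel {z \<in> S. w z > l i} \<le> ennreal (T i) * ennreal (2 * Z / (\<theta> powr p * G (l i powr a)))"
        by (rule mult_left_mono[OF level]) simp
      also have "\<dots> = ennreal (T i * (2 * Z / (\<theta> powr p * G (l i powr a))))"
        by (rule ennreal_mult'[OF T0, symmetric])
      also have "T i * (2 * Z / (\<theta> powr p * G (l i powr a))) \<le>
         ((4 + 2 powr q) * (l i powr (- \<beta>) * d powr (- (q * a))) * G (l i powr a)) * (2 * Z / (\<theta> powr p * G (l i powr a)))"
      proof (rule mult_right_mono)
        show "T i \<le> (4 + 2 powr q) * (l i powr (- \<beta>) * d powr (- (q * a))) * G (l i powr a)"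
          unfolding T_def l_def a_def by (rule dyadic_ratio[OF n d \<beta>])
      qed (use Z Gl \<theta> in auto)
      also have "\<dots> = 2 * Z * \<theta> powr (- p) * ((4 + 2 powr q) * (l i powr (- \<beta>) * d powr (- (q * a))))"
      proof -
        have "(x * y * e) * (2 * Z / (t * e)) = 2 * Z * (1 / t) * (x * y)" if "e > 0" for x y t e :: real
          using that by simp
        from this[OF Gl] show ?thesis by (simp only: powr_minus_divide)
      qed
      also have "l i powr (- \<beta>) * d powr (- (q * a)) = d powr (- (q * a) - \<beta>) * \<rho> ^ i"
      proof -
        have "l i powr (- \<beta>) = (2 ^ i) powr (- \<beta>) * d powr (- \<beta>)" using d by (simp only: l_def powr_mult)
        also have "((2::real) ^ i) powr (- \<beta>) = \<rho> ^ i"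
        proof -
          have "((2::real) ^ i) powr (- \<beta>) = (2 powr real i) powr (- \<beta>)" by (simp add: powr_realpow)
          also have "\<dots> = (2 powr (- \<beta>)) powr real i" by (simp add: powr_powr mult.commute)
          also have "\<dots> = \<rho> ^ i" using \<rho> by (simp add: \<rho>_def powr_realpow)
          finally show ?thesis .
        qed
        finally show ?thesis using powr_add[of d "- (q * a)" "- \<beta>"] by (simp add: mult_ac)
      qed
      finally show ?thesis by (simp add: C2_def mult_ac ennreal_leI)
    qed
    have "(\<integral>\<^sup>+z. indicator S z * ennreal ((max 0 (w z - d))\<^sup>2 + G (max 0 (w z - d))) \<partial>lborel)
       \<le> (\<integral>\<^sup>+z. (\<Sum>i. ennreal (T i) * indicator {z \<in> S. w z > l i} z) \<partial>lborel)"
      by (rule nn_integral_mono[OF pw])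
    also have "\<dots> = (\<Sum>i. \<integral>\<^sup>+z. ennreal (T i) * indicator {z \<in> S. w z > l i} z \<partial>lborel)"
      by (rule nn_integral_suminf) measurable
    also have "\<dots> = (\<Sum>i. ennreal (T i) * emeasure lborel {z \<in> S. w z > l i})"
      by (intro suminf_cong nn_integral_cmult_indicator) measurable
    also have "\<dots> \<le> (\<Sum>i. ennreal (C2 * \<rho> ^ i))"
      by (rule suminf_le[OF summand]) auto
    also have "\<dots> = ennreal (\<Sum>i. C2 * \<rho> ^ i)"
      by (rule suminf_ennreal2) (use C2 \<rho> in auto)
    also have "(\<Sum>i. C2 * \<rho> ^ i) = C2 * (1 / (1 - \<rho>))"
      using \<rho> by (simp add: suminf_mult suminf_geometric)
    also have "C2 * (1 / (1 - \<rho>)) = C * d powr (- \<gamma>) * Z powr (1 + p / n)"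
    proof -
      \<comment> \<open>This power of \<theta> is the source of the exponent p/n beyond linear in
        \<open>Z\<close>, which drives the iteration.\<close>
      have "\<theta> powr (- p) = \<kappa> powr (- p) * d powr (- (p * a)) * Z powr (p / n)"
        using \<kappa> d Z by (simp add: \<theta>_def powr_mult powr_powr mult.commute)
      then have "C2 * (1 / (1 - \<rho>)) = C * (d powr (- (p * a)) * d powr (- (q * a) - \<beta>)) * (Z * Z powr (p / n))"
        by (simp add: C2_def C_def mult_ac)
      also have "d powr (- (p * a)) * d powr (- (q * a) - \<beta>) = d powr (- \<gamma>)"
      proof -
        have "- (p * a) + (- (q * a) - \<beta>) = - \<gamma>" by (simp add: \<gamma>_def)
        then show ?thesis by (simp only: flip: powr_add)
      qed
      also have "Z * Z powr (p / n) = Z powr (1 + p / n)" using Z by (simp add: powr_add)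
      finally show ?thesis .
    qed
    finally show "(\<integral>\<^sup>+z. indicator S z * ennreal ((max 0 (w z - d))\<^sup>2 + G (max 0 (w z - d))) \<partial>lborel) \<le> ennreal (C * d powr (- \<gamma>) * Z powr (1 + p / n))" .
  qed
qed

end

text \<open>Fast geometric convergence in explicit form: every step of the iteration reproduces the
  decay \<open>\<delta> * 2 powr (- N * j)\<close>, and the smallness required by \<open>degiorgi_step\<close> persists.\<close>

lemma iteration_parameters:
  fixes C \<gamma> \<kappa> B \<alpha> n a M :: real
  assumes "0 < C" "0 < \<gamma>" "0 < \<kappa>" "0 < B" "0 < \<alpha>" "0 < n" "0 < a" "0 \<le> M"
  shows "\<exists>\<delta> N. 0 < \<delta> \<and> 0 < N \<and> (\<forall>j::nat.
    C * (2 powr (- (real j + 1))) powr (- \<gamma>) * (B * 2 powr (M * real j) * (\<delta> * 2 powr (- (N * real j)))) powr (1 + \<alpha>)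
        \<le> \<delta> * 2 powr (- (N * (real j + 1))) \<and>
    (B * 2 powr (M * real j) * (\<delta> * 2 powr (- (N * real j)))) powr (1 / n) \<le> \<kappa> * (2 powr (- (real j + 1))) powr a)"
proof -
  \<comment> \<open>Comparing the exponents of 2 linear in \<open>j\<close>, the first entry lets
    the step reproduce the decay, the second preserves the smallness condition.\<close>
  define N where "N = max ((\<gamma> + M * (1 + \<alpha>)) / \<alpha>) (M + n * a)"
  have N: "\<gamma> + M * (1 + \<alpha>) \<le> N * \<alpha>" "M + n * a \<le> N"
  proof -
    have "(\<gamma> + M * (1 + \<alpha>)) / \<alpha> \<le> N" by (simp add: N_def)
    then show "\<gamma> + M * (1 + \<alpha>) \<le> N * \<alpha>" using assms by (simp add: field_simps)
  qed (simp add: N_def)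
  have N0: "N > 0" using N(2) assms mult_pos_pos[of n a] by linarith
  define D1 where "D1 = C * 2 powr \<gamma> * B powr (1 + \<alpha>) * 2 powr N"
  have D1: "D1 > 0" using assms by (simp add: D1_def)
  \<comment> \<open>With the growth in \<open>j\<close> settled by \<open>N\<close>, the two entries
    are the two requirements at \<open>j = 0\<close>.\<close>
  define \<delta> where "\<delta> = min ((1 / D1) powr (1 / \<alpha>)) ((\<kappa> * 2 powr (- a)) powr n / B)"
  have \<delta>: "\<delta> > 0" using assms D1 by (simp add: \<delta>_def)
  have \<delta>1: "D1 * \<delta> powr \<alpha> \<le> 1"
  proof -
    have "\<delta> powr \<alpha> \<le> ((1 / D1) powr (1 / \<alpha>)) powr \<alpha>" using \<delta> assms by (intro powr_mono2) (auto simp: \<delta>_def)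
    also have "\<dots> = 1 / D1" using assms D1 by (simp add: powr_powr)
    finally show ?thesis using D1 by (simp add: field_simps)
  qed
  have \<delta>2: "(B * \<delta>) powr (1 / n) \<le> \<kappa> * 2 powr (- a)"
  proof -
    have "\<delta> \<le> (\<kappa> * 2 powr (- a)) powr n / B" by (simp add: \<delta>_def)
    then have "B * \<delta> \<le> (\<kappa> * 2 powr (- a)) powr n" using assms by (simp add: field_simps)
    then have "(B * \<delta>) powr (1 / n) \<le> ((\<kappa> * 2 powr (- a)) powr n) powr (1 / n)" using assms \<delta> by (intro powr_mono2) auto
    also have "\<dots> = \<kappa> * 2 powr (- a)" using assms by (simp add: powr_powr)
    finally show ?thesis .
  qed
  have "C * (2 powr (- (real j + 1))) powr (- \<gamma>) * (B * 2 powr (M * real j) * (\<delta> * 2 powr (- (N * real j)))) powr (1 + \<alpha>)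
        \<le> \<delta> * 2 powr (- (N * (real j + 1)))" for j
  proof -
    have e: "B * 2 powr (M * real j) * (\<delta> * 2 powr (- (N * real j))) = B * \<delta> * 2 powr (M * real j - N * real j)"
      by (simp add: powr_diff powr_minus field_simps)
    have "(B * \<delta> * 2 powr (M * real j - N * real j)) powr (1 + \<alpha>) = B powr (1 + \<alpha>) * \<delta> powr (1 + \<alpha>) * 2 powr ((M * real j - N * real j) * (1 + \<alpha>))"
      using assms \<delta> by (simp add: powr_mult powr_powr)
    moreover have "\<delta> powr (1 + \<alpha>) = \<delta> * \<delta> powr \<alpha>" using \<delta> by (simp add: powr_add)
    moreover have "(2 powr (- (real j + 1))) powr (- \<gamma>) = 2 powr (\<gamma> * real j) * 2 powr \<gamma>"
      by (simp add: powr_powr algebra_simps flip: powr_add)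
    ultimately have "C * (2 powr (- (real j + 1))) powr (- \<gamma>) * (B * 2 powr (M * real j) * (\<delta> * 2 powr (- (N * real j)))) powr (1 + \<alpha>)
       = \<delta> * ((C * 2 powr \<gamma> * B powr (1 + \<alpha>)) * \<delta> powr \<alpha>) * (2 powr (\<gamma> * real j) * 2 powr ((M * real j - N * real j) * (1 + \<alpha>)))"
      unfolding e by (simp only: mult_ac)
    also have "\<dots> = \<delta> * ((C * 2 powr \<gamma> * B powr (1 + \<alpha>)) * \<delta> powr \<alpha>) * 2 powr (\<gamma> * real j + (M * real j - N * real j) * (1 + \<alpha>))"
      by (simp only: powr_add)
    also have "\<dots> \<le> \<delta> * 2 powr (- N) * 2 powr (- (N * real j))"
    proof (intro mult_mono mult_left_mono)
      show "C * 2 powr \<gamma> * B powr (1 + \<alpha>) * \<delta> powr \<alpha> \<le> 2 powr (- N)"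
        using \<delta>1 by (simp add: D1_def powr_minus field_simps)
      have "(\<gamma> + M * (1 + \<alpha>)) * real j \<le> (N * \<alpha>) * real j" by (rule mult_right_mono[OF N(1)]) simp
      then have "\<gamma> * real j + (M * real j - N * real j) * (1 + \<alpha>) \<le> - (N * real j)" by (simp add: algebra_simps)
      then show "2 powr (\<gamma> * real j + (M * real j - N * real j) * (1 + \<alpha>)) \<le> 2 powr (- (N * real j))" by simp
    qed (use \<delta> assms in auto)
    also have "\<dots> = \<delta> * 2 powr (- (N * (real j + 1)))" by (simp add: algebra_simps flip: powr_add)
    finally show ?thesis .
  qed
  moreover have "(B * 2 powr (M * real j) * (\<delta> * 2 powr (- (N * real j)))) powr (1 / n) \<le> \<kappa> * (2 powr (- (real j + 1))) powr a" for j
  proof -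
    have e: "B * 2 powr (M * real j) * (\<delta> * 2 powr (- (N * real j))) = B * \<delta> * 2 powr (M * real j - N * real j)"
      by (simp add: powr_diff powr_minus field_simps)
    have "(B * \<delta> * 2 powr (M * real j - N * real j)) powr (1 / n) = (B * \<delta>) powr (1 / n) * 2 powr ((M * real j - N * real j) * (1 / n))"
      using assms \<delta> by (simp add: powr_mult powr_powr)
    also have "\<dots> \<le> (\<kappa> * 2 powr (- a)) * 2 powr (- a * real j)"
    proof (rule mult_mono[OF \<delta>2])
      have "(M + n * a) * real j \<le> N * real j" by (rule mult_right_mono[OF N(2)]) simp
      then have "(M * real j - N * real j) * (1 / n) \<le> - a * real j" using assms by (simp add: field_simps)
      then show "2 powr ((M * real j - N * real j) * (1 / n)) \<le> 2 powr (- a * real j)" by simp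
    qed (use assms in auto)
    also have "\<dots> = \<kappa> * (2 powr (- (real j + 1))) powr a"
      by (simp add: powr_powr algebra_simps flip: powr_add)
    finally show ?thesis by (simp only: e)
  qed
  ultimately show ?thesis using \<delta> N0 by blast
qed

section \<open>Iteration over levels and shrinking balls\<close>

context local_subsolution
begin

definition "\<Phi> s = (max 0 s)\<^sup>2 + G (max 0 s)"

lemma \<Phi>_nonneg: "\<Phi> s \<ge> 0" by (simp add: \<Phi>_def G_nonneg)

lemma \<Phi>_measurable [measurable]: "\<Phi> \<in> borel_measurable borel" unfolding \<Phi>_def by measurable

lemma \<Phi>_le_H: assumes "k \<ge> 0" shows "\<Phi> (U z - k) \<le> H z"
proof -
  have le: "max 0 (U z - k) \<le> \<bar>U z\<bar>" using assms by auto
  then have "(max 0 (U z - k))\<^sup>2 \<le> \<bar>U z\<bar>\<^sup>2" by (intro power_mono) auto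
  then show ?thesis using G_mono[OF le] G_nonneg[of "norm (v z)"] by (simp add: \<Phi>_def H_def)
qed

definition "excess \<rho> k = (\<integral>z. indicator (ball z0 \<rho>) z * \<Phi> (U z - k) \<partial>lborel)"

lemma excess_int: assumes "k \<ge> 0" shows "integrable lborel (\<lambda>z. indicator (ball z0 \<rho>) z * \<Phi> (U z - k))"
  by (rule Bochner_Integration.integrable_bound[OF H_int])
     (use \<Phi>_le_H[OF assms] \<Phi>_nonneg H_nonneg in \<open>auto simp: indicator_def\<close>)

lemma excess_nonneg: "excess \<rho> k \<ge> 0"
  unfolding excess_def by (intro Bochner_Integration.integral_nonneg mult_nonneg_nonneg \<Phi>_nonneg) auto

lemma excess_mono: assumes "k \<ge> 0" "\<rho> \<le> \<rho>'" "k \<le> k'" shows "excess \<rho> k' \<le> excess \<rho>' k"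
  unfolding excess_def
proof (rule integral_mono[OF excess_int excess_int])
  fix z
  have "\<Phi> (U z - k') \<le> \<Phi> (U z - k)" unfolding \<Phi>_def using assms by (intro add_mono power_mono G_mono) auto
  moreover have "indicat_real (ball z0 \<rho>) z \<le> indicator (ball z0 \<rho>') z" using assms by (auto simp: indicator_def)
  ultimately show "indicator (ball z0 \<rho>) z * \<Phi> (U z - k') \<le> indicator (ball z0 \<rho>') z * \<Phi> (U z - k)"
    by (intro mult_mono \<Phi>_nonneg) auto
qed (use assms in auto)

text \<open>Supplies the smallness at the start: a high enough integer level makes the excess as
  small as the iteration demands.\<close>

lemma excess_tendsto_0: "(\<lambda>i. excess \<rho> (real i)) \<longlonglongrightarrow> 0"
proof -
  have "(\<lambda>i. \<integral>z. indicator (ball z0 \<rho>) z * \<Phi> (U z - real i) \<partial>lborel) \<longlonglongrightarrow> (\<integral>z. 0 \<partial>(lborel :: ('a \<times> real) measure))"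
  proof (rule integral_dominated_convergence[where w = H])
    show "AE z in lborel. (\<lambda>i. indicator (ball z0 \<rho>) z * \<Phi> (U z - real i)) \<longlonglongrightarrow> 0"
    proof (rule AE_I2)
      fix z
      obtain N where N: "U z \<le> real N" using real_arch_simple by blast
      have "eventually (\<lambda>i. indicator (ball z0 \<rho>) z * \<Phi> (U z - real i) = 0) sequentially"
        using eventually_ge_at_top[of N]
      proof eventually_elim
        case (elim i)
        then have "max 0 (U z - real i) = 0" using N by simp
        then show ?case by (simp add: \<Phi>_def G_zero)
      qed
      then show "(\<lambda>i. indicator (ball z0 \<rho>) z * \<Phi> (U z - real i)) \<longlonglongrightarrow> 0" by (rule tendsto_eventually)
    qed
    show "AE z in lborel. norm (indicator (ball z0 \<rho>) z * \<Phi> (U z - real i)) \<le> H z" for i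
      using \<Phi>_le_H[of "real i"] \<Phi>_nonneg H_nonneg by (intro AE_I2) (auto simp: indicator_def)
    show "(\<lambda>z. indicator (ball z0 \<rho>) z * \<Phi> (U z - real i)) \<in> borel_measurable lborel" for i
      by (rule borel_measurable_integrable[OF excess_int]) simp
  qed (use H_int in auto)
  then show ?thesis by (simp add: excess_def)
qed

text \<open>The energy estimate feeds \<open>degiorgi_step\<close> with a cutoff that is 1 on the
  smaller ball. A positive upper bound \<open>y\<close> replaces the excess itself, which may be
  zero, because the step takes powers of a positive \<open>Z\<close>.\<close>

lemma excess_step:
  assumes pn: "2 * real DIM('a) / (real DIM('a) + 2) < p"
    and R: "0 < R" "R < R0"
  shows "\<exists>C \<gamma> \<kappa> K m. 0 < C \<and> 0 < \<gamma> \<and> 0 < \<kappa> \<and> 0 < K \<and>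
    (\<forall>a b k d y. R / 2 \<le> a \<longrightarrow> a < b \<longrightarrow> b \<le> R \<longrightarrow> 0 \<le> k \<longrightarrow> 0 < d \<longrightarrow> d \<le> 1 \<longrightarrow> 0 < y \<longrightarrow> excess b k \<le> y \<longrightarrow>
      (K * ((R + 8) / (b - a)) ^ m * y) powr (1 / real DIM('a)) \<le> \<kappa> * d powr (1 + 2 / real DIM('a)) \<longrightarrow>
      excess a (k + d) \<le> C * d powr (- \<gamma>) * (K * ((R + 8) / (b - a)) ^ m * y) powr (1 + p / real DIM('a)))"
proof -
  define m where "m = nat \<lceil>q\<rceil> + 2"
  have m: "m \<ge> 2" "q \<le> real m" unfolding m_def by linarith+
  \<comment> \<open>The added 1 guarantees positivity.\<close>
  define K where "K = energy_const q \<nu> \<Lambda> m + 1"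
  have yp: "young_par q \<nu> \<Lambda> m > 0" using m \<nu> \<Lambda> q_gt_1 by (simp add: young_par_def)
  have K0: "energy_const q \<nu> \<Lambda> m \<ge> 0"
    using yp \<nu> \<Lambda> q_gt_1 by (simp add: energy_const_def energy_const0_def)
  have K: "K > 0" using K0 by (simp add: K_def)
  obtain C \<gamma> \<kappa> where C: "0 < C" "0 < \<gamma>" "0 < \<kappa>"
    and step: "\<forall>(f :: 'a \<times> real \<Rightarrow> real) w S d Z. f \<in> borel_measurable borel \<longrightarrow> w \<in> borel_measurable borel \<longrightarrow> S \<in> sets borel \<longrightarrow>
      (\<forall>z. f z \<ge> 0) \<longrightarrow> 0 < d \<longrightarrow> d \<le> 1 \<longrightarrow> 0 < Z \<longrightarrow>
      (AE t in lborel. (\<integral>\<^sup>+x. ennreal ((f (x, t))\<^sup>2) \<partial>lborel) \<le> ennreal Z) \<longrightarrow>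
      (\<forall>y h. 0 < h \<longrightarrow> norm y \<le> h \<longrightarrow> (\<integral>\<^sup>+z. G (\<bar>f (z + (y, 0)) - f z\<bar> / h) \<partial>lborel) \<le> ennreal Z) \<longrightarrow>
      (\<forall>z\<in>S. d \<le> w z \<longrightarrow> w z * d / 4 \<le> f z) \<longrightarrow>
      Z powr (1 / real DIM('a)) \<le> \<kappa> * d powr (1 + 2 / real DIM('a)) \<longrightarrow>
      (\<integral>\<^sup>+z. indicator S z * ennreal ((max 0 (w z - d))\<^sup>2 + G (max 0 (w z - d))) \<partial>lborel)
        \<le> ennreal (C * d powr (- \<gamma>) * Z powr (1 + p / real DIM('a)))"
    using degiorgi_step[OF pn] by (elim exE conjE) (rule that; assumption)
  show ?thesis
  proof (rule exI[of _ C], rule exI[of _ \<gamma>], rule exI[of _ \<kappa>], rule exI[of _ K], rule exI[of _ m], intro conjI C K allI impI)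
    fix a b k d y
    assume ab: "R / 2 \<le> a" "a < b" "b \<le> R" and k: "0 \<le> k" and d: "0 < d" "d \<le> 1" and y: "0 < y" "excess b k \<le> y"
      and small: "(K * ((R + 8) / (b - a)) ^ m * y) powr (1 / real DIM('a)) \<le> \<kappa> * d powr (1 + 2 / real DIM('a))"
    \<comment> \<open>The 8 covers the Lipschitz constant of the cutoff, and the additional
      \<open>R\<close> makes the quotient at least 1, as \<open>local_energy\<close>
      requires.\<close>
    define c where "c = (R + 8) / (b - a)"
    have c: "c \<ge> 1" using ab R by (simp add: c_def field_simps)
    define Z where "Z = K * c ^ m * y"
    have Z: "Z > 0" using K c y by (simp add: Z_def)
    have a0: "a > 0" using ab R by simp
    obtain \<phi> \<phi>' where \<phi>: "\<forall>z. (\<phi> has_derivative \<phi>' z) (at z)" "\<forall>h. continuous_on UNIV (\<lambda>z. \<phi>' z h)"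
      "\<forall>z. 0 \<le> \<phi> z \<and> \<phi> z \<le> 1" "\<forall>z\<in>cball z0 a. \<phi> z = 1" "\<forall>z. z \<notin> ball z0 b \<longrightarrow> \<phi> z = 0"
      "\<forall>z h. \<bar>\<phi>' z h\<bar> \<le> 8 * b / (b\<^sup>2 - a\<^sup>2) * norm h"
      using cutoff_exists[OF a0 ab(2), of z0] by blast
    have cb: "8 * b / (b\<^sup>2 - a\<^sup>2) \<le> c"
    proof -
      have "b\<^sup>2 - a\<^sup>2 = (b - a) * (b + a)" by (simp add: power2_eq_square algebra_simps)
      then have "8 * b / (b\<^sup>2 - a\<^sup>2) = 8 / (b - a) * (b / (b + a))" by simp
      also have "\<dots> \<le> 8 / (b - a) * 1" using ab a0 by (intro mult_left_mono) (auto simp: field_simps)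
      also have "\<dots> \<le> c" using ab R by (simp add: c_def divide_right_mono)
      finally show ?thesis .
    qed
    interpret e: local_energy g g' p q A \<nu> \<Lambda> U v z0 R0 \<phi> \<phi>' c k b m
    proof unfold_locales
      show "C1_fun \<phi> \<phi>'" using \<phi> by (simp add: C1_fun_def)
      show "\<bar>\<phi>' z h\<bar> \<le> c * norm h" for z h
        using \<phi>(6)[rule_format, of z h] mult_right_mono[OF cb norm_ge_zero[of h]] by linarith
    qed (use \<phi> c m k ab R in auto)
    have "(\<integral>z. e.E z \<partial>lborel) \<le> excess b k"
      unfolding excess_def
    proof (rule integral_mono[OF e.E_int excess_int[OF k]])
      fix z show "e.E z \<le> indicator (ball z0 b) z * \<Phi> (U z - k)"
        using \<phi>(5)[rule_format, of z] \<Phi>_nonneg[of "U z - k"] by (cases "z \<in> ball z0 b") (auto simp: e.E_def e.w_def \<Phi>_def)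
    qed
    then have Ey: "(\<integral>z. e.E z \<partial>lborel) \<le> y" using y by linarith
    have ZZ: "energy_const q \<nu> \<Lambda> m * c ^ m * (\<integral>z. e.E z \<partial>lborel) \<le> Z"
    proof -
      have "energy_const q \<nu> \<Lambda> m * c ^ m * (\<integral>z. e.E z \<partial>lborel) \<le> energy_const q \<nu> \<Lambda> m * c ^ m * y"
        using Ey K0 c by (intro mult_left_mono mult_nonneg_nonneg) auto
      also have "\<dots> \<le> K * c ^ m * y" using c y by (intro mult_right_mono) (auto simp: K_def)
      finally show ?thesis by (simp add: Z_def)
    qed
    have "(\<integral>\<^sup>+z. indicator (ball z0 a) z * ennreal ((max 0 (e.w z - d))\<^sup>2 + G (max 0 (e.w z - d))) \<partial>lborel)
        \<le> ennreal (C * d powr (- \<gamma>) * Z powr (1 + p / real DIM('a)))"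
    proof (rule step[rule_format, where f = e.f])
      show "e.f \<in> borel_measurable borel" by (rule e.f_measurable)
      show "e.w \<in> borel_measurable borel" unfolding e.w_def[abs_def] by measurable
      show "0 \<le> e.f z" for z by (simp add: e.f_def trunc1_nonneg e.\<zeta>_nonneg)
      show "AE t in lborel. (\<integral>\<^sup>+x. ennreal ((e.f (x, t))\<^sup>2) \<partial>lborel) \<le> ennreal Z"
        using e.energy_estimate(1) by eventually_elim (rule order_trans[OF _ ennreal_leI[OF ZZ]])
      show "(\<integral>\<^sup>+z. G (\<bar>e.f (z + (y, 0)) - e.f z\<bar> / h) \<partial>lborel) \<le> ennreal Z" if "0 < h" "norm y \<le> h" for y h
        by (rule order_trans[OF e.energy_estimate(2)[OF that] ennreal_leI[OF ZZ]])
      show "e.w z * d / 4 \<le> e.f z" if z: "z \<in> ball z0 a" and dw: "d \<le> e.w z" for z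
      proof -
        have "\<phi> z = 1" using \<phi>(4) z by auto
        moreover have "e.w z = U z - k" using dw d by (auto simp: e.w_def max_def split: if_splits)
        ultimately show "e.w z * d / 4 \<le> e.f z" using trunc1_lower[OF d, of "U z - k"] dw by (simp add: e.f_def e.\<zeta>_def)
      qed
    qed (use d Z small in \<open>auto simp: Z_def c_def\<close>)
    also have "(\<integral>\<^sup>+z. indicator (ball z0 a) z * ennreal ((max 0 (e.w z - d))\<^sup>2 + G (max 0 (e.w z - d))) \<partial>lborel)
       = (\<integral>\<^sup>+z. ennreal (indicator (ball z0 a) z * \<Phi> (U z - (k + d))) \<partial>lborel)"
    proof (rule nn_integral_cong)
      fix z
      have "max 0 (e.w z - d) = max 0 (U z - (k + d))" using d by (auto simp: e.w_def max_def)
      then show "indicator (ball z0 a) z * ennreal ((max 0 (e.w z - d))\<^sup>2 + G (max 0 (e.w z - d))) = ennreal (indicator (ball z0 a) z * \<Phi> (U z - (k + d)))"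
        by (simp add: \<Phi>_def indicator_def)
    qed
    also have "\<dots> = ennreal (excess a (k + d))"
      unfolding excess_def by (rule nn_integral_eq_integral[OF excess_int]) (use k d in \<open>auto simp: \<Phi>_nonneg\<close>)
    finally show "excess a (k + d) \<le> C * d powr (- \<gamma>) * (K * ((R + 8) / (b - a)) ^ m * y) powr (1 + p / real DIM('a))"
      using C by (simp add: ennreal_le_iff Z_def c_def)
  qed
qed

text \<open>Radii decrease from \<open>R\<close> to \<open>R / 2\<close> and levels increase by less
  than 1 in total, so the decay of the excess along the way forces it to vanish at the limiting
  level on the inner ball.\<close>

theorem locally_bounded_above:
  assumes pn: "2 * real DIM('a) / (real DIM('a) + 2) < p" and R: "0 < R" "R < R0"
  shows "\<exists>M. AE z in lborel. z \<in> ball z0 (R / 2) \<longrightarrow> U z \<le> M"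
proof -
  define n where "n = real DIM('a)"
  have n: "n > 0" by (simp add: n_def)
  obtain C \<gamma> \<kappa> K m where C: "0 < C" "0 < \<gamma>" "0 < \<kappa>" "0 < K"
    and step: "\<forall>a b k d y. R / 2 \<le> a \<longrightarrow> a < b \<longrightarrow> b \<le> R \<longrightarrow> 0 \<le> k \<longrightarrow> 0 < d \<longrightarrow> d \<le> 1 \<longrightarrow> 0 < y \<longrightarrow> excess b k \<le> y \<longrightarrow>
      (K * ((R + 8) / (b - a)) ^ m * y) powr (1 / n) \<le> \<kappa> * d powr (1 + 2 / n) \<longrightarrow>
      excess a (k + d) \<le> C * d powr (- \<gamma>) * (K * ((R + 8) / (b - a)) ^ m * y) powr (1 + p / n)"
    using excess_step[OF pn R, folded n_def] by (elim exE conjE) (rule that; assumption)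
  define B where "B = K * ((R + 8) / (R / 4)) ^ m"
  have B: "B > 0" using C R by (simp add: B_def)
  have an: "1 + 2 / n > 0" "p / n > 0" using n p_gt_1 by (auto intro: add_pos_pos)
  obtain \<delta> N where \<delta>: "0 < \<delta>" "0 < N" and par: "\<And>j::nat.
     C * (2 powr (- (real j + 1))) powr (- \<gamma>) * (B * 2 powr (real m * real j) * (\<delta> * 2 powr (- (N * real j)))) powr (1 + p / n)
        \<le> \<delta> * 2 powr (- (N * (real j + 1)))"
    "\<And>j::nat. (B * 2 powr (real m * real j) * (\<delta> * 2 powr (- (N * real j)))) powr (1 / n) \<le> \<kappa> * (2 powr (- (real j + 1))) powr (1 + 2 / n)"
    using iteration_parameters[OF C(1,2,3) B an(2) n an(1), of "real m"] by auto
  obtain i where i: "excess R (real i) < \<delta>"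
    using LIMSEQ_D[OF excess_tendsto_0[of R] \<delta>(1)] excess_nonneg by fastforce
  \<comment> \<open>Consecutive radii differ by \<open>R / 4 * 2 powr (- real j)\<close>. Its power
    \<open>m\<close> in the step explains both the quotient by \<open>R / 4\<close> in
    \<open>B\<close> and the choice \<open>real m\<close> for the growth rate.\<close>
  define \<rho> where "\<rho> j = R / 2 * (1 + 2 powr (- real j))" for j :: nat
  define lev where "lev j = real i + 1 - 2 powr (- real j)" for j :: nat
  have half: "2 powr (- real (Suc j)) = 2 powr (- real j) / 2" for j
    by (simp add: powr_diff powr_minus field_simps)
  have pw1: "2 powr (- real j) \<le> 1" for j using powr_mono[of "- real j" 0 "2::real"] by simp
  have it: "excess (\<rho> j) (lev j) \<le> \<delta> * 2 powr (- (N * real j))" for j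
  proof (induction j)
    case 0
    then show ?case using i by (simp add: \<rho>_def lev_def)
  next
    case (Suc j)
    have diff: "\<rho> j - \<rho> (Suc j) = R / 4 * 2 powr (- real j)"
      unfolding \<rho>_def half by (simp add: algebra_simps)
    have gap: "K * ((R + 8) / (\<rho> j - \<rho> (Suc j))) ^ m * (\<delta> * 2 powr (- (N * real j))) = B * 2 powr (real m * real j) * (\<delta> * 2 powr (- (N * real j)))"
    proof -
      have "(R + 8) / (\<rho> j - \<rho> (Suc j)) = (R + 8) / (R / 4) * 2 powr real j"
        unfolding diff by (simp add: powr_minus field_simps)
      moreover have "(2 powr real j) ^ m = 2 powr (real m * real j)"
        by (simp add: powr_powr mult.commute flip: powr_realpow)
      ultimately show ?thesis by (simp only: power_mult_distrib B_def mult_ac)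
    qed
    have lev: "lev (Suc j) = lev j + 2 powr (- (real j + 1))"
      using half[of j] by (simp add: lev_def algebra_simps)
    have "excess (\<rho> (Suc j)) (lev j + 2 powr (- (real j + 1))) \<le> C * (2 powr (- (real j + 1))) powr (- \<gamma>) * (K * ((R + 8) / (\<rho> j - \<rho> (Suc j))) ^ m * (\<delta> * 2 powr (- (N * real j)))) powr (1 + p / n)"
    proof (rule step[rule_format, OF _ _ _ _ _ _ _ Suc.IH])
      show "R / 2 \<le> \<rho> (Suc j)" using R by (simp add: \<rho>_def)
      show "\<rho> (Suc j) < \<rho> j" using diff R by (smt (verit) powr_gt_zero mult_pos_pos divide_pos_pos)
      show "\<rho> j \<le> R" using pw1[of j] R by (simp add: \<rho>_def)
      show "0 \<le> lev j" using pw1[of j] by (simp add: lev_def)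
      show "2 powr (- (real j + 1)) \<le> 1" using pw1[of "Suc j"] by (simp add: add.commute)
      show "(K * ((R + 8) / (\<rho> j - \<rho> (Suc j))) ^ m * (\<delta> * 2 powr (- (N * real j)))) powr (1 / n) \<le> \<kappa> * (2 powr (- (real j + 1))) powr (1 + 2 / n)"
        unfolding gap by (rule par(2))
    qed (use \<delta> in auto)
    also have "\<dots> \<le> \<delta> * 2 powr (- (N * (real j + 1)))" unfolding gap by (rule par(1))
    finally show ?case unfolding lev by (simp add: add.commute)
  qed
  define k where "k = real i + 1"
  have "excess (R / 2) k \<le> \<delta> * (2 powr (- N)) ^ j" for j
  proof -
    have "excess (R / 2) k \<le> excess (\<rho> j) (lev j)"
      using pw1[of j] R by (intro excess_mono) (auto simp: \<rho>_def lev_def k_def)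
    also have "\<dots> \<le> \<delta> * 2 powr (- (N * real j))" by (rule it)
    also have "2 powr (- (N * real j)) = (2 powr (- N)) ^ j"
      by (simp add: powr_powr flip: powr_realpow)
    finally show ?thesis .
  qed
  moreover have "(\<lambda>j. \<delta> * (2 powr (- N)) ^ j) \<longlonglongrightarrow> \<delta> * 0"
    using \<delta> by (intro tendsto_intros LIMSEQ_power_zero) (auto simp: powr_less_one)
  ultimately have "excess (R / 2) k \<le> \<delta> * 0" by (intro LIMSEQ_le_const) auto
  then have "excess (R / 2) k = 0" using excess_nonneg[of "R / 2" k] by simp
  then have "AE z in lborel. indicator (ball z0 (R / 2)) z * \<Phi> (U z - k) = 0"
    unfolding excess_def using excess_int[of k "R / 2"]
    by (subst (asm) integral_nonneg_eq_0_iff_AE) (auto simp: k_def \<Phi>_nonneg)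
  then have "AE z in lborel. z \<in> ball z0 (R / 2) \<longrightarrow> U z \<le> k"
  proof eventually_elim
    case (elim z)
    show ?case
    proof
      assume "z \<in> ball z0 (R / 2)"
      then have "\<Phi> (U z - k) = 0" using elim by simp
      then have "(max 0 (U z - k))\<^sup>2 \<le> 0" using G_nonneg[of "max 0 (U z - k)"] unfolding \<Phi>_def by linarith
      then show "U z \<le> k" by (auto simp: max_def split: if_splits)
    qed
  qed
  then show ?thesis by blast
qed

end

subsection \<open>Borel representatives and uniqueness of weak gradients\<close>

lemma AE_lebesgue_on_iff:
  assumes "S \<in> sets lebesgue"
  shows "(AE x in lebesgue_on S. P x) \<longleftrightarrow> (AE x in lborel. x \<in> S \<longrightarrow> P x)"
  using AE_restrict_space_iff[of S lebesgue P] assms by (simp add: AE_completion_iff)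

text \<open>Measurability is enough on both sides: where the integral does not exist, both take the
  default value 0. Weak identities can thus be transferred before integrability is
  discussed.\<close>

lemma integral_lebesgue_on_eq_lborel:
  fixes h h0 :: "'a::euclidean_space \<Rightarrow> real"
  assumes S: "S \<in> sets lebesgue" and h0: "h0 \<in> borel_measurable borel"
    and ae: "AE x in lborel. indicator S x * h x = h0 x"
  shows "integral\<^sup>L (lebesgue_on S) h = integral\<^sup>L lborel h0"
proof -
  have ae': "AE x in lebesgue. h0 x = indicator S x * h x"
    unfolding AE_completion_iff using ae by eventually_elim simp
  have m0: "h0 \<in> borel_measurable lebesgue" using h0 by (intro measurable_completion) simp
  have m1: "(\<lambda>x. indicator S x * h x) \<in> borel_measurable lebesgue" by (rule borel_measurable_AE[OF m0 ae'])
  have "integral\<^sup>L (lebesgue_on S) h = (\<integral>x. indicator S x * h x \<partial>lebesgue)"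
    using S by (subst integral_restrict_space) auto
  also have "\<dots> = integral\<^sup>L lebesgue h0"
    by (rule integral_cong_AE[OF m1 m0]) (use ae' in eventually_elim, simp)
  also have "\<dots> = integral\<^sup>L lborel h0" using h0 by (intro integral_completion) simp
  finally show ?thesis .
qed

lemma nn_integral_lebesgue_on:
  assumes "S \<in> sets lebesgue"
  shows "(\<integral>\<^sup>+x. h x \<partial>lebesgue_on S) = (\<integral>\<^sup>+x. h x * indicator S x \<partial>lborel)"
  using assms by (subst nn_integral_restrict_space) (auto simp: nn_integral_completion)

text \<open>The definitions use the completed measure, whereas Fubini and mollification are carried
  out for Borel functions. Each coordinate is modified on a null set, and finitely many null sets
  are collected.\<close>

lemma borel_representative:
  fixes f :: "'a::euclidean_space \<Rightarrow> 'b::euclidean_space"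
  assumes S: "S \<in> sets lebesgue" and f: "f \<in> borel_measurable (lebesgue_on S)"
  shows "\<exists>f0\<in>borel_measurable borel. AE x in lborel. indicator S x *\<^sub>R f x = f0 x"
proof -
  have m: "(\<lambda>x. indicator S x *\<^sub>R f x) \<in> borel_measurable lebesgue"
    using f S by (subst (asm) borel_measurable_restrict_space_iff) auto
  have "\<exists>h\<in>borel_measurable lborel. AE x in lborel. (indicator S x *\<^sub>R f x) \<bullet> b = h x" for b
    by (rule completion_ex_borel_measurable_real) (use m in measurable)
  then obtain h where h: "\<And>b. h b \<in> borel_measurable lborel" "\<And>b. AE x in lborel. (indicator S x *\<^sub>R f x) \<bullet> b = h b x" by metis
  have [measurable]: "h b \<in> borel_measurable borel" for b using h(1) by simp
  have "AE x in lborel. \<forall>b\<in>Basis. (indicator S x *\<^sub>R f x) \<bullet> b = h b x"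
    by (rule AE_finite_allI[OF finite_Basis], rule h)
  then have "AE x in lborel. indicator S x *\<^sub>R f x = (\<Sum>b\<in>Basis. h b x *\<^sub>R b)"
  proof eventually_elim
    case (elim x)
    have "indicator S x *\<^sub>R f x = (\<Sum>b\<in>Basis. ((indicator S x *\<^sub>R f x) \<bullet> b) *\<^sub>R b)"
      by (rule euclidean_representation[symmetric])
    also have "\<dots> = (\<Sum>b\<in>Basis. h b x *\<^sub>R b)" using elim by (intro sum.cong) auto
    finally show ?case .
  qed
  moreover have "(\<lambda>x. \<Sum>b\<in>Basis. h b x *\<^sub>R b) \<in> borel_measurable borel" by measurable
  ultimately show ?thesis by (intro bexI[of _ "\<lambda>x. \<Sum>b\<in>Basis. h b x *\<^sub>R b"])
qed

text \<open>A set with null sections is null by Tonelli once it is known to be measurable, which is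
  why properties are formulated for Borel representatives before being assembled from
  slices.\<close>

lemma AE_lborel_PairI:
  fixes P :: "'a::euclidean_space \<times> 'b::euclidean_space \<Rightarrow> bool"
  assumes P: "{z. P z} \<in> sets borel" and ae: "AE t in lborel. AE x in lborel. P (x, t)"
  shows "AE z in lborel. P z"
proof -
  have eq: "{z. \<not> P z} = - {z. P z}" by auto
  have [measurable]: "{z. \<not> P z} \<in> sets borel" unfolding eq using P by (rule borel_comp)
  have "emeasure lborel {z. \<not> P z} = (\<integral>\<^sup>+z. indicator {z. \<not> P z} z \<partial>lborel)" by simp
  also have "\<dots> = (\<integral>\<^sup>+t. \<integral>\<^sup>+x. indicator {z. \<not> P z} (x, t) \<partial>lborel \<partial>lborel)"
    by (rule nn_integral_lborel_Pair[symmetric]) measurable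
  also have "\<dots> = (\<integral>\<^sup>+t. 0 \<partial>(lborel :: 'b measure))"
  proof (rule nn_integral_cong_AE, use ae in eventually_elim)
    case (elim t)
    have "(\<integral>\<^sup>+x. indicator {z. \<not> P z} (x, t) \<partial>lborel) = (\<integral>\<^sup>+x. 0 \<partial>(lborel :: 'a measure))"
      by (rule nn_integral_cong_AE, use elim in eventually_elim) simp
    then show ?case by simp
  qed
  finally have "{z. \<not> P z} \<in> null_sets lborel" by auto
  from AE_not_in[OF this] show ?thesis by simp
qed

lemma integral_lborel_Pair_snd:
  fixes f :: "'a::euclidean_space \<times> 'b::euclidean_space \<Rightarrow> real"
  assumes "integrable lborel f"
  shows "(\<integral>t. \<integral>x. f (x, t) \<partial>lborel \<partial>lborel) = integral\<^sup>L lborel f"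
  using lborel_pair.integral_snd[of "\<lambda>x t. f (x, t)"] assms by (simp add: lborel_prod)

lemma bump_nonzero_cball: "0 \<le> \<epsilon> \<Longrightarrow> z \<notin> cball c \<epsilon> \<Longrightarrow> bump (\<epsilon>\<^sup>2) c z = 0 \<and> dbump (\<epsilon>\<^sup>2) c z h = 0"
proof -
  assume \<epsilon>: "0 \<le> \<epsilon>" and z: "z \<notin> cball c \<epsilon>"
  then have "\<epsilon> \<le> norm (z - c)" by (simp add: dist_norm norm_minus_commute)
  then have "\<epsilon>\<^sup>2 \<le> (norm (z - c))\<^sup>2" using \<epsilon> by (intro power_mono) auto
  then show ?thesis by (simp add: bump_eq_0 dbump_eq_0)
qed

lemma integral_lebesgue_on_cong_support:
  fixes h :: "'a::euclidean_space \<Rightarrow> real"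
  assumes "S \<in> sets lebesgue" "S' \<in> sets lebesgue" "\<And>x. x \<notin> S \<inter> S' \<Longrightarrow> h x = 0"
  shows "integral\<^sup>L (lebesgue_on S) h = integral\<^sup>L (lebesgue_on S') h"
proof -
  have eq: "(\<lambda>x. indicator S x *\<^sub>R h x) = (\<lambda>x. indicator S' x *\<^sub>R h x)"
  proof
    fix x show "indicator S x *\<^sub>R h x = indicator S' x *\<^sub>R h x" using assms(3)[of x] by (auto simp: indicator_def)
  qed
  have "integral\<^sup>L (lebesgue_on S) h = (\<integral>x. indicator S x *\<^sub>R h x \<partial>lebesgue)"
    by (rule integral_restrict_space) (use assms in simp)
  also have "\<dots> = integral\<^sup>L (lebesgue_on S') h"
    unfolding eq by (rule integral_restrict_space[symmetric]) (use assms in simp)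
  finally show ?thesis .
qed

text \<open>Kernels are test functions, so the mollifications of the difference vanish near the
  smaller ball, while they converge to the difference almost everywhere along a subsequence. The
  loss of radius makes room for the kernels.\<close>

lemma weak_gradient_unique:
  fixes v v' :: "'a::euclidean_space \<Rightarrow> 'a"
  assumes v: "weak_gradient (ball x0 \<rho>) f v" and v': "weak_gradient D' f v'"
    and D': "open D'" "ball x0 \<rho> \<subseteq> D'" and \<rho>: "0 < \<rho>'" "\<rho>' < \<rho>"
  shows "AE x in lborel. x \<in> ball x0 \<rho>' \<longrightarrow> v x = v' x"
proof -
  \<comment> \<open>The closed ball of this intermediate radius is compact in both domains, so both
    gradients are integrable on it.\<close>
  define s where "s = (\<rho>' + \<rho>) / 2"
  have s: "\<rho>' < s" "s < \<rho>" using \<rho> by (auto simp: s_def)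
  define C where "C = cball x0 s"
  have C: "compact C" "C \<subseteq> ball x0 \<rho>" "C \<subseteq> D'" using s D' by (auto simp: C_def)
  have Cl: "C \<in> sets lebesgue" by (simp add: C_def)
  have Sl: "ball x0 \<rho> \<in> sets lebesgue" "D' \<in> sets lebesgue" using D' by auto
  have iv: "integrable lebesgue (\<lambda>x. indicator C x *\<^sub>R v x)" "integrable lebesgue (\<lambda>x. indicator C x *\<^sub>R v' x)"
  proof -
    have "integrable (lebesgue_on C) v" using v C(1,2) by (simp add: weak_gradient_def locally_integrable_def)
    then show "integrable lebesgue (\<lambda>x. indicator C x *\<^sub>R v x)"
      by (rule integrable_restrict_space[THEN iffD1, rotated]) (use Cl in simp)
    have "integrable (lebesgue_on C) v'" using v' C(1,3) by (simp add: weak_gradient_def locally_integrable_def)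
    then show "integrable lebesgue (\<lambda>x. indicator C x *\<^sub>R v' x)"
      by (rule integrable_restrict_space[THEN iffD1, rotated]) (use Cl in simp)
  qed
  define F where "F x = indicator C x *\<^sub>R v x - indicator C x *\<^sub>R v' x" for x
  have Fi: "integrable lebesgue F" unfolding F_def using iv by auto
  then have Fm: "F \<in> borel_measurable (lebesgue_on UNIV)" by simp
  obtain F0 where F0 [measurable]: "F0 \<in> borel_measurable borel" and F0e: "AE x in lborel. F x = F0 x"
    using borel_representative[OF _ Fm] by auto
  have F0e': "AE x in lebesgue. F x = F0 x" unfolding AE_completion_iff by (rule F0e)
  have F0m: "F0 \<in> borel_measurable lebesgue" by (intro measurable_completion) simp
  have "integrable lebesgue F0"
    by (rule integrable_cong_AE_imp[OF Fi F0m]) (use F0e' in eventually_elim, simp)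
  then have F0i: "integrable lborel F0" by (simp add: integrable_completion)
  define \<epsilon> where "\<epsilon> n = (s - \<rho>') * inverse (real (Suc n))" for n
  have \<epsilon>: "\<epsilon> n > 0" "\<epsilon> n \<le> s - \<rho>'" for n
  proof -
    show "\<epsilon> n > 0" using s by (simp add: \<epsilon>_def)
    have "\<epsilon> n \<le> (s - \<rho>') * 1" unfolding \<epsilon>_def using s by (intro mult_left_mono) (auto simp: field_simps)
    then show "\<epsilon> n \<le> s - \<rho>'" by simp
  qed
  have \<epsilon>0: "\<epsilon> \<longlonglongrightarrow> 0"
    using tendsto_mult[OF tendsto_const LIMSEQ_inverse_real_of_nat, of "s - \<rho>'"] by (simp add: \<epsilon>_def[abs_def])
  have zero: "mollify (\<epsilon> n) F0 x = 0" if x: "x \<in> ball x0 \<rho>'" for n x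
  proof (rule euclidean_eqI)
    fix b :: 'a assume b: "b \<in> Basis"
    let ?\<phi> = "bump ((\<epsilon> n)\<^sup>2) x"
    have sub: "cball x (\<epsilon> n) \<subseteq> C"
    proof
      fix y assume "y \<in> cball x (\<epsilon> n)"
      then show "y \<in> C" using x \<epsilon>(2)[of n] dist_triangle[of x0 y x] by (simp add: C_def)
    qed
    have supp: "?\<phi> y = 0" "dbump ((\<epsilon> n)\<^sup>2) x y h = 0" if "y \<notin> C" for y h
    proof -
      have "y \<notin> cball x (\<epsilon> n)" using that sub by blast
      then show "?\<phi> y = 0" "dbump ((\<epsilon> n)\<^sup>2) x y h = 0"
        using bump_nonzero_cball[of "\<epsilon> n" y x h] \<epsilon>(1)[of n] by auto
    qed
    have test: "?\<phi> \<in> test_functions (ball x0 \<rho>)" "?\<phi> \<in> test_functions D'"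
      using sub C \<epsilon>(1)[of n] by (auto intro!: bump_test_function[of "\<epsilon> n"])
    have e1: "integral\<^sup>L (lebesgue_on (ball x0 \<rho>)) (\<lambda>y. f y * frechet_derivative ?\<phi> (at y) b) = integral\<^sup>L (lebesgue_on D') (\<lambda>y. f y * frechet_derivative ?\<phi> (at y) b)"
      by (rule integral_lebesgue_on_cong_support[OF Sl]) (use C in \<open>auto simp: frechet_derivative_bump intro!: supp(2)\<close>)
    have e2: "integral\<^sup>L (lebesgue_on (ball x0 \<rho>)) (\<lambda>y. (v y \<bullet> b) * ?\<phi> y) = integral\<^sup>L (lebesgue_on C) (\<lambda>y. (v y \<bullet> b) * ?\<phi> y)"
    proof (rule integral_lebesgue_on_cong_support[OF Sl(1) Cl])
      fix y assume "y \<notin> ball x0 \<rho> \<inter> C"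
      then have "y \<notin> C" using C by blast
      then show "(v y \<bullet> b) * ?\<phi> y = 0" by (simp add: supp(1))
    qed
    have e3: "integral\<^sup>L (lebesgue_on D') (\<lambda>y. (v' y \<bullet> b) * ?\<phi> y) = integral\<^sup>L (lebesgue_on C) (\<lambda>y. (v' y \<bullet> b) * ?\<phi> y)"
    proof (rule integral_lebesgue_on_cong_support[OF Sl(2) Cl])
      fix y assume "y \<notin> D' \<inter> C"
      then have "y \<notin> C" using C by blast
      then show "(v' y \<bullet> b) * ?\<phi> y = 0" by (simp add: supp(1))
    qed
    have eq: "integral\<^sup>L (lebesgue_on C) (\<lambda>y. (v y \<bullet> b) * ?\<phi> y) = integral\<^sup>L (lebesgue_on C) (\<lambda>y. (v' y \<bullet> b) * ?\<phi> y)"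
      using v v' test b e1 e2 e3 unfolding weak_gradient_def by auto
    have im: "integrable lebesgue (\<lambda>y. indicator C y *\<^sub>R ((w y \<bullet> b) * ?\<phi> y))" if "integrable lebesgue (\<lambda>y. indicator C y *\<^sub>R w y)" for w :: "'a \<Rightarrow> 'a"
    proof (rule Bochner_Integration.integrable_bound)
      show "integrable lebesgue (\<lambda>y. norm (indicator C y *\<^sub>R w y))" using that by (rule integrable_norm)
      have "(\<lambda>y. ?\<phi> y * ((indicator C y *\<^sub>R w y) \<bullet> b)) \<in> borel_measurable lebesgue"
        by (intro borel_measurable_times borel_measurable_inner borel_measurable_const borel_measurable_integrable[OF that] measurable_completion) simp
      then show "(\<lambda>y. indicator C y *\<^sub>R ((w y \<bullet> b) * ?\<phi> y)) \<in> borel_measurable lebesgue" by (simp add: mult_ac)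
      show "AE y in lebesgue. norm (indicator C y *\<^sub>R ((w y \<bullet> b) * ?\<phi> y)) \<le> norm (norm (indicator C y *\<^sub>R w y))"
      proof (intro AE_I2)
        fix y
        have "\<bar>w y \<bullet> b\<bar> * \<bar>?\<phi> y\<bar> \<le> norm (w y) * 1"
          using Basis_le_norm[OF b, of "w y"] bump_le_1[of "(\<epsilon> n)\<^sup>2" x y] bump_nonneg[of "(\<epsilon> n)\<^sup>2" x y] by (intro mult_mono) auto
        then show "norm (indicator C y *\<^sub>R ((w y \<bullet> b) * ?\<phi> y)) \<le> norm (norm (indicator C y *\<^sub>R w y))"
          by (auto simp: indicator_def abs_mult)
      qed
    qed
    have "(\<integral>y. ?\<phi> y * (F0 y \<bullet> b) \<partial>lborel) = (\<integral>y. ?\<phi> y * (F0 y \<bullet> b) \<partial>lebesgue)"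
      by (rule integral_completion[symmetric]) simp
    also have "\<dots> = (\<integral>y. indicator C y *\<^sub>R ((v y \<bullet> b) * ?\<phi> y) - indicator C y *\<^sub>R ((v' y \<bullet> b) * ?\<phi> y) \<partial>lebesgue)"
    proof (rule integral_cong_AE)
      show "(\<lambda>y. ?\<phi> y * (F0 y \<bullet> b)) \<in> borel_measurable lebesgue" by (intro measurable_completion) simp
      show "(\<lambda>y. indicator C y *\<^sub>R ((v y \<bullet> b) * ?\<phi> y) - indicator C y *\<^sub>R ((v' y \<bullet> b) * ?\<phi> y)) \<in> borel_measurable lebesgue"
        using im[OF iv(1)] im[OF iv(2)] by auto
      show "AE y in lebesgue. ?\<phi> y * (F0 y \<bullet> b) = indicator C y *\<^sub>R ((v y \<bullet> b) * ?\<phi> y) - indicator C y *\<^sub>R ((v' y \<bullet> b) * ?\<phi> y)"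
        using F0e'
      proof eventually_elim
        case (elim y)
        then have F0y: "F0 y = indicator C y *\<^sub>R v y - indicator C y *\<^sub>R v' y" by (simp add: F_def)
        show ?case unfolding F0y
          by (cases "y \<in> C") (simp_all add: inner_diff_left left_diff_distrib right_diff_distrib mult.commute)
      qed
    qed
    also have "\<dots> = 0"
    proof -
      have "integral\<^sup>L (lebesgue_on C) (\<lambda>y. (w y \<bullet> b) * ?\<phi> y) = (\<integral>y. indicator C y *\<^sub>R ((w y \<bullet> b) * ?\<phi> y) \<partial>lebesgue)" for w :: "'a \<Rightarrow> 'a"
        by (rule integral_restrict_space) (use Cl in simp)
      then show ?thesis using eq by (subst Bochner_Integration.integral_diff[OF im[OF iv(1)] im[OF iv(2)]]) simp
    qed
    finally have z: "(\<integral>y. ?\<phi> y * (F0 y \<bullet> b) \<partial>lborel) = 0" .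
    have "mollify (\<epsilon> n) F0 x \<bullet> b = (\<integral>y. ((?\<phi> y / bump_mass TYPE('a) (\<epsilon> n)) *\<^sub>R F0 y) \<bullet> b \<partial>lborel)"
      unfolding mollify_def by (rule integral_inner_left[symmetric]) (use mollify_integrand[OF F0i, of "\<epsilon> n" x] in simp)
    also have "\<dots> = (\<integral>y. (1 / bump_mass TYPE('a) (\<epsilon> n)) * (?\<phi> y * (F0 y \<bullet> b)) \<partial>lborel)" by simp
    also have "\<dots> = 0" using z by simp
    finally show "mollify (\<epsilon> n) F0 x \<bullet> b = 0 \<bullet> b" by simp
  qed
  obtain r where "AE x in lborel. (\<lambda>n. mollify (\<epsilon> (r n)) F0 x) \<longlonglongrightarrow> F0 x"
    using mollify_AE_subseq[OF F0i \<epsilon>0 \<epsilon>(1)] by blast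
  then show ?thesis using F0e
  proof eventually_elim
    case (elim x)
    show ?case
    proof
      assume x: "x \<in> ball x0 \<rho>'"
      have "(\<lambda>n. 0) \<longlonglongrightarrow> F0 x" using elim(1) by (simp add: zero[OF x])
      then have "F0 x = 0" by (simp add: LIMSEQ_const_iff)
      moreover have "x \<in> C" using x s by (simp add: C_def)
      ultimately show "v x = v' x" using elim(2) by (simp add: F_def)
    qed
  qed
qed

subsection \<open>Local boundedness\<close>

lemma open_sets_lebesgue: "open S \<Longrightarrow> S \<in> sets lebesgue"
  by simp

context orlicz_field
begin

text \<open>Turns a weak subsolution, restricted to a small cylinder around the point and extended
  by zero, into an instance of \<open>local_subsolution\<close>.\<close>

lemma subsolution_bounded_near_point:
  fixes \<Omega> :: "'a set" and u :: "'a \<times> real \<Rightarrow> real"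
  assumes pn: "2 * real DIM('a) / (real DIM('a) + 2) < p"
    and \<Omega>: "open \<Omega>" and sub: "weak_subsolution g A \<Omega> T u" and z0: "(x0, t0) \<in> \<Omega> \<times> {0<..<T}"
  shows "\<exists>r>0. \<exists>M. AE z in lborel. z \<in> ball (x0, t0) r \<longrightarrow> u z \<le> M"
proof -
  define W where "W = \<Omega> \<times> {0<..<T}"
  have Wo: "open W" unfolding W_def by (intro open_Times \<Omega> open_greaterThanLessThan)
  then obtain e where e: "e > 0" "ball (x0, t0) e \<subseteq> W" using z0 openE unfolding W_def by blast
  define \<rho> where "\<rho> = e / 3"
  have \<rho>: "\<rho> > 0" using e by (simp add: \<rho>_def)
  have box: "cball x0 \<rho> \<times> cball t0 \<rho> \<subseteq> W"
  proof
    fix z assume "z \<in> cball x0 \<rho> \<times> cball t0 \<rho>"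
    then have "dist x0 (fst z) \<le> \<rho>" "dist t0 (snd z) \<le> \<rho>" by auto
    then have "norm (x0 - fst z) + norm (t0 - snd z) \<le> 2 * \<rho>" by (simp add: dist_norm)
    moreover have "dist (x0, t0) z \<le> norm (x0 - fst z) + norm (t0 - snd z)"
      using norm_Pair_le[of "x0 - fst z" "t0 - snd z"] by (simp add: dist_norm minus_prod_def)
    ultimately have "dist (x0, t0) z < e" using \<rho> by (simp add: \<rho>_def)
    then show "z \<in> W" using e(2) by auto
  qed
  define D where "D = ball x0 \<rho>"
  define I where "I = {t0 - \<rho><..<t0 + \<rho>}"
  have Isub: "I \<subseteq> cball t0 \<rho>" by (auto simp: I_def dist_real_def)
  define KK where "KK = D \<times> I"
  \<comment> \<open>Only the spatial radius is halved: gradients are compared slice by slice, so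
    uniqueness loses radius in space but not in time.\<close>
  define K' where "K' = ball x0 (\<rho> / 2) \<times> I"
  have opens: "open D" "open I" "open KK" "open K'" by (auto simp: D_def I_def KK_def K'_def intro!: open_Times)
  have KKW: "KK \<subseteq> W" using box Isub unfolding KK_def D_def by (meson Sigma_mono ball_subset_cball order_trans)
  have K'KK: "K' \<subseteq> KK" using \<rho> by (auto simp: K'_def KK_def D_def)
  have DI: "D \<subseteq> \<Omega>" "I \<subseteq> {0<..<T}"
  proof -
    have "x0 \<in> D" "t0 \<in> I" using \<rho> by (auto simp: D_def I_def)
    then show "D \<subseteq> \<Omega>" "I \<subseteq> {0<..<T}" using KKW by (auto simp: KK_def W_def)
  qed
  have cyl: "compact_cylinder \<Omega> T D (t0 - \<rho>) (t0 + \<rho>)"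
  proof -
    have "closure (D \<times> {t0 - \<rho><..<t0 + \<rho>}) \<subseteq> cball x0 \<rho> \<times> cball t0 \<rho>"
      using Isub by (intro closure_minimal closed_Times) (auto simp: D_def I_def)
    moreover have "bounded (cball x0 \<rho> \<times> cball t0 \<rho>)" by (intro bounded_Times) auto
    ultimately show ?thesis
      using opens \<rho> box by (auto simp: compact_cylinder_def compact_eq_bounded_closed W_def intro: bounded_subset)
  qed
  from sub have "u \<in> V2_G_loc g \<Omega> T" by (simp add: weak_subsolution_def)
  then have uV: "u \<in> V2_G g D (t0 - \<rho>) (t0 + \<rho>)" using cyl by (simp add: V2_G_loc_def)
  from sub obtain v where v: "weak_spatial_gradient \<Omega> 0 T u v"
    and ineq: "\<And>\<eta>. \<eta> \<in> test_functions W \<Longrightarrow> (\<forall>z. 0 \<le> \<eta> z) \<Longrightarrow>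
           - integral\<^sup>L (lebesgue_on W) (\<lambda>z. u z * time_deriv \<eta> z)
           + integral\<^sup>L (lebesgue_on W) (\<lambda>z. A (v z) \<bullet> space_grad \<eta> z) \<le> 0"
    by (auto simp: weak_subsolution_def W_def)
  from uV obtain v' where v': "weak_spatial_gradient D (t0 - \<rho>) (t0 + \<rho>) u v'" "v' \<in> L_G g KK"
    by (auto simp: V2_G_def V_G_def KK_def I_def)
  from uV have uLG: "u \<in> L_G g KK" by (simp add: V2_G_def V_G_def KK_def I_def)
  have "u \<in> Linf_L2 D (t0 - \<rho>) (t0 + \<rho>)" using uV by (simp add: V2_G_def)
  then have "\<exists>C. AE t in lebesgue_on I. integrable (lebesgue_on D) (\<lambda>x. (u (x, t))\<^sup>2) \<and> integral\<^sup>L (lebesgue_on D) (\<lambda>x. (u (x, t))\<^sup>2) \<le> C"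
    unfolding Linf_L2_def I_def by (elim CollectE conjE) assumption
  then obtain C where C: "AE t in lebesgue_on I. integrable (lebesgue_on D) (\<lambda>x. (u (x, t))\<^sup>2) \<and> integral\<^sup>L (lebesgue_on D) (\<lambda>x. (u (x, t))\<^sup>2) \<le> C"
    by blast
  have leb: "KK \<in> sets lebesgue" "W \<in> sets lebesgue" "I \<in> sets lebesgue" "{0<..<T} \<in> sets lebesgue" "D \<in> sets lebesgue" "\<Omega> \<in> sets lebesgue"
    by (rule open_sets_lebesgue, fact opens Wo \<Omega> open_greaterThanLessThan)+
  have [measurable]: "K' \<in> sets borel" "I \<in> sets borel" "KK \<in> sets borel" using opens by auto
  have um: "u \<in> borel_measurable (lebesgue_on KK)" using uLG by (simp add: L_G_def)
  obtain u1 where u1 [measurable]: "u1 \<in> borel_measurable borel" and u1e: "AE z in lborel. indicator KK z *\<^sub>R u z = u1 z"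
    using borel_representative[OF leb(1) um] by blast
  have vm: "v \<in> borel_measurable (lebesgue_on W)" using v by (simp add: weak_spatial_gradient_def W_def)
  obtain v1 where v1 [measurable]: "v1 \<in> borel_measurable borel" and v1e: "AE z in lborel. indicator W z *\<^sub>R v z = v1 z"
    using borel_representative[OF leb(2) vm] by blast
  have vm': "v' \<in> borel_measurable (lebesgue_on KK)" using v' by (simp add: L_G_def)
  obtain v2 where v2 [measurable]: "v2 \<in> borel_measurable borel" and v2e: "AE z in lborel. indicator KK z *\<^sub>R v' z = v2 z"
    using borel_representative[OF leb(1) vm'] by blast
  define U0 where "U0 z = indicator K' z * u1 z" for z
  define v0 where "v0 z = indicator K' z *\<^sub>R v1 z" for z
  have [measurable]: "U0 \<in> borel_measurable borel" "v0 \<in> borel_measurable borel"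
    unfolding U0_def v0_def by measurable
  have U0e: "AE z in lborel. U0 z = indicator K' z * u z"
    using u1e by eventually_elim (use K'KK in \<open>auto simp: U0_def indicator_def\<close>)
  have v0e: "AE z in lborel. v0 z = indicator K' z *\<^sub>R v z"
    using v1e by eventually_elim (use K'KK KKW in \<open>auto simp: v0_def indicator_def\<close>)
  have U0out: "U0 z = 0" "v0 z = 0" if "z \<notin> K'" for z using that by (auto simp: U0_def v0_def)
  have wgv: "AE t in lborel. t \<in> {0<..<T} \<longrightarrow> weak_gradient \<Omega> (\<lambda>x. u (x, t)) (\<lambda>x. v (x, t))"
    using v AE_lebesgue_on_iff[OF leb(4)] by (simp add: weak_spatial_gradient_def)
  have wgv': "AE t in lborel. t \<in> I \<longrightarrow> weak_gradient D (\<lambda>x. u (x, t)) (\<lambda>x. v' (x, t))"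
  proof -
    have "AE t in lebesgue_on I. weak_gradient D (\<lambda>x. u (x, t)) (\<lambda>x. v' (x, t))"
      using v'(1) unfolding weak_spatial_gradient_def I_def by blast
    then show ?thesis by (rule AE_lebesgue_on_iff[OF leb(3), THEN iffD1])
  qed
  \<comment> \<open>The gradient \<open>v\<close> occurs in the inequality, while finiteness of the
    modular is known for the gradient \<open>v'\<close> of the cylinder. Uniqueness on almost every
    slice identifies their Borel representatives.\<close>
  have "AE z in lborel. z \<in> K' \<longrightarrow> v1 z = v2 z"
  proof (rule AE_lborel_PairI)
    have "{z. z \<in> K' \<longrightarrow> v1 z = v2 z} = - K' \<union> {z. v1 z = v2 z}" by auto
    moreover have "{z. v1 z = v2 z} \<in> sets borel" by measurable
    ultimately show "{z. z \<in> K' \<longrightarrow> v1 z = v2 z} \<in> sets borel" by auto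
    show "AE t in lborel. AE x in lborel. (x, t) \<in> K' \<longrightarrow> v1 (x, t) = v2 (x, t)"
      using wgv wgv' AE_lborel_Pair[OF v1e] AE_lborel_Pair[OF v2e]
    proof eventually_elim
      case (elim t)
      show ?case
      proof (cases "t \<in> I")
        case True
        have "AE x in lborel. x \<in> ball x0 (\<rho> / 2) \<longrightarrow> v' (x, t) = v (x, t)"
        proof (rule weak_gradient_unique)
          show "weak_gradient (ball x0 \<rho>) (\<lambda>x. u (x, t)) (\<lambda>x. v' (x, t))" using elim(2) True by (simp add: D_def)
          show "weak_gradient \<Omega> (\<lambda>x. u (x, t)) (\<lambda>x. v (x, t))" using elim(1) True DI by auto
        qed (use \<Omega> DI \<rho> in \<open>auto simp: D_def\<close>)
        then show ?thesis using elim(3,4)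
        proof eventually_elim
          case (elim x)
          show ?case
          proof
            assume z: "(x, t) \<in> K'"
            then have "x \<in> ball x0 (\<rho> / 2)" by (simp add: K'_def)
            moreover have "(x, t) \<in> KK" "(x, t) \<in> W" using z K'KK KKW by blast+
            ultimately show "v1 (x, t) = v2 (x, t)" using elim by simp
          qed
        qed
      qed (simp add: K'_def)
    qed
  qed
  then have v0e': "AE z in lborel. v0 z = indicator K' z *\<^sub>R v' z"
    using v2e by eventually_elim (use K'KK in \<open>auto simp: v0_def indicator_def\<close>)
  have K'fin: "emeasure lborel K' < \<infinity>"
  proof (rule emeasure_bounded_finite)
    show "bounded K'" using bounded_Times[of "ball x0 (\<rho> / 2)" I] by (simp add: K'_def I_def)
  qed
  have K'int: "integrable lborel (indicat_real K')" using K'fin by (simp add: integrable_indicator_iff)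
  have GU: "integrable lborel (\<lambda>z. G \<bar>U0 z\<bar>)"
  proof (rule integrableI_nonneg)
    have "(\<integral>\<^sup>+z. ennreal (G \<bar>U0 z\<bar>) \<partial>lborel) \<le> (\<integral>\<^sup>+z. ennreal (G (norm (u z))) * indicator KK z \<partial>lborel)"
      by (rule nn_integral_mono_AE, use U0e in eventually_elim) (use K'KK in \<open>auto simp: indicator_def G_zero\<close>)
    also have "\<dots> < \<infinity>" using uLG by (simp add: L_G_def nn_integral_lebesgue_on[OF leb(1)])
    finally show "(\<integral>\<^sup>+z. ennreal (G \<bar>U0 z\<bar>) \<partial>lborel) < \<infinity>" .
  qed (auto simp: G_nonneg)
  have Gv: "integrable lborel (\<lambda>z. G (norm (v0 z)))"
  proof (rule integrableI_nonneg)
    have "(\<integral>\<^sup>+z. ennreal (G (norm (v0 z))) \<partial>lborel) \<le> (\<integral>\<^sup>+z. ennreal (G (norm (v' z))) * indicator KK z \<partial>lborel)"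
      by (rule nn_integral_mono_AE, use v0e' in eventually_elim) (use K'KK in \<open>auto simp: indicator_def G_zero\<close>)
    also have "\<dots> < \<infinity>" using v'(2) by (simp add: L_G_def nn_integral_lebesgue_on[OF leb(1)])
    finally show "(\<integral>\<^sup>+z. ennreal (G (norm (v0 z))) \<partial>lborel) < \<infinity>" .
  qed (auto simp: G_nonneg)
  have U2: "integrable lborel (\<lambda>z. (U0 z)\<^sup>2)"
  proof (rule integrableI_nonneg)
    have C': "AE t in lborel. t \<in> I \<longrightarrow> integrable (lebesgue_on D) (\<lambda>x. (u (x, t))\<^sup>2) \<and> integral\<^sup>L (lebesgue_on D) (\<lambda>x. (u (x, t))\<^sup>2) \<le> C"
      by (rule AE_lebesgue_on_iff[OF leb(3), THEN iffD1, OF C])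
    \<comment> \<open>The uniform L2 bound on slices, multiplied by the length of the time interval,
      bounds the space-time integral.\<close>
    have "(\<integral>\<^sup>+z. ennreal ((U0 z)\<^sup>2) \<partial>lborel) = (\<integral>\<^sup>+t. \<integral>\<^sup>+x. ennreal ((U0 (x, t))\<^sup>2) \<partial>lborel \<partial>lborel)"
      by (rule nn_integral_lborel_Pair[symmetric]) measurable
    also have "\<dots> \<le> (\<integral>\<^sup>+t. ennreal C * indicator I t \<partial>lborel)"
    proof (rule nn_integral_mono_AE, use C' AE_lborel_Pair[OF U0e] in eventually_elim)
      case (elim t)
      show ?case
      proof (cases "t \<in> I")
        case True
        have "(\<integral>\<^sup>+x. ennreal ((U0 (x, t))\<^sup>2) \<partial>lborel) \<le> (\<integral>\<^sup>+x. ennreal ((u (x, t))\<^sup>2) * indicator D x \<partial>lborel)"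
          by (rule nn_integral_mono_AE, use elim(2) in eventually_elim) (use \<rho> in \<open>auto simp: indicator_def K'_def D_def\<close>)
        also have "\<dots> = (\<integral>\<^sup>+x. ennreal ((u (x, t))\<^sup>2) \<partial>lebesgue_on D)" by (rule nn_integral_lebesgue_on[OF leb(5), symmetric])
        also have "\<dots> = ennreal (integral\<^sup>L (lebesgue_on D) (\<lambda>x. (u (x, t))\<^sup>2))"
          using elim(1) True by (intro nn_integral_eq_integral) auto
        also have "\<dots> \<le> ennreal C" using elim(1) True by (intro ennreal_leI) auto
        finally show ?thesis using True by simp
      next
        case False
        then have "U0 (x, t) = 0" for x by (intro U0out) (simp add: K'_def)
        then show ?thesis by simp
      qed
    qed
    also have "\<dots> = ennreal C * emeasure lborel I" by (rule nn_integral_cmult_indicator) simp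
    also have "\<dots> < \<infinity>" using \<rho> by (simp add: I_def ennreal_mult_less_top)
    finally show "(\<integral>\<^sup>+z. ennreal ((U0 z)\<^sup>2) \<partial>lborel) < \<infinity>" .
  qed auto
  \<comment> \<open>The support has finite measure, so square integrability suffices; the gradient
    and the flux are treated likewise through \<open>G_ge_id\<close> and
    \<open>g_le_G\<close>.\<close>
  have Ui: "integrable lborel U0"
  proof (rule Bochner_Integration.integrable_bound)
    show "integrable lborel (\<lambda>z. indicat_real K' z + (U0 z)\<^sup>2)" using K'int U2 by auto
    show "AE z in lborel. norm (U0 z) \<le> norm (indicat_real K' z + (U0 z)\<^sup>2)"
    proof (rule AE_I2)
      fix z
      have "2 * \<bar>U0 z\<bar> \<le> 1 + (U0 z)\<^sup>2" using sum_squares_bound[of 1 "\<bar>U0 z\<bar>"] by simp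
      then have "\<bar>U0 z\<bar> \<le> 1 + (U0 z)\<^sup>2" by linarith
      then show "norm (U0 z) \<le> norm (indicat_real K' z + (U0 z)\<^sup>2)" by (cases "z \<in> K'") (auto simp: U0out)
    qed
  qed measurable
  have vi: "integrable lborel v0"
  proof (rule Bochner_Integration.integrable_bound)
    show "integrable lborel (\<lambda>z. indicat_real K' z + G (norm (v0 z)))" using K'int Gv by auto
    show "AE z in lborel. norm (v0 z) \<le> norm (indicat_real K' z + G (norm (v0 z)))"
    proof (rule AE_I2)
      fix z
      show "norm (v0 z) \<le> norm (indicat_real K' z + G (norm (v0 z)))"
        using G_ge_id[of "norm (v0 z)"] G_nonneg[of "norm (v0 z)"] by (cases "z \<in> K'") (auto simp: U0out)
    qed
  qed measurable
  define \<Lambda> where "\<Lambda> = L / (p - 1)"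
  have \<Lambda>: "\<Lambda> > 0" using L_pos p_gt_1 by (simp add: \<Lambda>_def)
  have Ab: "norm (A \<xi>) \<le> \<Lambda> * g (norm \<xi>)" for \<xi> unfolding \<Lambda>_def by (rule A_bound)
  have Vi: "integrable lborel (\<lambda>z. A (v0 z))"
  proof (rule Bochner_Integration.integrable_bound)
    show "integrable lborel (\<lambda>z. \<Lambda> * (g 1 * indicat_real K' z + q * G (norm (v0 z))))" using K'int Gv by auto
    show "AE z in lborel. norm (A (v0 z)) \<le> norm (\<Lambda> * (g 1 * indicat_real K' z + q * G (norm (v0 z))))"
    proof (rule AE_I2)
      fix z
      show "norm (A (v0 z)) \<le> norm (\<Lambda> * (g 1 * indicat_real K' z + q * G (norm (v0 z))))"
      proof (cases "z \<in> K'")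
        case True
        have "norm (A (v0 z)) \<le> \<Lambda> * (g 1 + q * G (norm (v0 z)))"
          by (rule order_trans[OF Ab mult_left_mono[OF g_le_G]]) (use \<Lambda> in auto)
        also have "\<dots> \<le> norm (\<Lambda> * (g 1 + q * G (norm (v0 z))))" by simp
        finally show ?thesis using True by simp
      qed (simp add: U0out A_zero)
    qed
  qed measurable
  have ballK: "ball (x0, t0) (\<rho> / 2) \<subseteq> K'"
  proof
    fix z assume "z \<in> ball (x0, t0) (\<rho> / 2)"
    then have "dist z (x0, t0) < \<rho> / 2" by (simp add: dist_commute)
    then have "norm (fst z - x0, snd z - t0) < \<rho> / 2" by (simp add: dist_norm minus_prod_def)
    then have "norm (fst z - x0) < \<rho> / 2" "norm (snd z - t0) < \<rho>"
      using norm_fst_le[of "fst z - x0" "snd z - t0"] norm_snd_le[of "snd z - t0" "fst z - x0"] \<rho> by auto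
    then have "fst z \<in> ball x0 (\<rho> / 2)" "snd z \<in> I" by (auto simp: dist_norm norm_minus_commute I_def abs_less_iff)
    then show "z \<in> K'" by (simp add: K'_def mem_Times_iff)
  qed
  interpret s: local_subsolution g g' p q A \<nu> \<Lambda> U0 v0 "(x0, t0)" "\<rho> / 2"
  proof unfold_locales
    show "0 < \<nu>" by (rule \<nu>_pos)
    show "0 < \<Lambda>" by (rule \<Lambda>)
    show "\<nu> * G (norm \<xi>) \<le> A \<xi> \<bullet> \<xi>" for \<xi> by (rule A_coercive)
    show "norm (A \<xi>) \<le> \<Lambda> * g (norm \<xi>)" for \<xi> by (rule Ab)
    show "integrable lborel U0" "integrable lborel v0" "integrable lborel (\<lambda>z. A (v0 z))"
      "integrable lborel (\<lambda>z. (U0 z)\<^sup>2)" "integrable lborel (\<lambda>z. G \<bar>U0 z\<bar>)" "integrable lborel (\<lambda>z. G (norm (v0 z)))"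
      by (rule Ui vi Vi U2 GU Gv)+
  next
    fix c :: "'a \<times> real" and \<epsilon> :: real assume \<epsilon>: "\<epsilon> > 0" and cb: "cball c \<epsilon> \<subseteq> ball (x0, t0) (\<rho> / 2)"
    have cK: "cball c \<epsilon> \<subseteq> K'" using cb ballK by blast
    have supp: "bump (\<epsilon>\<^sup>2) c z = 0" "dbump (\<epsilon>\<^sup>2) c z h = 0" if "z \<notin> K'" for z h
    proof -
      have "z \<notin> cball c \<epsilon>" using that cK by blast
      then show "bump (\<epsilon>\<^sup>2) c z = 0" "dbump (\<epsilon>\<^sup>2) c z h = 0"
        using bump_nonzero_cball[of \<epsilon> z c h] \<epsilon> by auto
    qed
    have K'W: "K' \<subseteq> W" using K'KK KKW by blast
    define \<eta> where "\<eta> = bump (\<epsilon>\<^sup>2) c"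
    have test: "\<eta> \<in> test_functions W" unfolding \<eta>_def
      by (rule bump_test_function[of \<epsilon>, OF _ _ order_trans[OF cK K'W]]) (use \<epsilon> in auto)
    have td: "time_deriv \<eta> z = dbump (\<epsilon>\<^sup>2) c z (0, 1)" for z
      by (simp add: time_deriv_def \<eta>_def frechet_derivative_bump)
    have sg: "w \<bullet> space_grad \<eta> z = (\<Sum>b\<in>Basis. dbump (\<epsilon>\<^sup>2) c z (b, 0) * (w \<bullet> b))" for w z
      by (simp add: space_grad_def \<eta>_def frechet_derivative_bump inner_sum_right)
    have 1: "integral\<^sup>L (lebesgue_on W) (\<lambda>z. u z * time_deriv \<eta> z) = (\<integral>z. dbump (\<epsilon>\<^sup>2) c z (0, 1) * U0 z \<partial>lborel)"
    proof (rule integral_lebesgue_on_eq_lborel[OF leb(2)])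
      show "AE z in lborel. indicator W z * (u z * time_deriv \<eta> z) = dbump (\<epsilon>\<^sup>2) c z (0, 1) * U0 z"
        using U0e
      proof eventually_elim
        case (elim z)
        have "z \<in> K' \<Longrightarrow> z \<in> W" using K'W by blast
        then show ?case by (cases "z \<in> K'") (simp_all add: td elim supp)
      qed
    qed measurable
    have 2: "integral\<^sup>L (lebesgue_on W) (\<lambda>z. A (v z) \<bullet> space_grad \<eta> z) = (\<integral>z. (\<Sum>b\<in>Basis. dbump (\<epsilon>\<^sup>2) c z (b, 0) * (A (v0 z) \<bullet> b)) \<partial>lborel)"
    proof (rule integral_lebesgue_on_eq_lborel[OF leb(2)])
      show "AE z in lborel. indicator W z * (A (v z) \<bullet> space_grad \<eta> z) = (\<Sum>b\<in>Basis. dbump (\<epsilon>\<^sup>2) c z (b, 0) * (A (v0 z) \<bullet> b))"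
        using v0e
      proof eventually_elim
        case (elim z)
        have "z \<in> K' \<Longrightarrow> z \<in> W" using K'W by blast
        then show ?case by (cases "z \<in> K'") (simp_all add: sg elim supp)
      qed
    qed measurable
    have 3: "(\<integral>z. (\<Sum>b\<in>Basis. dbump (\<epsilon>\<^sup>2) c z (b, 0) * (A (v0 z) \<bullet> b)) \<partial>lborel) = (\<Sum>b\<in>Basis. \<integral>z. dbump (\<epsilon>\<^sup>2) c z (b, 0) * (A (v0 z) \<bullet> b) \<partial>lborel)"
    proof (rule Bochner_Integration.integral_sum)
      fix b :: 'a
      have "integrable lborel (\<lambda>z. A (v0 z) \<bullet> b)" using Vi by auto
      from integrable_bounded_scaleR[OF this dbump_measurable dbump_bound]
      show "integrable lborel (\<lambda>z. dbump (\<epsilon>\<^sup>2) c z (b, 0) * (A (v0 z) \<bullet> b))" by simp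
    qed
    have "\<forall>z. 0 \<le> \<eta> z" by (simp add: \<eta>_def bump_nonneg)
    from ineq[OF test this]
    show "- (\<integral>z. dbump (\<epsilon>\<^sup>2) c z (0, 1) * U0 z \<partial>lborel) + (\<Sum>b\<in>Basis. \<integral>z. dbump (\<epsilon>\<^sup>2) c z (b, 0) * (A (v0 z) \<bullet> b) \<partial>lborel) \<le> 0"
      by (simp only: 1 2 3)
    fix b :: 'a assume b: "b \<in> Basis"
    obtain cx ct where c: "c = (cx, ct)" by (cases c)
    have iU: "integrable lborel (\<lambda>z. dbump (\<epsilon>\<^sup>2) c z (b, 0) * U0 z)"
      using integrable_bounded_scaleR[OF Ui dbump_measurable dbump_bound] by simp
    have iv: "integrable lborel (\<lambda>z. bump (\<epsilon>\<^sup>2) c z * (v0 z \<bullet> b))"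
    proof -
      have "integrable lborel (\<lambda>z. v0 z \<bullet> b)" using vi by auto
      from integrable_bounded_scaleR[OF this bump_measurable, of "\<epsilon>\<^sup>2" c 1] show ?thesis by (simp add: bump_nonneg bump_le_1)
    qed
    \<comment> \<open>The weak gradient identity on a slice, with the slice of the space-time kernel
      as test function; integrating over \<open>t\<close> afterwards gives the identity in
      space-time.\<close>
    have slice: "AE t in lborel. (\<integral>x. dbump (\<epsilon>\<^sup>2) c (x, t) (b, 0) * U0 (x, t) \<partial>lborel) = - (\<integral>x. bump (\<epsilon>\<^sup>2) c (x, t) * (v0 (x, t) \<bullet> b) \<partial>lborel)"
      using wgv AE_lborel_Pair[OF U0e] AE_lborel_Pair[OF v0e]
    proof eventually_elim
      case (elim t)
      \<comment> \<open>The squared radius of the slice of the kernel at time \<open>t\<close>. If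
        it is not positive, the slice misses the support and both sides are zero.\<close>
      define a where "a = \<epsilon>\<^sup>2 - (t - ct)\<^sup>2"
      have sl: "bump (\<epsilon>\<^sup>2) c (x, t) = bump a cx x" "dbump (\<epsilon>\<^sup>2) c (x, t) (b, 0) = dbump a cx x b" for x
        by (simp_all add: c a_def bump_slice dbump_slice)
      show ?case
      proof (cases "a \<le> 0")
        case True
        then have "bump a cx x = 0" "dbump a cx x b = 0" for x
          by (auto intro!: bump_eq_0 dbump_eq_0 order_trans[OF _ zero_le_power2])
        then show ?thesis by (simp add: sl)
      next
        case False
        define r where "r = sqrt a"
        have r: "r \<ge> 0" "r\<^sup>2 = a" using False by (auto simp: r_def)
        have cyl_sub: "(x, t) \<in> K'" if "x \<in> cball cx r" for x
        proof -
          have "norm (x - cx) \<le> r" using that by (simp add: dist_norm norm_minus_commute)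
          then have "(norm (x - cx))\<^sup>2 \<le> r\<^sup>2" by (intro power_mono) auto
          then have "(norm (x - cx))\<^sup>2 + (t - ct)\<^sup>2 \<le> \<epsilon>\<^sup>2" using r by (simp add: a_def)
          then have "norm (x - cx, t - ct) \<le> sqrt (\<epsilon>\<^sup>2)" by (simp add: norm_Pair del: real_sqrt_abs)
          then have "dist (x, t) c \<le> \<epsilon>" using \<epsilon> by (simp add: c dist_norm)
          then have "(x, t) \<in> cball c \<epsilon>" by (simp add: dist_commute)
          then show ?thesis using cK by blast
        qed
        have "cx \<in> cball cx r" using r by simp
        from cyl_sub[OF this] have t: "t \<in> I" by (simp add: K'_def)
        then have t': "t \<in> {0<..<T}" using DI by blast
        have subO: "cball cx r \<subseteq> \<Omega>"
        proof
          fix x assume "x \<in> cball cx r"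
          from cyl_sub[OF this] have "(x, t) \<in> W" using K'W by blast
          then show "x \<in> \<Omega>" by (simp add: W_def)
        qed
        have ta: "bump a cx \<in> test_functions \<Omega>" using r subO by (intro bump_test_function[of r]) auto
        have supx: "bump a cx x = 0" "dbump a cx x b = 0" if "(x, t) \<notin> K'" for x
          using supp[OF that] by (simp_all flip: sl)
        have KO: "x \<in> \<Omega>" if "(x, t) \<in> K'" for x
        proof -
          have "(x, t) \<in> W" using that K'W by blast
          then show ?thesis by (simp add: W_def)
        qed
        have "integral\<^sup>L (lebesgue_on \<Omega>) (\<lambda>x. u (x, t) * frechet_derivative (bump a cx) (at x) b) = (\<integral>x. dbump a cx x b * U0 (x, t) \<partial>lborel)"
        proof (rule integral_lebesgue_on_eq_lborel[OF leb(6)])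
          show "AE x in lborel. indicator \<Omega> x * (u (x, t) * frechet_derivative (bump a cx) (at x) b) = dbump a cx x b * U0 (x, t)"
            using elim(2)
          proof eventually_elim
            case (elim x)
            show ?case by (cases "(x, t) \<in> K'") (auto simp: elim supx KO frechet_derivative_bump)
          qed
        qed measurable
        moreover have "integral\<^sup>L (lebesgue_on \<Omega>) (\<lambda>x. (v (x, t) \<bullet> b) * bump a cx x) = (\<integral>x. bump a cx x * (v0 (x, t) \<bullet> b) \<partial>lborel)"
        proof (rule integral_lebesgue_on_eq_lborel[OF leb(6)])
          show "AE x in lborel. indicator \<Omega> x * ((v (x, t) \<bullet> b) * bump a cx x) = bump a cx x * (v0 (x, t) \<bullet> b)"
            using elim(3)
          proof eventually_elim
            case (elim x)
            show ?case by (cases "(x, t) \<in> K'") (auto simp: elim supx KO)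
          qed
        qed measurable
        ultimately show ?thesis
          using elim(1) t' ta b by (simp add: weak_gradient_def sl)
      qed
    qed
    have "(\<integral>z. dbump (\<epsilon>\<^sup>2) c z (b, 0) * U0 z \<partial>lborel) = (\<integral>t. \<integral>x. dbump (\<epsilon>\<^sup>2) c (x, t) (b, 0) * U0 (x, t) \<partial>lborel \<partial>lborel)"
      by (rule integral_lborel_Pair_snd[OF iU, symmetric])
    also have "\<dots> = (\<integral>t. - (\<integral>x. bump (\<epsilon>\<^sup>2) c (x, t) * (v0 (x, t) \<bullet> b) \<partial>lborel) \<partial>lborel)"
    proof (rule integral_cong_AE[OF _ _ slice])
      have [measurable]: "(\<lambda>(t, x). dbump (\<epsilon>\<^sup>2) c (x, t) (b, 0)) \<in> borel_measurable (lborel \<Otimes>\<^sub>M lborel)"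
        unfolding dbump_def by measurable
      have [measurable]: "(\<lambda>(t, x). U0 (x, t)) \<in> borel_measurable (lborel \<Otimes>\<^sub>M lborel)" by measurable
      show "(\<lambda>t. \<integral>x. dbump (\<epsilon>\<^sup>2) c (x, t) (b, 0) * U0 (x, t) \<partial>lborel) \<in> borel_measurable lborel"
        by (rule lborel.borel_measurable_lebesgue_integral) measurable
      have [measurable]: "(\<lambda>(t, x). v0 (x, t)) \<in> borel_measurable (lborel \<Otimes>\<^sub>M lborel)" by measurable
      have "(\<lambda>t. \<integral>x. bump (\<epsilon>\<^sup>2) c (x, t) * (v0 (x, t) \<bullet> b) \<partial>lborel) \<in> borel_measurable lborel"
        by (rule lborel.borel_measurable_lebesgue_integral) measurable
      then show "(\<lambda>t. - (\<integral>x. bump (\<epsilon>\<^sup>2) c (x, t) * (v0 (x, t) \<bullet> b) \<partial>lborel)) \<in> borel_measurable lborel" by measurable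
    qed
    also have "\<dots> = - (\<integral>t. \<integral>x. bump (\<epsilon>\<^sup>2) c (x, t) * (v0 (x, t) \<bullet> b) \<partial>lborel \<partial>lborel)" by simp
    also have "\<dots> = - (\<integral>z. bump (\<epsilon>\<^sup>2) c z * (v0 z \<bullet> b) \<partial>lborel)"
      using integral_lborel_Pair_snd[OF iv] by simp
    finally show "(\<integral>z. dbump (\<epsilon>\<^sup>2) c z (b, 0) * U0 z \<partial>lborel) = - (\<integral>z. bump (\<epsilon>\<^sup>2) c z * (v0 z \<bullet> b) \<partial>lborel)" .
  qed
  obtain M where M: "AE z in lborel. z \<in> ball (x0, t0) (\<rho> / 4 / 2) \<longrightarrow> U0 z \<le> M"
    using s.locally_bounded_above[OF pn, of "\<rho> / 4"] \<rho> by auto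
  have "AE z in lborel. z \<in> ball (x0, t0) (\<rho> / 8) \<longrightarrow> u z \<le> M"
    using M U0e
  proof eventually_elim
    case (elim z)
    show ?case
    proof
      assume z: "z \<in> ball (x0, t0) (\<rho> / 8)"
      then have "z \<in> ball (x0, t0) (\<rho> / 2)" using \<rho> by simp
      then have "z \<in> K'" using ballK by blast
      then show "u z \<le> M" using elim z by simp
    qed
  qed
  then show ?thesis using \<rho> by (intro exI[of _ "\<rho> / 8"]) auto
qed

text \<open>Compactness reduces the upper bound to finitely many balls; the lower bound is the
  nonnegativity of \<open>u\<close>.\<close>

lemma subsolution_locally_bounded:
  fixes \<Omega> :: "'a set" and u :: "'a \<times> real \<Rightarrow> real"
  assumes pn: "2 * real DIM('a) / (real DIM('a) + 2) < p"
    and \<Omega>: "open \<Omega>" and sub: "weak_subsolution g A \<Omega> T u"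
    and nonneg: "AE z in lebesgue_on (\<Omega> \<times> {0<..<T}). u z \<ge> 0"
  shows "u \<in> L_inf_loc \<Omega> T"
  unfolding L_inf_loc_def
proof (intro CollectI allI impI)
  fix D t\<^sub>1 t\<^sub>2 assume cyl: "compact_cylinder \<Omega> T D t\<^sub>1 t\<^sub>2"
  define Q where "Q = D \<times> {t\<^sub>1<..<t\<^sub>2}"
  define W where "W = \<Omega> \<times> {0<..<T}"
  have K: "compact (closure Q)" "closure Q \<subseteq> W" and Do: "open D" using cyl by (auto simp: compact_cylinder_def Q_def W_def)
  have ol: "Q \<in> sets lebesgue" "W \<in> sets lebesgue"
    unfolding Q_def W_def by (intro open_sets_lebesgue open_Times Do \<Omega> open_greaterThanLessThan)+
  have "u \<in> V2_G g D t\<^sub>1 t\<^sub>2" using sub cyl by (auto simp: weak_subsolution_def V2_G_loc_def)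
  then have um: "u \<in> borel_measurable (lebesgue_on Q)" by (simp add: V2_G_def Linf_L2_def Q_def)
  have "\<forall>z\<in>closure Q. \<exists>r>0. \<exists>M. AE y in lborel. y \<in> ball z r \<longrightarrow> u y \<le> M"
  proof
    fix z assume "z \<in> closure Q"
    then have "(fst z, snd z) \<in> \<Omega> \<times> {0<..<T}" using K(2) by (auto simp: W_def)
    from subsolution_bounded_near_point[OF pn \<Omega> sub this]
    show "\<exists>r>0. \<exists>M. AE y in lborel. y \<in> ball z r \<longrightarrow> u y \<le> M" by simp
  qed
  then obtain r M where rM: "\<And>z. z \<in> closure Q \<Longrightarrow> r z > 0" "\<And>z. z \<in> closure Q \<Longrightarrow> AE y in lborel. y \<in> ball z (r z) \<longrightarrow> u y \<le> M z"
    by metis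
  have "\<exists>F\<subseteq>closure Q. finite F \<and> closure Q \<subseteq> (\<Union>z\<in>F. ball z (r z))"
  proof (rule compactE_image[OF K(1), of "closure Q" "\<lambda>z. ball z (r z)"])
    show "closure Q \<subseteq> (\<Union>z\<in>closure Q. ball z (r z))" using rM(1) by force
  qed auto
  then obtain F where F: "F \<subseteq> closure Q" "finite F" "closure Q \<subseteq> (\<Union>z\<in>F. ball z (r z))" by blast
  have "AE y in lborel. \<forall>z\<in>F. y \<in> ball z (r z) \<longrightarrow> u y \<le> M z"
    by (rule AE_finite_allI[OF F(2)]) (use rM(2) F(1) in blast)
  moreover have "AE y in lborel. y \<in> W \<longrightarrow> u y \<ge> 0"
    using nonneg[folded W_def] by (simp only: AE_lebesgue_on_iff[OF ol(2)])
  \<comment> \<open>The sum replaces a maximum over \<open>F\<close>, which would need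
    \<open>F\<close> to be nonempty.\<close>
  ultimately have "AE y in lborel. y \<in> Q \<longrightarrow> \<bar>u y\<bar> \<le> (\<Sum>z\<in>F. \<bar>M z\<bar>)"
  proof eventually_elim
    case (elim y)
    show ?case
    proof
      assume y: "y \<in> Q"
      then have yc: "y \<in> closure Q" using closure_subset by blast
      then obtain z where z: "z \<in> F" "y \<in> ball z (r z)" using F(3) by blast
      have "0 \<le> u y" using elim(2) yc K(2) by blast
      then have "\<bar>u y\<bar> \<le> \<bar>M z\<bar>" using elim(1) z by fastforce
      also have "\<dots> \<le> (\<Sum>z\<in>F. \<bar>M z\<bar>)" using F(2) z(1) by (intro member_le_sum) auto
      finally show "\<bar>u y\<bar> \<le> (\<Sum>z\<in>F. \<bar>M z\<bar>)" .
    qed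
  qed
  then have "AE y in lebesgue_on Q. \<bar>u y\<bar> \<le> (\<Sum>z\<in>F. \<bar>M z\<bar>)" using AE_lebesgue_on_iff[OF ol(1)] by simp
  then show "u \<in> L_inf (D \<times> {t\<^sub>1<..<t\<^sub>2})" using um unfolding L_inf_def Q_def[symmetric] by blast
qed

end

theorem theorem4p2:
  fixes \<Omega> :: "(real ^ 'n) set" and T :: real
    and g g' :: "real \<Rightarrow> real" and g\<^sub>0 g\<^sub>1 :: real
    and A :: "real ^ 'n \<Rightarrow> real ^ 'n" and DA :: "real ^ 'n \<Rightarrow> (real ^ 'n) \<Rightarrow>\<^sub>L (real ^ 'n)"
    and \<nu> L :: real
    and u :: "(real ^ 'n) \<times> real \<Rightarrow> real"
  assumes dim: "CARD('n) \<ge> 2"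
    and domain: "open \<Omega>" "connected \<Omega>" "bounded \<Omega>" "\<Omega> \<noteq> {}"
    and T_pos: "T > 0"
    and g_nonneg: "\<And>s. s \<ge> 0 \<Longrightarrow> g s \<ge> 0"
    and g_deriv: "\<And>s. s \<ge> 0 \<Longrightarrow> (g has_real_derivative g' s) (at s within {0..})"
    and g'_cont: "continuous_on {0..} g'"
    and g_pos: "\<And>s. s > 0 \<Longrightarrow> g s > 0"
    and g_growth: "\<And>s. s > 0 \<Longrightarrow> g\<^sub>0 - 1 \<le> s * g' s / g s \<and> s * g' s / g s \<le> g\<^sub>1 - 1"
    and g0_lower: "2 * real CARD('n) / (real CARD('n) + 2) < g\<^sub>0"
    and g0_le_g1: "g\<^sub>0 \<le> g\<^sub>1"
    and g_normalized: "integral {0..1} g = 1"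
    and A_deriv: "\<And>\<xi>. (A has_derivative blinfun_apply (DA \<xi>)) (at \<xi>)"
    and DA_cont: "continuous_on UNIV DA"
    and A_zero: "A 0 = 0"
    and constants: "0 < \<nu>" "\<nu> \<le> 1" "1 \<le> L"
    and A_elliptic: "\<And>\<xi> \<zeta>. \<xi> \<noteq> 0 \<Longrightarrow>
          blinfun_apply (DA \<xi>) \<zeta> \<bullet> \<zeta> \<ge> \<nu> * (g (norm \<xi>) / norm \<xi>) * (norm \<zeta>)\<^sup>2"
    and A_growth: "\<And>\<xi>. \<xi> \<noteq> 0 \<Longrightarrow> norm (DA \<xi>) \<le> L * (g (norm \<xi>) / norm \<xi>)"
    and u_nonneg: "AE z in lebesgue_on (\<Omega> \<times> {0<..<T}). u z \<ge> 0"
    and u_subsol: "weak_subsolution g A \<Omega> T u"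
  shows "u \<in> L_inf_loc \<Omega> T"
proof -
  \<comment> \<open>In dimension at least 2 the critical exponent 2n/(n + 2) is at least 1, which
    yields the condition \<open>1 < p\<close> of the locale.\<close>
  have "2 * (real CARD('n) + 2) \<le> 4 * real CARD('n)" using dim by simp
  then have "1 \<le> 2 * real CARD('n) / (real CARD('n) + 2)" by (simp add: field_simps)
  then have g0: "1 < g\<^sub>0" using g0_lower by linarith
  interpret orlicz_field g g' g\<^sub>0 g\<^sub>1 A DA \<nu> L
    by unfold_locales
       (use g_deriv g_nonneg g_pos g_growth g0 g0_le_g1 g_normalized A_deriv A_zero constants A_elliptic A_growth in auto)
  show ?thesis
    by (rule subsolution_locally_bounded[OF _ domain(1) u_subsol u_nonneg]) (use g0_lower in simp)
qed

end
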